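(* Consider the interconnected system $\Sigma:\dot x=f(x,u)$ of subsystems $\Sigma_i:\dot x_i=f_i(x_1,\dots,x_n,u)$, $i=1,\dots,n$, where each $\Sigma_i$ has an ISS Lyapunov function $V_i$ with gains $\gamma_{ij}\in\mathcal K_\infty\cup\{0\}$, $\gamma_{iu}\in\mathcal K\cup\{0\}$ and $\mu_i\in\mathrm{MAF}_{n+1}$, and let $\Gamma=(\gamma_{ij})$, $\Gamma_\mu$, $\overline\Gamma_\mu$ be the corresponding gain matrix and gain operators. Assume that the ISS condition is additive in the gain of $u$, that is, $$\overline\Gamma_\mu(V_1(x_1),\dots,V_n(x_n),\|u\|)=\Gamma_\mu(V_1(x_1),\dots,V_n(x_n))+\gamma_u(\|u\|)\quad\text{for all }x,u,$$ where $\gamma_u(\|u\|)=(\gamma_{1u}(\|u\|),\dots,\gamma_{nu}(\|u\|))^T$. If $\Gamma_\mu$ is irreducible and if there exists $\alpha\in\mathcal K_\infty$ such that for $D=\mathrm{diag}(\mathrm{id}+\alpha)$, i.e. $D(s)=(s_1+\alpha(s_1),\dots,s_n+\alpha(s_n))^T$, the strong small gain condition $$D\circ\Gamma_\mu(s)\not\ge s\quad\text{for all }s\in\mathbb R^n_+,\ s\ne0,$$ holds, then $\Sigma$ is ISS and an ISS Lyapunov function is given by $V(x)=\max_{i=1,\dots,n}\sigma_i^{-1}(V_i(x_i))$, where $\sigma\in\mathcal K_\infty^n$ is an arbitrary $\Omega$-path with respect to $D\circ\Gamma_\mu$.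
   Context: Notation: $\mathbb R_+=[0,\infty)$; for $v,w\in\mathbb R^n$, $v\ge w$ (resp. $v>w$) means $v_i\ge w_i$ (resp. $v_i>w_i$) for all $i$; $v\not\ge w$ is the negation of $v\ge w$. $\mathcal K$: continuous strictly increasing $\gamma:\mathbb R_+\to\mathbb R_+$ with $\gamma(0)=0$; $\mathcal K_\infty$: unbounded elements of $\mathcal K$; $\mathcal{KL}$: functions $\beta(s,t)$ of class $\mathcal K$ in $s$ and strictly decreasing to zero in $t$. $\alpha:\mathbb R_+\to\mathbb R_+$ is positive definite if it is continuous and $\alpha(r)=0$ iff $r=0$. System: $x=(x_1^T,\dots,x_n^T)^T$, $x_i\in\mathbb R^{N_i}$, $N=\sum_iN_i$, $u\in\mathbb R^M$, $f_i:\mathbb R^{N+M}\to\mathbb R^{N_i}$ continuous, $f=(f_1^T,\dots,f_n^T)^T$. Each $\Sigma_i$, with $x_j$ ($j\ne i$) and $u$ regarded as $L^\infty$ inputs, has for every initial condition a unique solution defined on $[0,\infty)$. $\Sigma$ is ISS if there are $\beta\in\mathcal{KL}$, $\gamma\in\mathcal K$ with $\|x(t;x_0,u)\|\le\beta(\|x_0\|,t)+\gamma(\|u\|_\infty)$ for all $x_0$, all $u\in L^\infty(\mathbb R_+,\mathbb R^M)$ and $t\ge0$. Lyapunov function candidates are functions $V:\mathbb R^N\to\mathbb R_+$ that are continuous, proper and positive definite (there are $\psi_1,\psi_2\in\mathcal K_\infty$ with $\psi_1(\|x\|)\le V(x)\le\psi_2(\|x\|)$) and locally Lipschitz on $\mathbb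 R^N\setminus\{0\}$. Such a $V$ is an ISS Lyapunov function for $\dot x=f(x,u)$ if there are $\gamma\in\mathcal K$ and a positive definite $\alpha$ such that at all points of differentiability of $V$: $V(x)\ge\gamma(\|u\|)\Rightarrow\nabla V(x)f(x,u)\le-\alpha(\|x\|)$. $\mathrm{MAF}_m$: continuous $\mu:\mathbb R^m_+\to\mathbb R_+$ with (M1) $\mu(s)\ge0$, and $\mu(s)>0$ if $s\ge0$, $s\ne0$; (M2) $x<y\Rightarrow\mu(x)<\mu(y)$; (M3) $\mu(x)\to\infty$ as $\|x\|\to\infty$. Given Lyapunov function candidates $V_j:\mathbb R^{N_j}\to\mathbb R_+$, $V_i$ is an ISS Lyapunov function for $\Sigma_i$ with $\mu_i\in\mathrm{MAF}_{n+1}$, $\gamma_{ij}\in\mathcal K_\infty\cup\{0\}$ ($\gamma_{ii}\equiv0$), $\gamma_{iu}\in\mathcal K\cup\{0\}$ if there is a positive definite $\alpha_i$ such that at all points of differentiability of $V_i$: $$V_i(x_i)\ge\mu_i(\gamma_{i1}(V_1(x_1)),\dots,\gamma_{in}(V_n(x_n)),\gamma_{iu}(\|u\|))\Rightarrow\nabla V_i(x_i)f_i(x,u)\le-\alpha_i(\|x_i\|).$$ Gain operators: $\overline\Gamma_\mu(s,r)_i=\mu_i(\gamma_{i1}(s_1),\dots,\gamma_{in}(s_n),\gamma_{iu}(r))$ for $s\in\mathbb R^n_+$, $r\ge0$, and $\Gamma_\mu(s)=\overline\Gamma_\mu(s,0)$. Standing compatibility assumption: $s\mapsto\mu_i(s,0)$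 satisfies (M2), and so does its restriction to the arguments $j$ with $\gamma_{ij}\not\equiv0$ (others set to $0$). $\Gamma_\mu$ is irreducible means $\Gamma$ is irreducible, i.e. its $0$-$1$ adjacency matrix $A_\Gamma$ ($a_{ij}=1$ iff $\gamma_{ij}\not\equiv0$) is irreducible. An $\Omega$-path with respect to an operator $T:\mathbb R^n_+\to\mathbb R^n_+$ is a continuous $\sigma=(\sigma_1,\dots,\sigma_n)\in\mathcal K_\infty^n$ such that (i) each $\sigma_i^{-1}$ is locally Lipschitz on $(0,\infty)$; (ii) for every compact $K\subset(0,\infty)$ there are $0<c<C$ with $c\le(\sigma_i^{-1})'(r)\le C$ for all $i$ and all points $r\in K$ of differentiability of $\sigma_i^{-1}$; (iii) $T(\sigma(r))<\sigma(r)$ for all $r>0$. *)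

theory Defs
  imports "HOL-Analysis.Analysis" "HOL-Probability.Essential_Supremum"
begin

text \<open>
  Functions on \<open>[0,\<infinity>)\<close> are total functions \<open>real \<Rightarrow> real\<close> of which only the values on \<open>{0..}\<close>
  matter. In class \<open>\<K>\<close>, nonnegativity on \<open>{0..}\<close> follows from strict monotonicity and \<open>\<gamma> 0 = 0\<close>.
\<close>

definition class_K :: "(real \<Rightarrow> real) \<Rightarrow> bool" where
  "class_K \<gamma> \<longleftrightarrow> continuous_on {0..} \<gamma> \<and> strict_mono_on {0..} \<gamma> \<and> \<gamma> 0 = 0"

definition class_K_inf :: "(real \<Rightarrow> real) \<Rightarrow> bool" where
  "class_K_inf \<gamma> \<longleftrightarrow> class_K \<gamma> \<and> \<not> bounded (\<gamma> ` {0..})"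

definition zero_fun :: "(real \<Rightarrow> real) \<Rightarrow> bool" where
  "zero_fun \<gamma> \<longleftrightarrow> (\<forall>r\<ge>0. \<gamma> r = 0)"

text \<open>Strict decrease in the second argument can only be asked for \<open>s > 0\<close>, as \<open>\<beta> 0 t = 0\<close>.\<close>

definition class_KL :: "(real \<Rightarrow> real \<Rightarrow> real) \<Rightarrow> bool" where
  "class_KL \<beta> \<longleftrightarrow>
     (\<forall>t\<ge>0. class_K (\<lambda>s. \<beta> s t)) \<and>
     (\<forall>s>0. (\<forall>t\<ge>0. \<forall>t'>t. \<beta> s t' < \<beta> s t) \<and> ((\<beta> s) \<longlongrightarrow> 0) at_top)"

definition pos_def_fun :: "(real \<Rightarrow> real) \<Rightarrow> bool" where
  "pos_def_fun \<alpha> \<longleftrightarrow> continuous_on {0..} \<alpha> \<and> (\<forall>r\<ge>0. 0 \<le> \<alpha> r \<and> (\<alpha> r = 0 \<longleftrightarrow> r = 0))"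

text \<open>
  The library's \<open>v \<le> w\<close> on vectors is componentwise, but its \<open>v < w\<close> only means
  \<open>v \<le> w \<and> v \<noteq> w\<close>; the strict order needed here is strict in every component.
\<close>

definition vless :: "real ^ 'n \<Rightarrow> real ^ 'n \<Rightarrow> bool" where
  "vless v w \<longleftrightarrow> (\<forall>i. v $ i < w $ i)"

definition MAF :: "(real ^ 'k \<Rightarrow> real) \<Rightarrow> bool" where
  "MAF \<mu> \<longleftrightarrow>
     continuous_on {s. 0 \<le> s} \<mu> \<and>
     (\<forall>s\<ge>0. 0 \<le> \<mu> s \<and> (s \<noteq> 0 \<longrightarrow> 0 < \<mu> s)) \<and>
     (\<forall>x\<ge>0. \<forall>y\<ge>0. vless x y \<longrightarrow> \<mu> x < \<mu> y) \<and>
     filterlim \<mu> at_top (inf at_infinity (principal {s. 0 \<le> s}))"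

text \<open>
  Vectors with \<open>n + 1\<close> entries are indexed by \<open>'n option\<close>: entry \<open>Some j\<close> is the \<open>j\<close>-th one and
  \<open>None\<close> is the additional last one (the slot of the external input).
\<close>

definition extend :: "real ^ 'n \<Rightarrow> real \<Rightarrow> real ^ ('n::finite option)" where
  "extend s r = (\<chi> k. case k of None \<Rightarrow> r | Some j \<Rightarrow> s $ j)"

text \<open>
  Compatibility of \<open>\<mu>\<close> with a row of gains: strict monotonicity
  (with respect to \<open>vless\<close>) holds for \<open>\<mu>(\<cdot>,0)\<close> and for its restriction to
  the arguments with nonzero gain. For a row of zero gains there is no restricted function, whence
  the guard (without it the second clause would be contradictory for such a row).
\<close>

definition compatible :: "(real ^ ('n::finite option) \<Rightarrow> real) \<Rightarrow> ('n \<Rightarrow> real \<Rightarrow> real) \<Rightarrow> bool" where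
  "compatible \<mu> g \<longleftrightarrow>
     (\<forall>x\<ge>0. \<forall>y\<ge>0. vless x y \<longrightarrow> \<mu> (extend x 0) < \<mu> (extend y 0)) \<and>
     (let J = {j. \<not> zero_fun (g j)} in
        J \<noteq> {} \<longrightarrow>
        (\<forall>x\<ge>0. \<forall>y\<ge>0.
           (\<forall>j. j \<notin> J \<longrightarrow> x $ j = 0 \<and> y $ j = 0) \<longrightarrow> (\<forall>j\<in>J. x $ j < y $ j) \<longrightarrow>
           \<mu> (extend x 0) < \<mu> (extend y 0)))"

definition gain_op_ext ::
  "('n \<Rightarrow> real ^ ('n::finite option) \<Rightarrow> real) \<Rightarrow> ('n \<Rightarrow> 'n \<Rightarrow> real \<Rightarrow> real) \<Rightarrow> ('n \<Rightarrow> real \<Rightarrow> real) \<Rightarrow>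
     real ^ 'n \<Rightarrow> real \<Rightarrow> real ^ 'n" where
  "gain_op_ext \<mu> \<gamma> \<gamma>u s r = (\<chi> i. \<mu> i (extend (\<chi> j. \<gamma> i j (s $ j)) (\<gamma>u i r)))"

definition gain_op ::
  "('n \<Rightarrow> real ^ ('n::finite option) \<Rightarrow> real) \<Rightarrow> ('n \<Rightarrow> 'n \<Rightarrow> real \<Rightarrow> real) \<Rightarrow> ('n \<Rightarrow> real \<Rightarrow> real) \<Rightarrow>
     real ^ 'n \<Rightarrow> real ^ 'n" where
  "gain_op \<mu> \<gamma> \<gamma>u s = gain_op_ext \<mu> \<gamma> \<gamma>u s 0"

definition diag_op :: "(real \<Rightarrow> real) \<Rightarrow> real ^ 'n \<Rightarrow> real ^ 'n" where
  "diag_op \<alpha> s = (\<chi> i. s $ i + \<alpha> (s $ i))"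

definition adjacency_matrix :: "('n \<Rightarrow> 'n \<Rightarrow> real \<Rightarrow> real) \<Rightarrow> real ^ 'n ^ 'n" where
  "adjacency_matrix \<gamma> = (\<chi> i j. if zero_fun (\<gamma> i j) then 0 else 1)"

text \<open>
  A matrix is reducible if a simultaneous permutation of rows and columns makes it block
  triangular with two nonempty diagonal blocks, \<open>I\<close> being the index set of one of them.
  Every \<open>1 \<times> 1\<close> matrix is irreducible in this convention.
\<close>

definition irreducible_matrix :: "real ^ 'n ^ 'n \<Rightarrow> bool" where
  "irreducible_matrix A \<longleftrightarrow>
     \<not> (\<exists>I. I \<noteq> {} \<and> I \<noteq> UNIV \<and> (\<forall>i\<in>I. \<forall>j\<in>- I. A $ i $ j = 0))"

definition loc_lipschitz_on :: "'a::metric_space set \<Rightarrow> ('a \<Rightarrow> 'b::metric_space) \<Rightarrow> bool" where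
  "loc_lipschitz_on S g \<longleftrightarrow> (\<forall>x\<in>S. \<exists>e>0. \<exists>L. L-lipschitz_on (cball x e \<inter> S) g)"

abbreviation inv_K :: "(real \<Rightarrow> real) \<Rightarrow> real \<Rightarrow> real" where
  "inv_K \<sigma> \<equiv> inv_into {0..} \<sigma>"

definition Omega_path :: "(real ^ 'n \<Rightarrow> real ^ 'n) \<Rightarrow> ('n \<Rightarrow> real \<Rightarrow> real) \<Rightarrow> bool" where
  "Omega_path T \<sigma> \<longleftrightarrow>
     (\<forall>i. class_K_inf (\<sigma> i)) \<and>
     (\<forall>i. loc_lipschitz_on {0<..} (inv_K (\<sigma> i))) \<and>
     (\<forall>K. compact K \<and> K \<subseteq> {0<..} \<longrightarrow>
        (\<exists>c C. 0 < c \<and> c < C \<and>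
           (\<forall>i. \<forall>r\<in>K. \<forall>d. (inv_K (\<sigma> i) has_real_derivative d) (at r) \<longrightarrow> c \<le> d \<and> d \<le> C))) \<and>
     (\<forall>r>0. vless (T (\<chi> i. \<sigma> i r)) (\<chi> i. \<sigma> i r))"

text \<open>
  The state space \<open>\<real>\<^sup>N\<close> is \<open>real ^ 'm\<close>, and \<open>blk k\<close> is the number of the subsystem to which
  coordinate \<open>k\<close> belongs, so \<open>N\<^sub>i = card {k. blk k = i}\<close>. The space of the \<open>i\<close>-th substate is
  identified, isometrically, with the coordinate subspace \<open>block_space blk i\<close>, and \<open>x\<^sub>i\<close> with
  \<open>block blk i x\<close>.
\<close>

definition block_space :: "('m \<Rightarrow> 'n) \<Rightarrow> 'n \<Rightarrow> (real ^ 'm) set" where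
  "block_space blk i = {x. \<forall>k. blk k \<noteq> i \<longrightarrow> x $ k = 0}"

definition block :: "('m \<Rightarrow> 'n) \<Rightarrow> 'n \<Rightarrow> real ^ 'm \<Rightarrow> real ^ 'm" where
  "block blk i x = (\<chi> k. if blk k = i then x $ k else 0)"

definition set_block :: "('m \<Rightarrow> 'n) \<Rightarrow> 'n \<Rightarrow> real ^ 'm \<Rightarrow> real ^ 'm \<Rightarrow> real ^ 'm" where
  "set_block blk i w z = (\<chi> k. if blk k = i then z $ k else w $ k)"

definition Linf :: "(real \<Rightarrow> 'a::euclidean_space) \<Rightarrow> bool" where
  "Linf u \<longleftrightarrow> u \<in> borel_measurable (lebesgue_on {0..}) \<and>
     esssup (lebesgue_on {0..}) (\<lambda>t. ereal (norm (u t))) < \<infinity>"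

definition Linf_norm :: "(real \<Rightarrow> 'a::euclidean_space) \<Rightarrow> real" where
  "Linf_norm u = real_of_ereal (esssup (lebesgue_on {0..}) (\<lambda>t. ereal (norm (u t))))"

text \<open>
  Caratheodory solutions of \<open>x' = g t x\<close>, \<open>x(0) = x0\<close> on an interval \<open>I\<close> with left endpoint
  \<open>0 \<in> I\<close>, in integrated form (with the Lebesgue integral): \<open>x\<close> is locally absolutely continuous
  and the equation holds almost everywhere.
\<close>

definition is_solution ::
  "(real \<Rightarrow> 'a \<Rightarrow> 'a) \<Rightarrow> real set \<Rightarrow> 'a \<Rightarrow> (real \<Rightarrow> 'a::euclidean_space) \<Rightarrow> bool" where
  "is_solution g I x0 x \<longleftrightarrow>
     (\<forall>t\<in>I. (\<lambda>s. g s (x s)) absolutely_integrable_on {0..t} \<and>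
            x t = x0 + integral {0..t} (\<lambda>s. g s (x s)))"

text \<open>
  The \<open>i\<close>-th subsystem with the other substates (the blocks \<open>j \<noteq> i\<close> of \<open>w\<close>) and \<open>u\<close> as
  inputs has a unique solution on \<open>[0,\<infinity>)\<close>.
\<close>

definition subsystem_well_posed ::
  "('m \<Rightarrow> 'n) \<Rightarrow> (real ^ 'm \<Rightarrow> real ^ 'p \<Rightarrow> real ^ 'm) \<Rightarrow> 'n \<Rightarrow> bool" where
  "subsystem_well_posed blk f i \<longleftrightarrow>
     (\<forall>\<xi>\<in>block_space blk i. \<forall>w u. Linf w \<and> Linf u \<longrightarrow>
        (let g = (\<lambda>t z. block blk i (f (set_block blk i (w t) z) (u t))) in
           \<exists>z. is_solution g {0..} \<xi> z \<and>
               (\<forall>z'. is_solution g {0..} \<xi> z' \<longrightarrow> (\<forall>t\<ge>0. z' t = z t))))"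

text \<open>
  Existence of \<open>x(t;x0,u)\<close> for all \<open>t \<ge> 0\<close> is part of the property. Solutions of the
  interconnection need not be unique (well-posedness of the subsystems does not imply it), so the
  estimate is required of every solution, including those given on a bounded interval only.
\<close>

definition ISS :: "('a \<Rightarrow> 'b::euclidean_space \<Rightarrow> 'a::euclidean_space) \<Rightarrow> bool" where
  "ISS f \<longleftrightarrow>
     (\<exists>\<beta> \<gamma>. class_KL \<beta> \<and> class_K \<gamma> \<and>
        (\<forall>x0 u. Linf u \<longrightarrow>
           (\<exists>x. is_solution (\<lambda>t z. f z (u t)) {0..} x0 x) \<and>
           (\<forall>T x. is_solution (\<lambda>t z. f z (u t)) {0..<T} x0 x \<longrightarrow>
              (\<forall>t\<in>{0..<T}. norm (x t) \<le> \<beta> (norm x0) t + \<gamma> (Linf_norm u)))))"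

text \<open>The parameter \<open>S\<close> is the whole space or, for a subsystem, its \<open>block_space\<close>.\<close>

definition lyapunov_candidate :: "'a::euclidean_space set \<Rightarrow> ('a \<Rightarrow> real) \<Rightarrow> bool" where
  "lyapunov_candidate S V \<longleftrightarrow>
     continuous_on S V \<and>
     (\<exists>\<psi>\<^sub>1 \<psi>\<^sub>2. class_K_inf \<psi>\<^sub>1 \<and> class_K_inf \<psi>\<^sub>2 \<and>
        (\<forall>x\<in>S. \<psi>\<^sub>1 (norm x) \<le> V x \<and> V x \<le> \<psi>\<^sub>2 (norm x))) \<and>
     loc_lipschitz_on (S - {0}) V"

text \<open>
  Points of differentiability are those with a Frechet derivative \<open>D\<close>, and then
  \<open>\<nabla>V(x) v = D v\<close>.
\<close>

definition ISS_lyapunov ::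
  "('a \<Rightarrow> 'b::euclidean_space \<Rightarrow> 'a::euclidean_space) \<Rightarrow> ('a \<Rightarrow> real) \<Rightarrow> bool" where
  "ISS_lyapunov f V \<longleftrightarrow>
     lyapunov_candidate UNIV V \<and>
     (\<exists>\<gamma> \<alpha>. class_K \<gamma> \<and> pos_def_fun \<alpha> \<and>
        (\<forall>x u D. (V has_derivative D) (at x) \<longrightarrow> V x \<ge> \<gamma> (norm u) \<longrightarrow>
           D (f x u) \<le> - \<alpha> (norm x)))"

text \<open>
  The family \<open>V\<close> consists of functions on the block spaces; \<open>D\<close> is unique on
  \<open>block_space blk i\<close>, to which \<open>f\<^sub>i(x,u)\<close> belongs.
\<close>

definition subsystem_ISS_lyapunov ::
  "('m \<Rightarrow> 'n) \<Rightarrow> (real ^ 'm \<Rightarrow> real ^ 'p \<Rightarrow> real ^ 'm) \<Rightarrow> ('n \<Rightarrow> real ^ 'm \<Rightarrow> real) \<Rightarrow>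
     ('n \<Rightarrow> real ^ ('n::finite option) \<Rightarrow> real) \<Rightarrow> ('n \<Rightarrow> 'n \<Rightarrow> real \<Rightarrow> real) \<Rightarrow> ('n \<Rightarrow> real \<Rightarrow> real) \<Rightarrow>
     'n \<Rightarrow> bool" where
  "subsystem_ISS_lyapunov blk f V \<mu> \<gamma> \<gamma>u i \<longleftrightarrow>
     (\<exists>\<alpha>. pos_def_fun \<alpha> \<and>
        (\<forall>x u D. (V i has_derivative D) (at (block blk i x) within block_space blk i) \<longrightarrow>
           V i (block blk i x) \<ge>
             \<mu> i (extend (\<chi> j. \<gamma> i j (V j (block blk j x))) (\<gamma>u i (norm u))) \<longrightarrow>
           D (block blk i (f x u)) \<le> - \<alpha> (norm (block blk i x))))"

end

(*
  The points where the hypotheses give information are the points of differentiability of the V_i, so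
  everything non-smooth rests on Rademacher's theorem: if a locally Lipschitz W satisfies D W(y) v <= c
  at almost all y, then averaging W over a small ball and differentiating the average along v gives
  W(x + h v) - W(x) <= c h. Applied to V_i this yields V_i(x_i + h f_i) <= V_i(x_i) - c h for every
  active index i (an index attaining the maximum in V), and a lower bound on (sigma_i^-1)' carries the
  decrease over to V. At an active index the implication premise holds with strict inequality in a neighbourhood:
  sigma is an Omega-path for D o Gamma, so sigma_i(r) - Gamma_i(sigma(r)) exceeds
  min (alpha(sigma_i(r)/2)) (sigma_i(r)/2), which absorbs the additive term gamma_iu(|u|).

  An ISS Lyapunov function yields ISS by comparison with w' = - a(w), where a is a 1-Lipschitz lower
  envelope of the decay rate. Solutions exist by Tonelli's delayed approximations for f clamped to a
  large ball, which the a priori bound shows is never left.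

  For the Omega-path, Brouwer's theorem gives points b with T b <= b of every size. By irreducibility
  the small gain condition survives replacing T by T o (id + eps) for some positive definite eps.
  Suitably shifted orbits of the new operator from larger and larger b converge to a bi-infinite orbit,
  monotone from 0 to infinity, and the slack eps makes a perturbation of it strictly increasing
  and strictly decaying under T. Its piecewise linear interpolation in ln r is the path.
*)

theory Submission
  imports Defs "HOL-Complex_Analysis.Great_Picard"
begin


section \<open>Rademacher's theorem and descent along directions\<close>

text \<open>Where V is differentiable, the V_i attaining the maximum may fail to be, and a
  trajectory may stay at such points for all time. The hypotheses are silent there, so decrease is
  phrased as a bound on finite increments or right difference quotients, and derivative bounds are
  collected from nearby points. One device supplies the rate functions: a quantity that is bounded
  below by a positive constant on every layer a \<le> n \<le> b has a positive definite, 1-Lipschitz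
  minorant of n. It turns decay in terms of |x| into decay in terms of V, yields the decay rate of
  the maximum, and produces the perturbation eps. Lipschitz constant 1 makes id + eps/2 monotone and
  lets eps be compared at s and at T s. The obstacle to finding eps is that a function of one
  component of s has to minorise the margin of T, while the set of all s with that component
  prescribed is unbounded and the margin need not be bounded below on it. Irreducibility removes
  this: after sufficiently many steps each component controls all the others, so the relevant points
  form a bounded set.\<close>

lemma lipschitz_integral_representation:
  fixes g :: "real \<Rightarrow> real"
  assumes "L-lipschitz_on UNIV g"
  shows "\<exists>f. \<forall>a b. a \<le> b \<longrightarrow> (f has_integral (g b - g a)) {a..b}"
proof -
  have L0: "0 \<le> L" using assms lipschitz_on_nonneg by blast
  have gl: "\<bar>g y - g x\<bar> \<le> L * \<bar>y - x\<bar>" for x y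
    using lipschitz_onD[OF assms, of y x] by (simp add: dist_real_def)
  \<comment> \<open>The summand gives \<open>F\<close> slope at least 1, so \<open>F\<close> is an
    increasing bijection of the line and the length of F(A) is a measure in A. It is subtracted
    again at the end.\<close>
  define F where "F t = g t + (L + 1) * t" for t
  have Fmono: "y - x \<le> F y - F x" if "x \<le> y" for x y
    using gl[of y x] that by (auto simp: F_def algebra_simps abs_if split: if_splits)
  have Fsm: "F x < F y \<longleftrightarrow> x < y" for x y
    using Fmono[of x y] Fmono[of y x] by linarith
  have Flip: "\<bar>F y - F x\<bar> \<le> (2 * L + 1) * \<bar>y - x\<bar>" for x y
  proof -
    have "F y - F x = (g y - g x) + (L + 1) * (y - x)" by (simp add: F_def algebra_simps)
    also have "\<bar>\<dots>\<bar> \<le> \<bar>g y - g x\<bar> + (L + 1) * \<bar>y - x\<bar>"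
      using abs_triangle_ineq[of "g y - g x" "(L + 1) * (y - x)"] L0 by (simp add: abs_mult)
    finally show ?thesis using gl[of y x] by (simp add: algebra_simps)
  qed
  have Fcont: "continuous_on S F" for S
  proof (rule continuous_on_subset)
    show "continuous_on UNIV F"
      unfolding F_def using lipschitz_on_continuous_on[OF assms] by (intro continuous_intros)
  qed simp
  have inj: "inj F" using Fsm by (intro linorder_injI) (metis less_irrefl)
  have surj: "surj F"
  proof -
    have "\<exists>x. F x = y" for y
    proof -
      define R where "R = \<bar>y - F 0\<bar>"
      have "F (- R) \<le> y" "y \<le> F R"
        using Fmono[of "-R" 0] Fmono[of 0 R] by (auto simp: R_def abs_if split: if_splits)
      then show ?thesis
        using IVT'[of F "-R" y R] Fcont by (auto simp: R_def)
    qed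
    then show ?thesis by (metis surjI)
  qed
  define G where "G = inv F"
  have GF: "G (F x) = x" and FG: "F (G y) = y" for x y
    using inj surj by (auto simp: G_def surj_f_inv_f)
  have Gm: "mono G" 
    by (intro monoI) (metis FG Fsm linorder_not_le)
  have Gmeas: "G \<in> borel_measurable borel" by (rule borel_measurable_mono[OF Gm])
  \<comment> \<open>The push-forward of Lebesgue measure under the inverse \<open>G\<close> measures
    A by the length of F(A). Lipschitz maps preserve null sets, so Radon-Nikodym yields a density,
    which plays the role of the derivative of \<open>F\<close>.\<close>
  define N where "N = distr lborel borel G"
  have emN: "emeasure N A = emeasure lborel (F ` A)" if "A \<in> sets borel" for A
  proof -
    have "G -` A = F ` A" using GF FG by (auto simp: image_iff) metis
    then show ?thesis unfolding N_def using emeasure_distr[of G lborel borel A] Gmeas that by simp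
  qed
  have ac: "absolutely_continuous lborel N"
    unfolding absolutely_continuous_def
  proof
    fix A :: "real set" assume A: "A \<in> null_sets lborel"
    then have Ab: "A \<in> sets borel" by auto
    have "A \<in> null_sets lebesgue" using A by (rule null_sets_completionI)
    then have "negligible A" by (simp add: negligible_iff_null_sets)
    then have "negligible (F ` A)"
    proof (rule negligible_locally_Lipschitz_image[rotated])
      fix x assume "x \<in> A"
      show "\<exists>T B. open T \<and> x \<in> T \<and> (\<forall>y\<in>A \<inter> T. norm (F y - F x) \<le> B * norm (y - x))"
        using Flip by (intro exI[of _ UNIV] exI[of _ "2*L+1"]) auto
    qed simp
    moreover have "F ` A \<in> sets borel"
    proof -
      have "F ` A = G -` A \<inter> space borel" using GF FG by (auto simp: image_iff) metis
      then show ?thesis using measurable_sets[OF Gmeas Ab] by simp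
    qed
    ultimately have "emeasure lborel (F ` A) = 0"
      by (simp add: negligible_iff_null_sets null_sets_completion_iff null_setsD1)
    then show "A \<in> null_sets N"
      using emN[OF Ab] Ab by (auto simp: null_sets_def N_def)
  qed
  have "sets N = sets lborel" by (simp add: N_def)
  from sigma_finite_measure.Radon_Nikodym[OF sigma_finite_lborel ac this] obtain f where f: "f \<in> borel_measurable lborel" "density lborel f = N"
    by auto
  have nnint: "(\<integral>\<^sup>+x\<in>{a..b}. f x \<partial>lborel) = ennreal (F b - F a)" if "a \<le> b" for a b
  proof -
    have "(\<integral>\<^sup>+x\<in>{a..b}. f x \<partial>lborel) = emeasure N {a..b}"
      unfolding f(2)[symmetric] by (rule emeasure_density[symmetric]) (use f(1) in auto)
    also have "\<dots> = emeasure lborel (F ` {a..b})" by (simp add: emN)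
    also have "F ` {a..b} = {F a..F b}"
    proof -
      have le: "F x \<le> F y \<longleftrightarrow> x \<le> y" for x y using Fsm[of y x] by linarith
      have "y \<in> F ` {a..b}" if "F a \<le> y" "y \<le> F b" for y
        using that le[of a "G y"] le[of "G y" b] FG[of y] by (metis atLeastAtMost_iff imageI)
      then show ?thesis using le by auto
    qed
    also have "emeasure lborel {F a..F b} = ennreal (F b - F a)"
      using Fmono[OF that] that by simp
    finally show ?thesis .
  qed
  have fin: "AE x in lborel. f x \<noteq> \<infinity>"
  proof -
    have 1: "AE x in lborel. x \<in> {-real n..real n} \<longrightarrow> f x \<noteq> \<infinity>" for n
    proof -
      have "(\<integral>\<^sup>+x. f x * indicator {-real n..real n} x \<partial>lborel) \<noteq> \<infinity>"
        using nnint[of "- real n" "real n"] by simp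
      moreover have "(\<lambda>x. f x * indicator {-real n..real n} x) \<in> borel_measurable lborel"
        using f(1) by measurable
      ultimately have "AE x in lborel. f x * indicator {-real n..real n} x \<noteq> \<infinity>"
        by (intro nn_integral_PInf_AE) auto
      then show ?thesis by eventually_elim (auto simp: indicator_def)
    qed
    have "AE x in lborel. \<forall>n. x \<in> {-real n..real n} \<longrightarrow> f x \<noteq> \<infinity>"
      unfolding AE_all_countable using 1 by blast
    then show ?thesis
    proof eventually_elim
      case (elim x)
      obtain n where "\<bar>x\<bar> \<le> real n" using real_arch_simple by blast
      then show ?case using elim by (auto simp: abs_le_iff)
    qed
  qed
  show ?thesis
  proof (intro exI[of _ "\<lambda>x. enn2real (f x) - (L + 1)"] allI impI)
    fix a b :: real assume ab: "a \<le> b"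
    have "(\<integral>\<^sup>+x. ennreal (enn2real (f x) * indicator {a..b} x) \<partial>lborel) = (\<integral>\<^sup>+x\<in>{a..b}. f x \<partial>lborel)"
      using fin by (intro nn_integral_cong_AE) (auto simp: indicator_def less_top)
    then have "(\<integral>\<^sup>+x. ennreal (enn2real (f x) * indicator {a..b} x) \<partial>lborel) = ennreal (F b - F a)"
      by (simp add: nnint[OF ab])
    then have "((\<lambda>x. enn2real (f x) * indicator {a..b} x) has_integral (F b - F a)) UNIV"
      using f(1) Fmono[OF ab] ab by (intro nn_integral_has_integral) auto
    then have "((\<lambda>x. if x \<in> {a..b} then enn2real (f x) else 0) has_integral (F b - F a)) UNIV"
      by (rule has_integral_eq[rotated]) (auto simp: indicator_def)
    then have "((\<lambda>x. enn2real (f x)) has_integral (F b - F a)) {a..b}"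
      by (simp only: has_integral_restrict_UNIV)
    moreover have "((\<lambda>x. L + 1) has_integral ((L + 1) * (b - a))) {a..b}"
      using has_integral_const_real[of "L + 1" a b] ab by (simp add: algebra_simps)
    ultimately have "((\<lambda>x. enn2real (f x) - (L + 1)) has_integral ((F b - F a) - (L + 1) * (b - a))) {a..b}"
      by (rule has_integral_diff)
    then show "((\<lambda>x. enn2real (f x) - (L + 1)) has_integral (g b - g a)) {a..b}"
      by (simp add: F_def algebra_simps)
  qed
qed

lemma indefinite_integral_right_quotients_AE:
  fixes f :: "real \<Rightarrow> 'b::euclidean_space"
  assumes "\<And>a b. f integrable_on {a..b}"
  shows "\<exists>N. negligible N \<and>
    (\<forall>t. t \<notin> N \<longrightarrow> ((\<lambda>h. integral {t..t + h} f /\<^sub>R h) \<longlongrightarrow> f t) (at_right 0))"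
proof -
  obtain N where N: "negligible N" "\<And>x e. \<lbrakk>x \<notin> N; 0 < e\<rbrakk> \<Longrightarrow>
               \<exists>d>0. \<forall>h. 0 < h \<and> h < d \<longrightarrow>
                         norm(integral (cbox x (x + h *\<^sub>R One)) f /\<^sub>R h ^ DIM(real) - f x) < e"
    by (rule integrable_ccontinuous_explicit[of f]) (use assms in auto)
  show ?thesis
  proof (intro exI[of _ N] conjI N(1) allI impI)
    fix t assume "t \<notin> N"
    show "((\<lambda>h. integral {t..t + h} f /\<^sub>R h) \<longlongrightarrow> f t) (at_right 0)"
    proof (rule tendstoI)
      fix e :: real assume "0 < e"
      from N(2)[OF \<open>t \<notin> N\<close> this] obtain d where d: "d > 0" "\<And>h. 0 < h \<Longrightarrow> h < d \<Longrightarrow> 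
          norm(integral (cbox t (t + h *\<^sub>R One)) f /\<^sub>R h ^ DIM(real) - f t) < e" by blast
      show "\<forall>\<^sub>F h in at_right 0. dist (integral {t..t + h} f /\<^sub>R h) (f t) < e"
        unfolding eventually_at_right_field using d by (intro exI[of _ d]) (auto simp: dist_norm)
    qed
  qed
qed

text \<open>This is Lebesgue's differentiation theorem for the density of \<open>g\<close>. Only the
  steps 1/(k+1) are recorded, as the directional quotients use no others.\<close>

lemma lipschitz_right_quotients_AE:
  fixes g :: "real \<Rightarrow> real"
  assumes "L-lipschitz_on UNIV g"
  shows "\<exists>N. negligible N \<and>
    (\<forall>t. t \<notin> N \<longrightarrow> convergent (\<lambda>k. real (Suc k) * (g (t + 1 / real (Suc k)) - g t)))"
proof -
  obtain f where f: "\<And>a b. a \<le> b \<Longrightarrow> (f has_integral (g b - g a)) {a..b}"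
    using lipschitz_integral_representation[OF assms] by blast
  have "f integrable_on {a..b}" for a b
    using f[of a b] by (cases "a \<le> b") (auto simp: has_integral_integrable)
  from indefinite_integral_right_quotients_AE[OF this] obtain N where N: "negligible N"
    "\<forall>t. t \<notin> N \<longrightarrow> ((\<lambda>h. integral {t..t + h} f /\<^sub>R h) \<longlongrightarrow> f t) (at_right 0)"
    by (elim exE conjE)
  show ?thesis
  proof (intro exI[of _ N] conjI N(1) allI impI)
    fix t assume "t \<notin> N"
    have "filterlim (\<lambda>k. 1 / real (Suc k)) (at_right 0) sequentially"
      unfolding filterlim_at using LIMSEQ_inverse_real_of_nat by (auto simp: inverse_eq_divide)
    from filterlim_compose[OF N(2)[rule_format, OF \<open>t \<notin> N\<close>] this]
    have "(\<lambda>k. integral {t..t + 1 / real (Suc k)} f /\<^sub>R (1 / real (Suc k))) \<longlonglongrightarrow> f t" .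
    moreover have "integral {t..t + 1 / real (Suc k)} f = g (t + 1 / real (Suc k)) - g t" for k
      using f[of t "t + 1 / real (Suc k)"] by (intro integral_unique) auto
    ultimately show "convergent (\<lambda>k. real (Suc k) * (g (t + 1 / real (Suc k)) - g t))"
      by (auto simp: convergent_def)
  qed
qed

text \<open>Translation invariance makes the measure of \<open>B\<close> the average over t in [0,1]
  of the measures of its translates by -t v. After exchanging the integrals the inner one runs along
  a line, where it vanishes.\<close>

lemma negligible_if_negligible_on_lines:
  fixes v :: "'a::euclidean_space"
  assumes B: "B \<in> sets borel" and lines: "\<And>x. negligible {t. x + t *\<^sub>R v \<in> B}"
  shows "B \<in> null_sets lborel"
proof -
  have trans: "(\<integral>\<^sup>+x. indicator B (x + t *\<^sub>R v) \<partial>lborel) = emeasure lborel B" for t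
  proof -
    have "emeasure lborel B = (\<integral>\<^sup>+x. indicator B x \<partial>distr lborel borel ((+) (t *\<^sub>R v)))"
      using B by (simp add: lborel_distr_plus)
    also have "\<dots> = (\<integral>\<^sup>+x. indicator B (t *\<^sub>R v + x) \<partial>lborel)"
      using B by (intro nn_integral_distr) auto
    finally show ?thesis by (simp add: add.commute)
  qed
  have m: "(\<lambda>(t, x). indicator {0..1::real} t * indicator B (x + t *\<^sub>R v) :: ennreal)
      \<in> borel_measurable (lborel \<Otimes>\<^sub>M lborel)"
  proof -
    have "(\<lambda>p::real \<times> 'a. snd p + fst p *\<^sub>R v) \<in> borel_measurable (lborel \<Otimes>\<^sub>M lborel)"
      by measurable
    from measurable_compose[OF this, of "indicator B" borel] B
    have "(\<lambda>p::real \<times> 'a. indicator B (snd p + fst p *\<^sub>R v) :: ennreal) \<in> borel_measurable (lborel \<Otimes>\<^sub>M lborel)"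
      by simp
    then show ?thesis unfolding case_prod_beta by measurable
  qed
  have "emeasure lborel B = (\<integral>\<^sup>+t. indicator {0..1::real} t * emeasure lborel B \<partial>lborel)"
    by (subst nn_integral_multc) auto
  also have "\<dots> = (\<integral>\<^sup>+t. (\<integral>\<^sup>+x. indicator {0..1::real} t * indicator B (x + t *\<^sub>R v) \<partial>lborel) \<partial>lborel)"
  proof (intro nn_integral_cong)
    fix t :: real
    have "(\<lambda>x. indicator B (x + t *\<^sub>R v) :: ennreal) \<in> borel_measurable lborel"
      using B by measurable
    then show "indicator {0..1::real} t * emeasure lborel B =
        (\<integral>\<^sup>+x. indicator {0..1::real} t * indicator B (x + t *\<^sub>R v) \<partial>lborel)"
      by (subst nn_integral_cmult) (auto simp: trans)
  qed
  also have "\<dots> = (\<integral>\<^sup>+x. (\<integral>\<^sup>+t. indicator {0..1::real} t * indicator B (x + t *\<^sub>R v) \<partial>lborel) \<partial>lborel)"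
    by (rule lborel_pair.Fubini'[OF m, symmetric])
  also have "\<dots> = (\<integral>\<^sup>+x. 0 \<partial>(lborel :: 'a measure))"
  proof (intro nn_integral_cong)
    fix x :: 'a
    have "{t. x + t *\<^sub>R v \<in> B} \<in> sets borel"
    proof -
      have "(\<lambda>t::real. x + t *\<^sub>R v) \<in> borel_measurable borel" by measurable
      from measurable_sets[OF this B] show ?thesis by (simp add: vimage_def)
    qed
    with lines[of x] have "{t. x + t *\<^sub>R v \<in> B} \<in> null_sets lborel"
      by (simp add: negligible_iff_null_sets null_sets_completion_iff)
    then have "AE t in lborel. x + t *\<^sub>R v \<notin> B" by (auto dest: AE_not_in)
    then have "AE t in lborel. indicator {0..1::real} t * indicator B (x + t *\<^sub>R v) = (0::ennreal)"
      by eventually_elim auto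
    then have "(\<integral>\<^sup>+t. indicator {0..1::real} t * indicator B (x + t *\<^sub>R v) \<partial>lborel) = (\<integral>\<^sup>+(t::real). 0 \<partial>lborel)"
      by (intro nn_integral_cong_AE)
    then show "(\<integral>\<^sup>+t. indicator {0..1::real} t * indicator B (x + t *\<^sub>R v) \<partial>lborel) = 0" by simp
  qed
  finally show ?thesis using B by (auto simp: null_sets_def)
qed

section \<open>Directional derivatives of Lipschitz functions\<close>

definition diff_quot :: "('a::real_normed_vector \<Rightarrow> real) \<Rightarrow> 'a \<Rightarrow> nat \<Rightarrow> 'a \<Rightarrow> real" where
  "diff_quot W v k x = real (Suc k) * (W (x + (1 / real (Suc k)) *\<^sub>R v) - W x)"

text \<open>The limit runs over the countably many steps 1/(k+1), which makes it Borel measurable.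
  Where the quotients diverge, \<open>lim\<close> is an unspecified value; for Lipschitz
  \<open>W\<close> this concerns a null set only.\<close>

definition dir_deriv :: "('a::real_normed_vector \<Rightarrow> real) \<Rightarrow> 'a \<Rightarrow> 'a \<Rightarrow> real" where
  "dir_deriv W v x = lim (\<lambda>k. diff_quot W v k x)"

lemma lipschitz_abs_diff:
  fixes W :: "'a::real_normed_vector \<Rightarrow> real"
  assumes "L-lipschitz_on S W" "x \<in> S" "y \<in> S"
  shows "\<bar>W x - W y\<bar> \<le> L * norm (x - y)"
  using lipschitz_onD[OF assms] by (simp add: dist_norm)

lemma integrable_indicator_bounded:
  fixes S :: "'a::euclidean_space set"
  assumes "S \<in> sets borel" "bounded S"
  shows "integrable lborel (\<lambda>x. c * indicator S x :: real)"
  using assms by (intro integrable_mult_right integrable_real_indicator emeasure_bounded_finite) auto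

context
  fixes W :: "'a::euclidean_space \<Rightarrow> real" and L :: real
  assumes Lip: "L-lipschitz_on UNIV W"
begin

lemma diff_quot_bound: "\<bar>diff_quot W v k x\<bar> \<le> L * norm v"
proof -
  have "\<bar>W (x + (1 / real (Suc k)) *\<^sub>R v) - W x\<bar> \<le> L * norm ((1 / real (Suc k)) *\<^sub>R v)"
    using lipschitz_abs_diff[OF Lip, of "x + (1 / real (Suc k)) *\<^sub>R v" x] by simp
  then have "real (Suc k) * \<bar>W (x + (1 / real (Suc k)) *\<^sub>R v) - W x\<bar> \<le> L * norm v"
    by (simp add: field_simps)
  then show ?thesis by (simp add: diff_quot_def abs_mult)
qed

lemma diff_quot_measurable [measurable]: "diff_quot W v k \<in> borel_measurable borel"
proof -
  have c: "continuous_on UNIV W" using Lip lipschitz_on_continuous_on by blast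
  have "continuous_on UNIV (diff_quot W v k)"
    unfolding diff_quot_def
    by (intro continuous_intros continuous_on_compose2[OF c]) auto
  then show ?thesis by (rule borel_measurable_continuous_onI)
qed

lemma dir_deriv_measurable [measurable]: "dir_deriv W v \<in> borel_measurable borel"
  unfolding dir_deriv_def by measurable

lemma diff_quot_convergent_AE: "AE x in lborel. convergent (\<lambda>k. diff_quot W v k x)"
proof -
  define B where "B = {x. \<not> Cauchy (\<lambda>k. diff_quot W v k x)}"
  have "{x \<in> space borel. Cauchy (\<lambda>k. diff_quot W v k x)} \<in> sets borel"
    by (intro sets_Collect_Cauchy) auto
  then have "- {x. Cauchy (\<lambda>k. diff_quot W v k x)} \<in> sets borel" by (intro borel_comp) simp
  then have B: "B \<in> sets borel" by (simp add: B_def Collect_neg_eq)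
  have "B \<in> null_sets lborel"
  proof (rule negligible_if_negligible_on_lines[OF B])
    fix x
    have "(L * norm v)-lipschitz_on UNIV (\<lambda>t. W (x + t *\<^sub>R v))"
    proof (rule lipschitz_onI)
      fix s t :: real
      have "\<bar>W (x + s *\<^sub>R v) - W (x + t *\<^sub>R v)\<bar> \<le> L * norm ((s - t) *\<^sub>R v)"
        using lipschitz_abs_diff[OF Lip, of "x + s *\<^sub>R v" "x + t *\<^sub>R v"] by (simp add: scaleR_diff_left)
      then show "dist (W (x + s *\<^sub>R v)) (W (x + t *\<^sub>R v)) \<le> L * norm v * dist s t"
        by (simp add: dist_real_def mult_ac)
    qed (use lipschitz_on_nonneg[OF Lip] in auto)
    from lipschitz_right_quotients_AE[OF this] obtain N where N: "negligible N"
      "\<And>t. t \<notin> N \<Longrightarrow> convergent (\<lambda>k. real (Suc k) * (W (x + (t + 1 / real (Suc k)) *\<^sub>R v) - W (x + t *\<^sub>R v)))"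
      by blast
    have "{t. x + t *\<^sub>R v \<in> B} \<subseteq> N"
    proof
      fix t assume t: "t \<in> {t. x + t *\<^sub>R v \<in> B}"
      show "t \<in> N"
      proof (rule ccontr)
        assume "t \<notin> N"
        from N(2)[OF this] have "convergent (\<lambda>k. diff_quot W v k (x + t *\<^sub>R v))"
          by (simp add: diff_quot_def algebra_simps)
        with t show False by (auto simp: B_def Cauchy_convergent_iff)
      qed
    qed
    then show "negligible {t. x + t *\<^sub>R v \<in> B}" using N(1) negligible_subset by blast
  qed
  then have "AE x in lborel. x \<notin> B" by (rule AE_not_in)
  then show ?thesis by eventually_elim (simp add: B_def Cauchy_convergent_iff)
qed

lemma diff_quot_tendsto_AE: "AE x in lborel. (\<lambda>k. diff_quot W v k x) \<longlonglongrightarrow> dir_deriv W v x"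
  using diff_quot_convergent_AE[of v]
  by eventually_elim (simp add: dir_deriv_def convergent_LIMSEQ_iff)

lemma dir_deriv_bound_AE: "AE x in lborel. \<bar>dir_deriv W v x\<bar> \<le> L * norm v"
  using diff_quot_tendsto_AE[of v]
proof eventually_elim
  case (elim x)
  from tendsto_rabs[OF this] show ?case
    by (rule LIMSEQ_le_const2) (use diff_quot_bound in auto)
qed

lemma integrable_dir_deriv: "integrable lborel (\<lambda>x. indicator (cbox a b) x * dir_deriv W v x)"
proof (rule Bochner_Integration.integrable_bound[of _ "\<lambda>x. L * norm v * indicator (cbox a b) x"])
  show "integrable lborel (\<lambda>x. L * norm v * indicator (cbox a b) x :: real)"
    by (intro integrable_indicator_bounded) auto
  show "AE x in lborel. norm (indicator (cbox a b) x * dir_deriv W v x) \<le> norm (L * norm v * indicator (cbox a b) x)"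
    using dir_deriv_bound_AE[of v] by eventually_elim (auto simp: indicator_def)
qed measurable

lemma integrable_diff_quot: "integrable lborel (\<lambda>x. indicator (cbox a b) x * diff_quot W v k x)"
proof (rule Bochner_Integration.integrable_bound[of _ "\<lambda>x. L * norm v * indicator (cbox a b) x"])
  show "integrable lborel (\<lambda>x. L * norm v * indicator (cbox a b) x :: real)"
    by (intro integrable_indicator_bounded) auto
  show "AE x in lborel. norm (indicator (cbox a b) x * diff_quot W v k x) \<le> norm (L * norm v * indicator (cbox a b) x)"
    using diff_quot_bound[of v k] by (intro AE_I2) (auto simp: indicator_def intro: order_trans[OF _ abs_ge_self])
qed measurable

text \<open>At the boundary of the box the shifted indicators may oscillate; it is excluded here and
  is a null set.\<close>

lemma indicator_shift_tendsto:
  fixes y :: 'a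
  assumes "y \<notin> cbox a b - box a b" and c: "c \<longlonglongrightarrow> 0"
  shows "(\<lambda>k. indicator (cbox a b) (y - c k) :: real) \<longlonglongrightarrow> indicator (cbox a b) y"
proof -
  have lim: "(\<lambda>k. y - c k) \<longlonglongrightarrow> y" using tendsto_diff[OF tendsto_const c, of y] by simp
  show ?thesis
  proof (cases "y \<in> box a b")
    case True
    have "eventually (\<lambda>k. y - c k \<in> box a b) sequentially"
      using topological_tendstoD[OF lim open_box True] .
    then have "eventually (\<lambda>k. indicator (cbox a b) (y - c k) = (indicator (cbox a b) y :: real)) sequentially"
      by eventually_elim (use True box_subset_cbox[of a b] in \<open>auto simp: indicator_def\<close>)
    then show ?thesis by (rule tendsto_eventually)
  next
    case False
    then have "y \<in> - cbox a b" using assms(1) by auto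
    then have "eventually (\<lambda>k. y - c k \<in> - cbox a b) sequentially"
      using topological_tendstoD[OF lim, of "- cbox a b"] by auto
    then have "eventually (\<lambda>k. indicator (cbox a b) (y - c k) = (indicator (cbox a b) y :: real)) sequentially"
      by eventually_elim (use \<open>y \<in> - cbox a b\<close> in \<open>auto simp: indicator_def\<close>)
    then show ?thesis by (rule tendsto_eventually)
  qed
qed

text \<open>The quotient in direction v + w splits into the quotient in v at x and the quotient in w
  at x + v/(k+1). The second need not converge pointwise to the derivative at x. Under the integral,
  a translation moves the shift to the box, and shifting the box by v/(k+1) has no effect in the
  limit.\<close>

lemma integral_dir_deriv_add:
  "(\<integral>x. indicator (cbox a b) x * dir_deriv W (v + w) x \<partial>lborel) =
   (\<integral>x. indicator (cbox a b) x * dir_deriv W v x \<partial>lborel) + (\<integral>x. indicator (cbox a b) x * dir_deriv W w x \<partial>lborel)"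
proof -
  let ?Q = "cbox a b"
  let ?c = "\<lambda>k. (1 / real (Suc k)) *\<^sub>R v"
  have L0: "0 \<le> L" using Lip lipschitz_on_nonneg by blast
  have lim: "(\<lambda>k. \<integral>x. indicator ?Q x * diff_quot W u k x \<partial>lborel) \<longlonglongrightarrow> (\<integral>x. indicator ?Q x * dir_deriv W u x \<partial>lborel)" for u
  proof (rule integral_dominated_convergence[where w = "\<lambda>x. L * norm u * indicator ?Q x"])
    show "integrable lborel (\<lambda>x. L * norm u * indicator ?Q x :: real)"
      by (intro integrable_indicator_bounded) auto
    show "AE x in lborel. (\<lambda>k. indicator ?Q x * diff_quot W u k x) \<longlonglongrightarrow> indicator ?Q x * dir_deriv W u x"
      using diff_quot_tendsto_AE[of u] by eventually_elim (rule tendsto_mult[OF tendsto_const])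
    show "AE x in lborel. norm (indicator ?Q x * diff_quot W u k x) \<le> L * norm u * indicator ?Q x" for k
      using diff_quot_bound[of u k] by (intro AE_I2) (auto simp: indicator_def)
  qed measurable
  have c0: "?c \<longlonglongrightarrow> 0"
  proof -
    have "(\<lambda>k. inverse (real (Suc k)) *\<^sub>R v) \<longlonglongrightarrow> 0 *\<^sub>R v"
      by (rule tendsto_scaleR[OF LIMSEQ_inverse_real_of_nat tendsto_const])
    then show ?thesis by (simp add: inverse_eq_divide)
  qed
  obtain R where R: "\<forall>x\<in>?Q. norm x \<le> R" using bounded_cbox[of a b] unfolding bounded_iff by blast
  \<comment> \<open>The dominating function lives on a larger ball because the shifted boxes stay
    within distance \<open>norm v\<close> of \<open>?Q\<close>.\<close>
  have "(\<lambda>k. \<integral>y. indicator ?Q (y - ?c k) * diff_quot W w k y \<partial>lborel) \<longlonglongrightarrow> (\<integral>x. indicator ?Q x * dir_deriv W w x \<partial>lborel)"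
  proof (rule integral_dominated_convergence[where w = "\<lambda>x. L * norm w * indicator (cball 0 (R + norm v)) x"])
    show "integrable lborel (\<lambda>x::'a. L * norm w * indicator (cball 0 (R + norm v)) x :: real)"
      by (intro integrable_indicator_bounded) auto
    have "negligible (cbox a b - box a b)" by (rule negligible_frontier_interval)
    then have "cbox a b - box a b \<in> null_sets lborel"
      by (simp add: negligible_iff_null_sets null_sets_completion_iff)
    then have "AE x in lborel. x \<notin> cbox a b - box a b" by (rule AE_not_in)
    then show "AE x in lborel. (\<lambda>k. indicator ?Q (x - ?c k) * diff_quot W w k x) \<longlonglongrightarrow> indicator ?Q x * dir_deriv W w x"
      using diff_quot_tendsto_AE[of w]
      by eventually_elim (rule tendsto_mult[OF indicator_shift_tendsto[OF _ c0]])
    show "AE x in lborel. norm (indicator ?Q (x - ?c k) * diff_quot W w k x) \<le> L * norm w * indicator (cball 0 (R + norm v)) x" for k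
    proof (intro AE_I2)
      fix x
      have "x \<in> cball 0 (R + norm v)" if "x - ?c k \<in> ?Q"
      proof -
        have "norm (x - ?c k) \<le> R" using that R by auto
        moreover have "norm (?c k) \<le> norm v" by (simp add: divide_le_eq mult_le_cancel_left1)
        ultimately show ?thesis using norm_triangle_ineq[of "x - ?c k" "?c k"] by simp
      qed
      then show "norm (indicator ?Q (x - ?c k) * diff_quot W w k x) \<le> L * norm w * indicator (cball 0 (R + norm v)) x"
        using diff_quot_bound[of w k x] L0 by (auto simp: indicator_def)
    qed
  qed measurable
  moreover have "(\<integral>y. indicator ?Q (y - ?c k) * diff_quot W w k y \<partial>lborel) = (\<integral>x. indicator ?Q x * diff_quot W w k (x + ?c k) \<partial>lborel)" for k
  proof -
    have "(\<integral>y. indicator ?Q (y - ?c k) * diff_quot W w k y \<partial>lborel) =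
      (\<integral>y. indicator ?Q (y - ?c k) * diff_quot W w k y \<partial>distr lborel borel ((+) (?c k)))"
      by (simp only: lborel_distr_plus)
    also have "\<dots> = (\<integral>x. indicator ?Q (?c k + x - ?c k) * diff_quot W w k (?c k + x) \<partial>lborel)"
      by (intro integral_distr) measurable
    finally show ?thesis by (simp add: add.commute)
  qed
  ultimately have lim2: "(\<lambda>k. \<integral>x. indicator ?Q x * diff_quot W w k (x + ?c k) \<partial>lborel) \<longlonglongrightarrow> (\<integral>x. indicator ?Q x * dir_deriv W w x \<partial>lborel)"
    by simp
  have split: "(\<integral>x. indicator ?Q x * diff_quot W (v + w) k x \<partial>lborel) =
      (\<integral>x. indicator ?Q x * diff_quot W v k x \<partial>lborel) + (\<integral>x. indicator ?Q x * diff_quot W w k (x + ?c k) \<partial>lborel)" for k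
  proof -
    have eq: "indicator ?Q x * diff_quot W w k (x + ?c k) = indicator ?Q x * diff_quot W (v + w) k x - indicator ?Q x * diff_quot W v k x" for x
      by (simp add: diff_quot_def algebra_simps)
    show ?thesis unfolding eq
      by (subst Bochner_Integration.integral_diff) (auto intro: integrable_diff_quot)
  qed
  have "(\<lambda>k. \<integral>x. indicator ?Q x * diff_quot W (v + w) k x \<partial>lborel) \<longlonglongrightarrow>
     (\<integral>x. indicator ?Q x * dir_deriv W v x \<partial>lborel) + (\<integral>x. indicator ?Q x * dir_deriv W w x \<partial>lborel)"
    unfolding split by (intro tendsto_add lim lim2)
  with lim[of "v + w"] show ?thesis by (rule LIMSEQ_unique)
qed

end

text \<open>Additivity gives homogeneity for integers. For real c, compare n c with its integer
  part: the remainder contributes at most 2 C |x|, so the defect for c is at most 2 C |x| / n for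
  every n.\<close>

lemma additive_bounded_scaleR:
  fixes f :: "'a::real_normed_vector \<Rightarrow> real"
  assumes fadd: "\<And>x y. f (x + y) = f x + f y" and bd: "\<And>x. \<bar>f x\<bar> \<le> C * norm x"
  shows "f (c *\<^sub>R x) = c * f x"
proof -
  have f0: "f 0 = 0" using fadd[of 0 0] by simp
  have fm: "f (- y) = - f y" for y using fadd[of y "- y"] f0 by simp
  have fn: "f (real n *\<^sub>R y) = real n * f y" for n y
    by (induction n) (simp_all add: f0 fadd scaleR_left_distrib distrib_right)
  have fi: "f (of_int k *\<^sub>R y) = of_int k * f y" for k y
    using fn[of "nat k" y] fn[of "nat (- k)" y] fm[of "of_int k *\<^sub>R y"] by (cases "k \<ge> 0") auto
  have C0: "0 \<le> C * norm x" using bd[of x] by linarith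
  have "\<bar>f (c *\<^sub>R x) - c * f x\<bar> * real n \<le> 2 * (C * norm x)" for n
  proof -
    define k where "k = \<lfloor>real n * c\<rfloor>"
    define r where "r = real n * c - of_int k"
    have r: "0 \<le> r" "r \<le> 1" unfolding r_def k_def by linarith+
    have "real n * f (c *\<^sub>R x) = f (of_int k *\<^sub>R x + r *\<^sub>R x)"
      by (simp add: fn[symmetric] r_def scaleR_left_distrib[symmetric])
    also have "\<dots> = of_int k * f x + f (r *\<^sub>R x)" by (simp add: fadd fi)
    finally have "real n * (f (c *\<^sub>R x) - c * f x) = f (r *\<^sub>R x) - r * f x"
      by (simp add: r_def algebra_simps)
    moreover have "\<bar>f (r *\<^sub>R x)\<bar> \<le> C * norm x"
    proof -
      have "\<bar>f (r *\<^sub>R x)\<bar> \<le> r * (C * norm x)" using bd[of "r *\<^sub>R x"] r by (simp add: mult_ac)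
      also have "\<dots> \<le> 1 * (C * norm x)" using r C0 by (intro mult_right_mono) auto
      finally show ?thesis by simp
    qed
    moreover have "\<bar>r * f x\<bar> \<le> C * norm x"
    proof -
      have "\<bar>r * f x\<bar> \<le> 1 * (C * norm x)" unfolding abs_mult using r bd[of x] by (intro mult_mono) auto
      then show ?thesis by simp
    qed
    ultimately have "\<bar>real n * (f (c *\<^sub>R x) - c * f x)\<bar> \<le> 2 * (C * norm x)" by linarith
    then show ?thesis by (simp add: abs_mult mult.commute)
  qed
  then have "\<bar>f (c *\<^sub>R x) - c * f x\<bar> \<le> 0"
    by (metis abs_ge_zero less_eq_real_def linorder_not_le mult.commute reals_Archimedean3)
  then show ?thesis by simp
qed

lemma AE_lborel_iff_negligible:
  "(AE x in lborel. P x) \<longleftrightarrow> (\<exists>N. negligible N \<and> (\<forall>x. x \<notin> N \<longrightarrow> P x))"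
proof -
  have "(AE x in lborel. P x) \<longleftrightarrow> (AE x in lebesgue. P x)" by (simp add: AE_completion_iff)
  also have "\<dots> \<longleftrightarrow> (\<exists>N. negligible N \<and> {x. \<not> P x} \<subseteq> N)"
    using eventually_ae_filter_negligible[of P] by (simp add: eventually_ae_filter)
  finally show ?thesis by blast
qed

lemma zero_box_integrals_AE:
  fixes g :: "'a::euclidean_space \<Rightarrow> real"
  assumes int: "\<And>a b. integrable lborel (\<lambda>x. indicator (cbox a b) x * g x)"
    and zero: "\<And>a b. (\<integral>x. indicator (cbox a b) x * g x \<partial>lborel) = 0"
  shows "AE x in lborel. g x = 0"
proof -
  have h: "(g has_integral 0) (cbox a b)" for a b
  proof -
    have "((\<lambda>x. indicator (cbox a b) x * g x) has_integral 0) UNIV"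
      using has_integral_integral_lborel[OF int[of a b]] by (simp only: zero)
    then have "((\<lambda>x. if x \<in> cbox a b then g x else 0) has_integral 0) UNIV"
      by (rule has_integral_eq[rotated]) (auto simp: indicator_def)
    then show ?thesis by (simp only: has_integral_restrict_UNIV)
  qed
  then have "g integrable_on cbox a b" for a b by blast
  then obtain N where N: "negligible N" "\<And>x e. \<lbrakk>x \<notin> N; 0 < e\<rbrakk> \<Longrightarrow>
      \<exists>d>0. \<forall>h. 0 < h \<and> h < d \<longrightarrow> norm (integral (cbox x (x + h *\<^sub>R One)) g /\<^sub>R h ^ DIM('a) - g x) < e"
    using integrable_ccontinuous_explicit[of g] by metis
  have "g x = 0" if "x \<notin> N" for x
  proof -
    have "norm (g x) < e" if e: "e > 0" for e
    proof -
      from N(2)[OF \<open>x \<notin> N\<close> e] obtain d where "d > 0" and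
        d: "\<And>h. 0 < h \<and> h < d \<Longrightarrow> norm (integral (cbox x (x + h *\<^sub>R One)) g /\<^sub>R h ^ DIM('a) - g x) < e"
        by blast
      have "integral (cbox x (x + (d / 2) *\<^sub>R One)) g = 0" using h integral_unique by blast
      then show ?thesis using d[of "d / 2"] \<open>d > 0\<close> by simp
    qed
    then show ?thesis by (metis less_irrefl zero_less_norm_iff)
  qed
  then show ?thesis unfolding AE_lborel_iff_negligible using N(1) by blast
qed

text \<open>For a fixed box the integral of \<open>dir_deriv W v\<close> is additive and bounded in
  \<open>v\<close>, hence linear; so the difference of both sides integrates to 0 over every box.
  The exceptional null set depends on \<open>v\<close>, which is why \<open>Rademacher_AE\<close>
  works with a countable dense set of directions.\<close>

lemma linear_dir_deriv_AE:
  fixes W :: "'a::euclidean_space \<Rightarrow> real"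
  assumes Lip: "L-lipschitz_on UNIV W"
  shows "AE x in lborel. dir_deriv W v x = (\<Sum>b\<in>Basis. (v \<bullet> b) * dir_deriv W b x)"
proof -
  define I where "I a c v = (\<integral>x. indicator (cbox a c) x * dir_deriv W v x \<partial>lborel)" for a c v
  have add: "I a c (v + w) = I a c v + I a c w" for a c v w
    unfolding I_def by (rule integral_dir_deriv_add[OF Lip])
  have bd: "\<bar>I a c v\<bar> \<le> (L * measure lborel (cbox a c)) * norm v" for a c v
  proof -
    have "\<bar>I a c v\<bar> \<le> (\<integral>x. \<bar>indicator (cbox a c) x * dir_deriv W v x\<bar> \<partial>lborel)"
      unfolding I_def by (rule integral_abs_bound)
    also have "\<dots> \<le> (\<integral>x. (L * norm v) * indicator (cbox a c) x \<partial>lborel)"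
    proof (rule integral_mono_AE)
      show "integrable lborel (\<lambda>x. \<bar>indicator (cbox a c) x * dir_deriv W v x\<bar>)"
        by (rule integrable_abs[OF integrable_dir_deriv[OF Lip]])
      show "AE x in lborel. \<bar>indicator (cbox a c) x * dir_deriv W v x\<bar> \<le> (L * norm v) * indicator (cbox a c) x"
        using dir_deriv_bound_AE[OF Lip, of v] by eventually_elim (auto simp: indicator_def)
    qed (intro integrable_indicator_bounded, auto)
    also have "\<dots> = (L * measure lborel (cbox a c)) * norm v" by simp
    finally show ?thesis .
  qed
  have scale: "I a c (r *\<^sub>R v) = r * I a c v" for a c r v
    by (rule additive_bounded_scaleR[OF add bd])
  have Isum: "I a c (\<Sum>b\<in>S. h b) = (\<Sum>b\<in>S. I a c (h b))" if "finite S" for a c S and h :: "'a \<Rightarrow> 'a"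
    using that scale[of a c 0 0] by (induction S) (auto simp: add)
  have rep: "I a c v = (\<Sum>b\<in>Basis. (v \<bullet> b) * I a c b)" for a c
    using Isum[of Basis a c "\<lambda>b. (v \<bullet> b) *\<^sub>R b"] by (simp add: scale euclidean_representation)
  have int: "integrable lborel (\<lambda>x. indicator (cbox a c) x * (\<Sum>b\<in>Basis. (v \<bullet> b) * dir_deriv W b x))" for a c
  proof -
    have "integrable lborel (\<lambda>x. \<Sum>b\<in>Basis. (v \<bullet> b) * (indicator (cbox a c) x * dir_deriv W b x))"
      by (intro Bochner_Integration.integrable_sum integrable_mult_right integrable_dir_deriv[OF Lip])
    then show ?thesis by (simp add: sum_distrib_left mult_ac)
  qed
  have "AE x in lborel. dir_deriv W v x - (\<Sum>b\<in>Basis. (v \<bullet> b) * dir_deriv W b x) = 0"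
  proof (rule zero_box_integrals_AE)
    fix a c :: 'a
    show "integrable lborel (\<lambda>x. indicator (cbox a c) x * (dir_deriv W v x - (\<Sum>b\<in>Basis. (v \<bullet> b) * dir_deriv W b x)))"
      unfolding right_diff_distrib by (intro Bochner_Integration.integrable_diff integrable_dir_deriv[OF Lip] int)
    have "(\<integral>x. indicator (cbox a c) x * (\<Sum>b\<in>Basis. (v \<bullet> b) * dir_deriv W b x) \<partial>lborel) =
        (\<integral>x. (\<Sum>b\<in>Basis. (v \<bullet> b) * (indicator (cbox a c) x * dir_deriv W b x)) \<partial>lborel)"
      by (simp add: sum_distrib_left mult_ac)
    also have "\<dots> = (\<Sum>b\<in>Basis. (v \<bullet> b) * I a c b)"
      unfolding I_def by (subst Bochner_Integration.integral_sum) (auto intro: integrable_dir_deriv[OF Lip])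
    finally show "(\<integral>x. indicator (cbox a c) x * (dir_deriv W v x - (\<Sum>b\<in>Basis. (v \<bullet> b) * dir_deriv W b x)) \<partial>lborel) = 0"
      unfolding right_diff_distrib using rep[of a c]
      by (subst Bochner_Integration.integral_diff) (auto intro: integrable_dir_deriv[OF Lip] int simp: I_def)
  qed
  then show ?thesis by simp
qed

theorem Rademacher_AE:
  fixes W :: "'a::euclidean_space \<Rightarrow> real"
  assumes Lip: "L-lipschitz_on UNIV W"
  shows "AE x in lborel. W differentiable (at x)"
proof -
  have L0: "0 \<le> L" using Lip lipschitz_on_nonneg by blast
  obtain Q :: "'a set" where Q: "countable Q" "\<And>X. open X \<Longrightarrow> X \<noteq> {} \<Longrightarrow> \<exists>q\<in>Q. q \<in> X"
    using countable_dense_exists by blast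
  have "AE x in lborel. \<forall>q\<in>Q. (\<lambda>k. diff_quot W q k x) \<longlonglongrightarrow> dir_deriv W q x \<and>
      dir_deriv W q x = (\<Sum>b\<in>Basis. (q \<bullet> b) * dir_deriv W b x)"
    unfolding AE_ball_countable[OF Q(1)]
    using diff_quot_tendsto_AE[OF Lip] linear_dir_deriv_AE[OF Lip] by auto
  then show ?thesis
  proof eventually_elim
    case (elim x)
    define A where "A h = (\<Sum>b\<in>Basis. (h \<bullet> b) * dir_deriv W b x)" for h
    have lim: "(\<lambda>k. diff_quot W q k x) \<longlonglongrightarrow> A q" if "q \<in> Q" for q
      using elim that by (auto simp: A_def)
    have blA: "bounded_linear A" unfolding A_def
      by (intro bounded_linear_sum bounded_linear_mult_const bounded_linear_inner_left)
    then obtain C where C: "\<And>h. norm (A h) \<le> norm h * C" "C > 0"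
      using bounded_linear.pos_bounded by blast
    have "(W has_derivative A) (at x)"
      unfolding has_derivative_at_alt
    proof (intro conjI blA allI impI)
      fix e :: real assume "0 < e"
      \<comment> \<open>\<open>K\<close> adds up three errors, \<open>L * \<epsilon>\<close> for
        moving to a direction \<open>q\<close> of the net, \<open>\<epsilon>\<close> for the
        quotient and \<open>C * \<epsilon>\<close> for the linear map \<open>A\<close>, and doubles
        them because 1/(k+1) is bounded by \<open>2 * norm h\<close>.\<close>
      define K where "K = 2 * (L + C + 1)"
      have K: "K > 0" using L0 C by (simp add: K_def)
      define \<epsilon> where "\<epsilon> = e / K"
      have \<epsilon>: "\<epsilon> > 0" using \<open>0 < e\<close> K by (simp add: \<epsilon>_def)
      have "cball (0::'a) 1 \<subseteq> (\<Union>q\<in>Q. ball q \<epsilon>)"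
      proof
        fix u :: 'a
        from Q(2)[of "ball u \<epsilon>"] \<epsilon> obtain q where "q \<in> Q" "dist u q < \<epsilon>" by auto
        then show "u \<in> (\<Union>q\<in>Q. ball q \<epsilon>)" by (auto simp: dist_commute)
      qed
      \<comment> \<open>Compactness of the unit ball leaves finitely many directions, so the
        quotients in all of them are close to their limits from one index \<open>k0\<close>
        on.\<close>
      then obtain F where F: "F \<subseteq> Q" "finite F" "cball (0::'a) 1 \<subseteq> (\<Union>q\<in>F. ball q \<epsilon>)"
        using compactE_image[OF compact_cball, of Q "\<lambda>q. ball q \<epsilon>" 0 1] by auto
      have "\<forall>\<^sub>F k in sequentially. \<forall>q\<in>F. dist (diff_quot W q k x) (A q) < \<epsilon>"
        using F by (intro eventually_ball_finite ballI tendstoD lim \<epsilon>) auto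
      then obtain k0 where k0: "\<And>k q. k \<ge> k0 \<Longrightarrow> q \<in> F \<Longrightarrow> \<bar>diff_quot W q k x - A q\<bar> < \<epsilon>"
        unfolding eventually_sequentially dist_real_def by blast
      show "\<exists>d>0. \<forall>y. norm (y - x) < d \<longrightarrow> norm (W y - W x - A (y - x)) \<le> e * norm (y - x)"
      proof (intro exI[of _ "1 / (real k0 + 2)"] conjI allI impI)
        fix y assume y: "norm (y - x) < 1 / (real k0 + 2)"
        show "norm (W y - W x - A (y - x)) \<le> e * norm (y - x)"
        proof (cases "y = x")
          case True then show ?thesis using linear_0[OF bounded_linear.linear[OF blA]] by simp
        next
          case False
          define h where "h = y - x"
          have h0: "norm h > 0" using False by (simp add: h_def)
          \<comment> \<open>The step is matched to the length of \<open>h\<close>: k+1 is the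
            integer part of 1/|h|, so that u = (k+1) h has norm at most 1 and 1/(k+1) is comparable
            to |h|.\<close>
          define k where "k = nat \<lfloor>1 / norm h\<rfloor> - 1"
          have big: "1 / norm h > real k0 + 2" using y h0 by (simp add: h_def field_simps)
          then have fl: "\<lfloor>1 / norm h\<rfloor> \<ge> int k0 + 2" by (simp add: le_floor_iff)
          have Sk: "real (Suc k) = of_int \<lfloor>1 / norm h\<rfloor>" using fl by (simp add: k_def of_nat_diff)
          have kk0: "k \<ge> k0" using fl by (simp add: k_def)
          have up: "real (Suc k) \<le> 1 / norm h" "1 / norm h < real (Suc k) + 1" unfolding Sk by linarith+
          have Sk1: "real (Suc k) \<ge> 1" by simp
          have inv: "1 / real (Suc k) \<le> 2 * norm h"
          proof -
            have "1 / norm h \<le> 2 * real (Suc k)" by (rule order_trans[OF less_imp_le[OF up(2)]]) (use Sk1 in simp)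
            then show ?thesis using h0 Sk1 by (simp add: field_simps)
          qed
          define u where "u = real (Suc k) *\<^sub>R h"
          have "norm u = real (Suc k) * norm h" unfolding u_def norm_scaleR by simp
          also have "\<dots> \<le> 1" using up(1) h0 pos_le_divide_eq by blast
          finally have "norm u \<le> 1" .
          then obtain q where q: "q \<in> F" "norm (q - u) < \<epsilon>" 
          proof -
            have "u \<in> (\<Union>q\<in>F. ball q \<epsilon>)" using F(3) \<open>norm u \<le> 1\<close> by (meson mem_cball_0 subsetD)
            then show ?thesis using that by (auto simp: dist_norm)
          qed
          have hu: "h = (1 / real (Suc k)) *\<^sub>R u" by (simp add: u_def)
          have yx: "y = x + (1 / real (Suc k)) *\<^sub>R u" unfolding hu[symmetric] by (simp add: h_def)
          let ?n = "real (Suc k)"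
          have 1: "\<bar>?n * (W y - W (x + (1 / ?n) *\<^sub>R q))\<bar> \<le> L * \<epsilon>"
          proof -
            have "\<bar>W y - W (x + (1 / ?n) *\<^sub>R q)\<bar> \<le> L * norm ((1 / ?n) *\<^sub>R (u - q))"
              using lipschitz_abs_diff[OF Lip, of y "x + (1 / ?n) *\<^sub>R q"] by (simp add: yx scaleR_diff_right)
            also have "\<dots> = L * norm (q - u) / ?n" by (simp add: norm_minus_commute)
            finally have "?n * \<bar>W y - W (x + (1 / ?n) *\<^sub>R q)\<bar> \<le> L * norm (q - u)"
              by (simp add: field_simps)
            also have "\<dots> \<le> L * \<epsilon>" using L0 q(2) by (intro mult_left_mono) auto
            finally show ?thesis by (simp add: abs_mult)
          qed
          have 2: "\<bar>diff_quot W q k x - A q\<bar> < \<epsilon>" using k0 kk0 q by blast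
          have 3: "\<bar>A q - A u\<bar> \<le> C * \<epsilon>"
          proof -
            have "\<bar>A q - A u\<bar> \<le> norm (q - u) * C"
              using C(1)[of "q - u"] by (simp add: bounded_linear.linear[OF blA] linear_diff)
            also have "\<dots> \<le> \<epsilon> * C" using C(2) q(2) by (intro mult_right_mono) auto
            finally show ?thesis by (simp add: mult.commute)
          qed
          have Au: "A u = ?n * A h" unfolding u_def using linear_scale[OF bounded_linear.linear[OF blA]] by simp
          have "?n * (W y - W x - A h) = ?n * (W y - W (x + (1 / ?n) *\<^sub>R q)) + (diff_quot W q k x - A q) + (A q - A u)"
            unfolding Au by (simp add: diff_quot_def algebra_simps)
          then have "\<bar>?n * (W y - W x - A h)\<bar> \<le> L * \<epsilon> + \<epsilon> + C * \<epsilon>" using 1 2 3 by linarith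
          moreover have "?n * \<bar>W y - W x - A h\<bar> = \<bar>?n * (W y - W x - A h)\<bar>"
            by (simp only: abs_mult abs_of_nat)
          moreover have "(L + C + 1) * \<epsilon> = L * \<epsilon> + \<epsilon> + C * \<epsilon>" by (simp add: distrib_right)
          ultimately have "\<bar>W y - W x - A h\<bar> * ?n \<le> (L + C + 1) * \<epsilon>" by (simp only: mult.commute)
          then have "\<bar>W y - W x - A h\<bar> \<le> (L + C + 1) * \<epsilon> * (1 / ?n)"
            using pos_le_divide_eq[of ?n "\<bar>W y - W x - A h\<bar>" "(L + C + 1) * \<epsilon>"] Sk1 by simp
          also have "\<dots> \<le> (L + C + 1) * \<epsilon> * (2 * norm h)"
            using inv L0 C \<epsilon> by (intro mult_left_mono) auto
          also have "\<dots> = K * \<epsilon> * norm h" by (simp add: K_def algebra_simps)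
          also have "K * \<epsilon> = e" using K by (simp add: \<epsilon>_def)
          finally show ?thesis by (simp add: h_def)
        qed
      qed simp
    qed
    then show ?case unfolding differentiable_def by blast
  qed
qed

section \<open>From almost everywhere derivative bounds to finite decrease\<close>

lemma McShane_extension:
  fixes W :: "'a::metric_space \<Rightarrow> real"
  assumes Lip: "L-lipschitz_on U W"
  shows "\<exists>W'. L-lipschitz_on UNIV W' \<and> (\<forall>x\<in>U. W' x = W x)"
proof (cases "U = {}")
  case True
  then show ?thesis using lipschitz_on_nonneg[OF Lip]
    by (intro exI[of _ "\<lambda>_. 0"]) (auto simp: lipschitz_on_def)
next
  case False
  then obtain z where z: "z \<in> U" by blast
  have L0: "0 \<le> L" using Lip lipschitz_on_nonneg by blast
  have dl: "\<bar>W x - W y\<bar> \<le> L * dist x y" if "x \<in> U" "y \<in> U" for x y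
    using lipschitz_onD[OF Lip that] by (simp add: dist_real_def)
  \<comment> \<open>The inf-convolution of \<open>W\<close> with \<open>L\<close> times the
    distance. Each competitor is \<open>L\<close>-Lipschitz in \<open>x\<close>, hence so is the
    infimum.\<close>
  define W' where "W' x = (INF y\<in>U. W y + L * dist x y)" for x
  have bdd: "bdd_below ((\<lambda>y. W y + L * dist x y) ` U)" for x
  proof (rule bdd_belowI2)
    fix y assume y: "y \<in> U"
    have "W z - L * dist z y \<le> W y" using dl[OF z y] by linarith
    moreover have "L * dist z y \<le> L * (dist x z + dist x y)"
      using L0 dist_triangle3[of z y x] by (intro mult_left_mono) (auto simp: dist_commute)
    ultimately show "W z - L * dist x z \<le> W y + L * dist x y" by (simp add: algebra_simps)
  qed
  have le: "W' x \<le> W' y + L * dist x y" for x y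
  proof -
    have "W' x - L * dist x y \<le> (INF w\<in>U. W w + L * dist y w)"
    proof (rule cINF_greatest[OF False])
      fix w assume w: "w \<in> U"
      have "W' x \<le> W w + L * dist x w" unfolding W'_def by (rule cINF_lower[OF bdd w])
      moreover have "L * dist x w \<le> L * (dist x y + dist y w)" using L0 dist_triangle by (intro mult_left_mono)
      ultimately show "W' x - L * dist x y \<le> W w + L * dist y w" by (simp add: algebra_simps)
    qed
    then show ?thesis by (simp add: W'_def)
  qed
  have "W' x = W x" if "x \<in> U" for x
  proof (rule antisym)
    show "W' x \<le> W x" unfolding W'_def using cINF_lower[OF bdd[of x] that] by simp
    show "W x \<le> W' x" unfolding W'_def
      by (rule cINF_greatest[OF False]) (use dl[OF that] in \<open>auto simp: abs_le_iff algebra_simps\<close>)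
  qed
  moreover have "L-lipschitz_on UNIV W'"
  proof (rule lipschitz_onI[OF _ L0])
    fix x y show "dist (W' x) (W' y) \<le> L * dist x y"
      using le[of x y] le[of y x] by (auto simp: dist_real_def dist_commute abs_le_iff)
  qed
  ultimately show ?thesis by blast
qed

lemma has_derivative_imp_dir_DERIV:
  assumes "(W has_derivative D) (at y)"
  shows "((\<lambda>t. W (y + t *\<^sub>R w)) has_real_derivative D w) (at 0)"
proof -
  have "((\<lambda>t. y + t *\<^sub>R w) has_derivative (\<lambda>t. t *\<^sub>R w)) (at (0::real))"
    by (auto intro!: derivative_eq_intros)
  moreover have "(W has_derivative D) (at (y + (0::real) *\<^sub>R w))" using assms by simp
  ultimately have "((\<lambda>t. W (y + t *\<^sub>R w)) has_derivative (\<lambda>t. D (t *\<^sub>R w))) (at 0)"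
    by (rule has_derivative_compose)
  moreover have "(\<lambda>t. D (t *\<^sub>R w)) = (*) (D w)"
    using linear_scale[OF has_derivative_linear[OF assms]] by (auto simp: mult.commute)
  ultimately show ?thesis by (simp add: has_field_derivative_def)
qed

lemma has_derivative_lipschitz_bound:
  fixes W :: "'a::euclidean_space \<Rightarrow> real"
  assumes D: "(W has_derivative D) (at y)" and S: "open S" "y \<in> S" and Lip: "L-lipschitz_on S W"
  shows "\<bar>D w\<bar> \<le> L * norm w"
proof -
  have "((\<lambda>t. (W (y + t *\<^sub>R w) - W y) / t) \<longlongrightarrow> D w) (at 0)"
    using has_derivative_imp_dir_DERIV[OF D, of w] by (simp add: has_field_derivative_iff)
  then have lim: "((\<lambda>t. \<bar>(W (y + t *\<^sub>R w) - W y) / t\<bar>) \<longlongrightarrow> \<bar>D w\<bar>) (at 0)" by (rule tendsto_rabs)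
  have "((\<lambda>t. y + t *\<^sub>R w) \<longlongrightarrow> y + 0 *\<^sub>R w) (at (0::real))" by (intro tendsto_intros)
  then have "\<forall>\<^sub>F t in at (0::real). y + t *\<^sub>R w \<in> S"
    using topological_tendstoD[of _ "y + 0 *\<^sub>R w" _ S] S by simp
  moreover have "\<forall>\<^sub>F t in at (0::real). t \<noteq> 0" by (simp add: eventually_at_filter)
  ultimately have "\<forall>\<^sub>F t in at (0::real). \<bar>(W (y + t *\<^sub>R w) - W y) / t\<bar> \<le> L * norm w"
  proof eventually_elim
    case (elim t)
    have "\<bar>W (y + t *\<^sub>R w) - W y\<bar> \<le> L * (\<bar>t\<bar> * norm w)"
      using lipschitz_abs_diff[OF Lip elim(1) S(2)] by simp
    then show ?case using elim(2) by (simp add: field_simps abs_mult)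
  qed
  then show ?thesis by (rule tendsto_upperbound[OF lim]) simp
qed


lemma lipschitz_descent_segment:
  fixes W :: "'a::euclidean_space \<Rightarrow> real"
  assumes Lip: "L-lipschitz_on U W" and U: "open U"
    and seg: "\<And>t. 0 \<le> t \<Longrightarrow> t \<le> h \<Longrightarrow> x + t *\<^sub>R v \<in> U" and h: "0 \<le> h"
    and N: "negligible N"
    and D: "\<And>y D. y \<in> U - N \<Longrightarrow> (W has_derivative D) (at y) \<Longrightarrow> D v \<le> c"
  shows "W (x + h *\<^sub>R v) - W x \<le> c * h"
proof (cases "h = 0")
  case True then show ?thesis by simp
next
  case False
  with h have hpos: "h > 0" by simp
  have L0: "0 \<le> L" using Lip lipschitz_on_nonneg by blast
  obtain W' where W': "L-lipschitz_on UNIV W'" "\<And>x. x \<in> U \<Longrightarrow> W' x = W x"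
    using McShane_extension[OF Lip] by blast
  have W'l: "\<bar>W' a - W' b\<bar> \<le> L * norm (a - b)" for a b
    using lipschitz_abs_diff[OF W'(1)] by simp
  have cW: "continuous_on UNIV W'" using W'(1) lipschitz_on_continuous_on by blast
  have mW: "(\<lambda>y. W' (y + w)) \<in> borel_measurable borel" for w
    by (intro borel_measurable_continuous_onI continuous_on_compose2[OF cW] continuous_intros) auto
  define S where "S = (\<lambda>t. x + t *\<^sub>R v) ` {0..h}"
  have "compact S" unfolding S_def by (intro compact_continuous_image continuous_intros) auto
  moreover have "S \<subseteq> U" using seg by (auto simp: S_def)
  ultimately obtain r where r: "r > 0" "(\<Union>s\<in>S. ball s r) \<subseteq> U"
    using compact_subset_open_imp_ball_epsilon_subset[OF _ U, of S] by metis
  \<comment> \<open>The cost \<open>2 * L * \<delta>\<close> comes from replacing the averages of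
    \<open>W\<close> over two balls of radius \<open>\<delta>\<close> by the values at their
    centres.\<close>
  have main: "W (x + h *\<^sub>R v) - W x - 2 * L * \<delta> \<le> c * h" if \<delta>: "0 < \<delta>" "\<delta> < r" for \<delta>
  proof -
    let ?Q = "cball x \<delta>"
    let ?I = "indicator ?Q :: 'a \<Rightarrow> real"
    have inU: "y + t *\<^sub>R v \<in> U" if "y \<in> ?Q" "0 \<le> t" "t \<le> h" for y t
    proof -
      have "dist (x + t *\<^sub>R v) (y + t *\<^sub>R v) < r" using that \<delta> by (auto simp: dist_norm)
      moreover have "x + t *\<^sub>R v \<in> S" using that(2,3) by (auto simp: S_def)
      ultimately show ?thesis using r(2) by (meson UN_I mem_ball subsetD)
    qed
    obtain B where B: "\<And>y. y \<in> ?Q \<Longrightarrow> norm y \<le> B"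
      using bounded_cball[of x \<delta>] unfolding bounded_iff by blast
    have mI: "(\<lambda>y. ?I y * G y) \<in> borel_measurable lborel" if "G \<in> borel_measurable borel" for G
      using that by (simp add: borel_measurable_times borel_measurable_indicator)
    have mD: "(\<lambda>y. dir_deriv W' v (y + w)) \<in> borel_measurable borel" for w
      by (rule measurable_compose[OF _ dir_deriv_measurable[OF W'(1)]]) simp
    define M where "M t = (\<integral>y. ?I y * W' (y + t *\<^sub>R v) \<partial>lborel)" for t
    have intW: "integrable lborel (\<lambda>y. ?I y * W' (y + w))" for w
    proof (rule Bochner_Integration.integrable_bound[of _ "\<lambda>y. (\<bar>W' 0\<bar> + L * (B + norm w)) * ?I y"])
      show "integrable lborel (\<lambda>y. (\<bar>W' 0\<bar> + L * (B + norm w)) * ?I y)"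
        by (intro integrable_indicator_bounded) auto
      show "AE y in lborel. norm (?I y * W' (y + w)) \<le> norm ((\<bar>W' 0\<bar> + L * (B + norm w)) * ?I y)"
      proof (intro AE_I2)
        fix y
        show "norm (?I y * W' (y + w)) \<le> norm ((\<bar>W' 0\<bar> + L * (B + norm w)) * ?I y)"
        proof (cases "y \<in> ?Q")
          case True
          have "\<bar>W' (y + w)\<bar> \<le> \<bar>W' 0\<bar> + L * norm (y + w)" using W'l[of "y + w" 0] by simp
          also have "\<dots> \<le> \<bar>W' 0\<bar> + L * (B + norm w)"
            using B[OF True] norm_triangle_ineq[of y w] L0 by (intro add_left_mono mult_left_mono) auto
          finally show ?thesis using True by (simp del: mem_cball)
        qed (simp del: mem_cball)
      qed
    qed (rule mI[OF mW])
    define d where "d t = (\<integral>y. ?I y * dir_deriv W' v (y + t *\<^sub>R v) \<partial>lborel)" for t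
    have diffAE: "AE y in lborel. W' differentiable (at y) \<and> (\<lambda>k. diff_quot W' v k y) \<longlonglongrightarrow> dir_deriv W' v y \<and> y \<notin> N"
    proof -
      have "AE y in lborel. y \<notin> N" unfolding AE_lborel_iff_negligible using N by blast
      then show ?thesis using Rademacher_AE[OF W'(1)] diff_quot_tendsto_AE[OF W'(1), of v]
        by eventually_elim auto
    qed
    \<comment> \<open>Where \<open>W'\<close> is differentiable, the measurable function
      \<open>dir_deriv\<close> agrees with the true derivative in direction
      \<open>v\<close>.\<close>
    have key: "\<exists>D. (W' has_derivative D) (at y) \<and> dir_deriv W' v y = D v"
      if kd: "W' differentiable (at y)" and kl: "(\<lambda>k. diff_quot W' v k y) \<longlonglongrightarrow> dir_deriv W' v y" for y
    proof -
      obtain D where D: "(W' has_derivative D) (at y)" using kd unfolding differentiable_def by blast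
      have "((\<lambda>t. (W' (y + t *\<^sub>R v) - W' y) / t) \<longlongrightarrow> D v) (at 0)"
        using has_derivative_imp_dir_DERIV[OF D, of v] by (simp add: has_field_derivative_iff)
      moreover have "filterlim (\<lambda>k. 1 / real (Suc k)) (at 0) sequentially"
        unfolding filterlim_at using LIMSEQ_inverse_real_of_nat by (auto simp: inverse_eq_divide)
      ultimately have "(\<lambda>k. (W' (y + (1 / real (Suc k)) *\<^sub>R v) - W' y) / (1 / real (Suc k))) \<longlonglongrightarrow> D v"
        by (rule filterlim_compose)
      then have "(\<lambda>k. diff_quot W' v k y) \<longlonglongrightarrow> D v" by (simp add: diff_quot_def mult.commute)
      then show ?thesis using D LIMSEQ_unique[OF kl] by blast
    qed
    have shiftAE: "AE y in lborel. W' differentiable (at (y + w)) \<and>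
        (\<lambda>k. diff_quot W' v k (y + w)) \<longlonglongrightarrow> dir_deriv W' v (y + w) \<and> y + w \<notin> N" for w
    proof -
      have "AE y in distr lborel borel ((+) w). W' differentiable (at y) \<and>
          (\<lambda>k. diff_quot W' v k y) \<longlonglongrightarrow> dir_deriv W' v y \<and> y \<notin> N"
        unfolding lborel_distr_plus by (rule diffAE)
      from AE_distrD[OF _ this] show ?thesis by (simp add: add.commute)
    qed
    have bnd: "d t \<le> c * measure lborel ?Q" if t: "0 \<le> t" "t \<le> h" for t
    proof -
      have "d t \<le> (\<integral>y. c * ?I y \<partial>lborel)" unfolding d_def
      proof (rule integral_mono_AE)
        show "integrable lborel (\<lambda>y. c * ?I y)" by (intro integrable_indicator_bounded) auto
        show "AE y in lborel. ?I y * dir_deriv W' v (y + t *\<^sub>R v) \<le> c * ?I y"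
          using shiftAE[of "t *\<^sub>R v"]
        proof eventually_elim
          case (elim y)
          show ?case
          proof (cases "y \<in> ?Q")
            case True
            obtain D' where D': "(W' has_derivative D') (at (y + t *\<^sub>R v))" "dir_deriv W' v (y + t *\<^sub>R v) = D' v"
              using key elim by blast
            have "(W has_derivative D') (at (y + t *\<^sub>R v))"
              by (rule has_derivative_transform_within_open[OF D'(1) U inU[OF True t]]) (use W'(2) in auto)
            with D[of "y + t *\<^sub>R v" D'] inU[OF True t] elim have "D' v \<le> c" by blast
            then show ?thesis using True D'(2) by (simp del: mem_cball)
          qed (simp del: mem_cball)
        qed
        show "integrable lborel (\<lambda>y. ?I y * dir_deriv W' v (y + t *\<^sub>R v))"
        proof (rule Bochner_Integration.integrable_bound[of _ "\<lambda>y. (L * norm v) * ?I y"])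
          show "integrable lborel (\<lambda>y. (L * norm v) * ?I y)" by (intro integrable_indicator_bounded) auto
          have "AE y in distr lborel borel ((+) (t *\<^sub>R v)). \<bar>dir_deriv W' v y\<bar> \<le> L * norm v"
            unfolding lborel_distr_plus by (rule dir_deriv_bound_AE[OF W'(1)])
          from AE_distrD[OF _ this] have "AE y in lborel. \<bar>dir_deriv W' v (y + t *\<^sub>R v)\<bar> \<le> L * norm v"
            by (simp add: add.commute)
          then show "AE y in lborel. norm (?I y * dir_deriv W' v (y + t *\<^sub>R v)) \<le> norm ((L * norm v) * ?I y)"
            by eventually_elim (auto simp: indicator_def)
        qed (rule mI[OF mD])
      qed
      then show ?thesis by simp
    qed
    \<comment> \<open>Although \<open>W'\<close> is differentiable only almost everywhere, its
      average is differentiable at every t by dominated convergence, so the classical mean value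
      theorem applies to \<open>M\<close>.\<close>
    have der: "(M has_real_derivative d t) (at t)" for t
    proof -
      have "((\<lambda>s. (M (t + s) - M t) / s) \<longlongrightarrow> d t) (at 0)"
        unfolding tendsto_at_iff_sequentially
      proof (intro allI impI)
        fix X :: "nat \<Rightarrow> real" assume X: "\<forall>i. X i \<in> UNIV - {0}" "X \<longlonglongrightarrow> 0"
        define q where "q i y = ?I y * ((W' (y + (t + X i) *\<^sub>R v) - W' (y + t *\<^sub>R v)) / X i)" for i y
        have "(\<lambda>i. \<integral>y. q i y \<partial>lborel) \<longlonglongrightarrow> d t" unfolding d_def
        proof (rule integral_dominated_convergence[where w = "\<lambda>y. (L * norm v) * ?I y"])
          show "(\<lambda>y. ?I y * dir_deriv W' v (y + t *\<^sub>R v)) \<in> borel_measurable lborel"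
            by (rule mI[OF mD])
          show "q i \<in> borel_measurable lborel" for i
            unfolding q_def by (intro mI borel_measurable_divide borel_measurable_diff mW borel_measurable_const)
          show "integrable lborel (\<lambda>y. (L * norm v) * ?I y)" by (intro integrable_indicator_bounded) auto
          show "AE y in lborel. (\<lambda>i. q i y) \<longlonglongrightarrow> ?I y * dir_deriv W' v (y + t *\<^sub>R v)"
            using shiftAE[of "t *\<^sub>R v"]
          proof eventually_elim
            case (elim y)
            obtain D' where D': "(W' has_derivative D') (at (y + t *\<^sub>R v))" "dir_deriv W' v (y + t *\<^sub>R v) = D' v"
              using key elim by blast
            have "((\<lambda>s. (W' (y + t *\<^sub>R v + s *\<^sub>R v) - W' (y + t *\<^sub>R v)) / s) \<longlongrightarrow> D' v) (at 0)"
              using has_derivative_imp_dir_DERIV[OF D'(1), of v] by (simp add: has_field_derivative_iff)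
            moreover have "filterlim X (at 0) sequentially" unfolding filterlim_at using X by auto
            ultimately have "(\<lambda>i. (W' (y + t *\<^sub>R v + X i *\<^sub>R v) - W' (y + t *\<^sub>R v)) / X i) \<longlonglongrightarrow> D' v"
              by (rule filterlim_compose)
            from tendsto_mult[OF tendsto_const[of "?I y"] this] show ?case
              unfolding q_def D'(2) by (simp add: scaleR_left_distrib add.assoc)
          qed
          show "AE y in lborel. norm (q i y) \<le> (L * norm v) * ?I y" for i
          proof (intro AE_I2)
            fix y
            have "\<bar>W' (y + (t + X i) *\<^sub>R v) - W' (y + t *\<^sub>R v)\<bar> \<le> L * norm (X i *\<^sub>R v)"
              using W'l[of "y + (t + X i) *\<^sub>R v" "y + t *\<^sub>R v"] by (simp add: scaleR_left_distrib)
            then have "\<bar>W' (y + (t + X i) *\<^sub>R v) - W' (y + t *\<^sub>R v)\<bar> / \<bar>X i\<bar> \<le> L * norm v"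
              using X(1) by (simp add: field_simps)
            then show "norm (q i y) \<le> (L * norm v) * ?I y"
              by (cases "y \<in> ?Q") (auto simp: q_def abs_mult simp del: mem_cball)
          qed
        qed
        moreover have "(\<integral>y. q i y \<partial>lborel) = (M (t + X i) - M t) / X i" for i
        proof -
          have "(\<integral>y. q i y \<partial>lborel) = (\<integral>y. (?I y * W' (y + (t + X i) *\<^sub>R v) - ?I y * W' (y + t *\<^sub>R v)) / X i \<partial>lborel)"
            by (intro Bochner_Integration.integral_cong) (auto simp: q_def right_diff_distrib)
          also have "\<dots> = (M (t + X i) - M t) / X i"
            unfolding M_def by (subst integral_divide_zero, subst Bochner_Integration.integral_diff) (auto intro: intW)
          finally show ?thesis .
        qed
        ultimately show "((\<lambda>s. (M (t + s) - M t) / s) \<circ> X) \<longlonglongrightarrow> d t" by (simp add: o_def)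
      qed
      then show ?thesis by (simp add: DERIV_def)
    qed
    obtain \<xi> where \<xi>: "0 < \<xi>" "\<xi> < h" "M h - M 0 = (h - 0) * d \<xi>"
      using MVT2[of 0 h M d] hpos der by blast
    have "M h - M 0 \<le> (c * h) * measure lborel ?Q"
    proof -
      have "M h - M 0 \<le> h * (c * measure lborel ?Q)"
        using \<xi>(3) mult_left_mono[OF bnd[of \<xi>], of h] \<xi>(1,2) hpos by simp
      then show ?thesis by (simp add: mult_ac)
    qed
    moreover have "(W (x + h *\<^sub>R v) - W x - 2 * L * \<delta>) * measure lborel ?Q \<le> M h - M 0"
    proof -
      have "(\<integral>y. (W (x + h *\<^sub>R v) - W x - 2 * L * \<delta>) * ?I y \<partial>lborel) \<le>
          (\<integral>y. ?I y * W' (y + h *\<^sub>R v) - ?I y * W' (y + 0 *\<^sub>R v) \<partial>lborel)"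
      proof (rule integral_mono)
        show "integrable lborel (\<lambda>y. (W (x + h *\<^sub>R v) - W x - 2 * L * \<delta>) * ?I y)"
          by (intro integrable_indicator_bounded) auto
        show "integrable lborel (\<lambda>y. ?I y * W' (y + h *\<^sub>R v) - ?I y * W' (y + 0 *\<^sub>R v))"
          by (intro Bochner_Integration.integrable_diff intW)
        fix y
        show "(W (x + h *\<^sub>R v) - W x - 2 * L * \<delta>) * ?I y \<le> ?I y * W' (y + h *\<^sub>R v) - ?I y * W' (y + 0 *\<^sub>R v)"
        proof (cases "y \<in> ?Q")
          case True
          have xy: "norm (x - y) \<le> \<delta>" using True by (simp add: dist_norm)
          then have e: "L * norm (x - y) \<le> L * \<delta>" using L0 by (intro mult_left_mono)
          have "W (x + h *\<^sub>R v) = W' (x + h *\<^sub>R v)" "W x = W' x"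
            using W'(2) seg[of h] seg[of 0] hpos by auto
          then show ?thesis using W'l[of "x + h *\<^sub>R v" "y + h *\<^sub>R v"] W'l[of x y] e True
            by (simp del: mem_cball)
        qed (simp del: mem_cball)
      qed
      also have "\<dots> = M h - M 0"
        unfolding M_def by (rule Bochner_Integration.integral_diff[OF intW intW])
      finally show ?thesis by simp
    qed
    moreover have "measure lborel ?Q > 0"
      using content_cball_pos[OF \<delta>(1), of x] by simp
    ultimately have "(W (x + h *\<^sub>R v) - W x - 2 * L * \<delta>) * measure lborel ?Q \<le> (c * h) * measure lborel ?Q"
      using order_trans by blast
    then show ?thesis using \<open>measure lborel ?Q > 0\<close> mult_right_le_imp_le by blast
  qed
  show ?thesis
  proof (rule field_le_epsilon)
    fix e :: real assume e: "0 < e"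
    define \<delta> where "\<delta> = min (r / 2) (e / (2 * (L + 1)))"
    have \<delta>: "0 < \<delta>" "\<delta> < r" "\<delta> \<le> e / (2 * (L + 1))" using r e L0 by (auto simp: \<delta>_def)
    have "2 * L * \<delta> \<le> 2 * (L + 1) * \<delta>" using \<delta>(1) by simp
    also have "\<dots> \<le> e" using \<delta>(3) L0 by (simp add: field_simps)
    finally show "W (x + h *\<^sub>R v) - W x \<le> c * h + e" using main[OF \<delta>(1,2)] by linarith
  qed
qed

text \<open>The segment lemma asks for an open set around the segment, so it is applied between a +
  s and b - s. The two ends cost at most 2 L s and the shortened interval at most 2 |c| s; the
  constant \<open>K\<close> collects these terms.\<close>

lemma lipschitz_descent_real:
  fixes g :: "real \<Rightarrow> real"
  assumes ab: "a \<le> b" and Lip: "L-lipschitz_on {a..b} g" and N: "negligible N"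
    and D: "\<And>t d. t \<in> {a<..<b} - N \<Longrightarrow> (g has_real_derivative d) (at t) \<Longrightarrow> d \<le> c"
  shows "g b - g a \<le> c * (b - a)"
proof (cases "a = b")
  case False
  have L0: "0 \<le> L" using Lip lipschitz_on_nonneg by blast
  have inner: "g b' - g a' \<le> c * (b' - a')" if "a < a'" "a' \<le> b'" "b' < b" for a' b'
  proof -
    have "g (a' + (b' - a') *\<^sub>R 1) - g a' \<le> c * (b' - a')"
    proof (rule lipschitz_descent_segment[of L "{a<..<b}" _ _ _ _ N])
      show "L-lipschitz_on {a<..<b} g" by (rule lipschitz_on_subset[OF Lip]) auto
      fix y D' assume y: "y \<in> {a<..<b} - N" "(g has_derivative D') (at y)"
      have "(g has_real_derivative D' 1) (at y)"
      proof -
        have "D' = (*) (D' 1)"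
        proof
          fix z
          have "D' (z *\<^sub>R 1) = z *\<^sub>R D' 1" by (rule linear_scale[OF has_derivative_linear[OF y(2)]])
          then show "D' z = D' 1 * z" by (metis real_scaleR_def mult_1_right mult.commute)
        qed
        then show ?thesis using y(2) unfolding has_field_derivative_def by metis
      qed
      then show "D' 1 \<le> c" by (rule D[OF y(1)])
    qed (use that N in auto)
    then show ?thesis by simp
  qed
  show ?thesis
  proof (rule field_le_epsilon)
    fix e :: real assume e: "0 < e"
    define K where "K = 2 * L + 2 * \<bar>c\<bar> + 1"
    have K: "K > 0" using L0 by (simp add: K_def)
    define s where "s = min ((b - a) / 3) (e / K)"
    have "s \<le> e / K" by (simp add: s_def)
    then have sK: "s * K \<le> e" using K by (simp add: pos_le_divide_eq)
    have s: "0 < s" "s \<le> (b - a) / 3" unfolding s_def using ab False e K by (simp, intro min.cobounded1)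
    have "g (b - s) - g (a + s) \<le> c * ((b - s) - (a + s))" using s ab by (intro inner) auto
    moreover have "\<bar>g b - g (b - s)\<bar> \<le> L * s" using lipschitz_abs_diff[OF Lip, of b "b - s"] s ab by auto
    moreover have "\<bar>g (a + s) - g a\<bar> \<le> L * s" using lipschitz_abs_diff[OF Lip, of "a + s" a] s ab by auto
    moreover have "- c * (2 * s) \<le> \<bar>c\<bar> * (2 * s)" using s(1) by (intro mult_right_mono) auto
    moreover have "2 * (L * s) + \<bar>c\<bar> * (2 * s) \<le> s * K" using s(1) by (simp add: K_def algebra_simps)
    moreover have "c * ((b - s) - (a + s)) = c * (b - a) + - c * (2 * s)" by (simp add: algebra_simps)
    ultimately show "g b - g a \<le> c * (b - a) + e" using sK by linarith
  qed
qed simp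

text \<open>The derivative bound at y concerns the direction \<open>F y\<close>, the increment the
  fixed direction \<open>F x\<close>. The discrepancy is at most L |F y - F x| and is absorbed, near
  x, by the gap between \<open>- a x\<close> and \<open>c\<close>.\<close>

lemma lipschitz_local_descent:
  fixes W :: "'a::euclidean_space \<Rightarrow> real"
  assumes Lip: "L-lipschitz_on (ball x r) W" and r: "r > 0"
    and F: "isCont F x" and a: "isCont a x"
    and D: "\<And>y D. y \<in> ball x r \<Longrightarrow> (W has_derivative D) (at y) \<Longrightarrow> D (F y) \<le> - a y"
    and c: "- a x < c"
  shows "\<exists>\<delta>>0. \<forall>h. 0 < h \<and> h < \<delta> \<longrightarrow> W (x + h *\<^sub>R F x) - W x \<le> c * h"
proof -
  have "((\<lambda>y. - a y + L * norm (F y - F x)) \<longlongrightarrow> - a x + L * norm (F x - F x)) (at x)"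
    using F a unfolding isCont_def by (intro tendsto_intros)
  then have "\<forall>\<^sub>F y in at x. - a y + L * norm (F y - F x) < c"
    using c by (intro order_tendstoD) auto
  then obtain s where s: "s > 0" "\<And>y. y \<noteq> x \<Longrightarrow> dist y x < s \<Longrightarrow> - a y + L * norm (F y - F x) < c"
    unfolding eventually_at by blast
  have s': "- a y + L * norm (F y - F x) < c" if "dist y x < s" for y
    using s(2)[of y] that c by (cases "y = x") auto
  define \<rho> where "\<rho> = min r s"
  have \<rho>: "\<rho> > 0" using r s by (simp add: \<rho>_def)
  define \<delta> where "\<delta> = \<rho> / (norm (F x) + 1)"
  have \<delta>: "\<delta> > 0" using \<rho> by (simp add: \<delta>_def add_nonneg_pos)
  have Lb: "L-lipschitz_on (ball x \<rho>) W" by (rule lipschitz_on_subset[OF Lip]) (auto simp: \<rho>_def)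
  show ?thesis
  proof (intro exI[of _ \<delta>] conjI \<delta> allI impI)
    fix h assume h: "0 < h \<and> h < \<delta>"
    show "W (x + h *\<^sub>R F x) - W x \<le> c * h"
    proof (rule lipschitz_descent_segment[OF Lb, of h x "F x" "{}"])
      fix t assume t: "0 \<le> t" "t \<le> h"
      have "t * norm (F x) \<le> h * (norm (F x) + 1)" using t by (intro mult_mono) auto
      also have "\<dots> < \<rho>" using h pos_less_divide_eq[of "norm (F x) + 1" h \<rho>] by (simp add: \<delta>_def add_nonneg_pos)
      finally show "x + t *\<^sub>R F x \<in> ball x \<rho>" using t by (simp add: dist_norm)
    next
      fix y D' assume y: "y \<in> ball x \<rho> - {}" "(W has_derivative D') (at y)"
      have "D' (F x) = D' (F y) + D' (F x - F y)"
        using linear_add[OF has_derivative_linear[OF y(2)], of "F y" "F x - F y"] by simp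
      also have "D' (F y) \<le> - a y" using y D by (auto simp: \<rho>_def)
      also have "D' (F x - F y) \<le> L * norm (F y - F x)"
        using has_derivative_lipschitz_bound[OF y(2) open_ball _ Lb, of "F x - F y"] y(1)
        by (auto simp: norm_minus_commute)
      finally show "D' (F x) \<le> c" using s'[of y] y(1) by (auto simp: \<rho>_def dist_commute)
    qed (use h in auto)
  qed
qed


section \<open>Comparison functions\<close>

lemma class_KI:
  assumes "continuous_on {0..} g" "\<And>r s. 0 \<le> r \<Longrightarrow> r < s \<Longrightarrow> g r < g s" "g 0 = 0"
  shows "class_K g"
  unfolding class_K_def using assms by (simp add: strict_mono_on_def)

lemma class_K_less: "class_K g \<Longrightarrow> 0 \<le> r \<Longrightarrow> r < s \<Longrightarrow> g r < g s"
  unfolding class_K_def strict_mono_on_def by auto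

lemma class_K_mono: "class_K g \<Longrightarrow> 0 \<le> r \<Longrightarrow> r \<le> s \<Longrightarrow> g r \<le> g s"
  using class_K_less[of g r s] by (cases "r = s") auto

lemma class_K_0: "class_K g \<Longrightarrow> g 0 = 0"
  unfolding class_K_def by auto

lemma class_K_pos: "class_K g \<Longrightarrow> 0 < r \<Longrightarrow> 0 < g r"
  using class_K_less[of g 0 r] class_K_0[of g] by simp

lemma class_K_nonneg: "class_K g \<Longrightarrow> 0 \<le> r \<Longrightarrow> 0 \<le> g r"
  using class_K_mono[of g 0 r] class_K_0[of g] by simp

lemma class_K_continuous_on: "class_K g \<Longrightarrow> S \<subseteq> {0..} \<Longrightarrow> continuous_on S g"
  unfolding class_K_def using continuous_on_subset by blast

lemma class_K_le_iff: "class_K g \<Longrightarrow> 0 \<le> r \<Longrightarrow> 0 \<le> s \<Longrightarrow> g r \<le> g s \<longleftrightarrow> r \<le> s"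
  using class_K_less[of g s r] class_K_mono[of g r s] by force

lemma class_K_compose:
  assumes "class_K g" "class_K h" shows "class_K (\<lambda>r. g (h r))"
proof (rule class_KI)
  have "h ` {0..} \<subseteq> {0..}" using class_K_nonneg[OF assms(2)] by auto
  then show "continuous_on {0..} (\<lambda>r. g (h r))"
    by (intro continuous_on_compose2[of "{0..}" g _ h] class_K_continuous_on assms order_refl)
  show "g (h r) < g (h s)" if "0 \<le> r" "r < s" for r s
    by (rule class_K_less[OF assms(1) class_K_nonneg[OF assms(2) that(1)] class_K_less[OF assms(2) that]])
  show "g (h 0) = 0" by (simp add: class_K_0[OF assms(1)] class_K_0[OF assms(2)])
qed

lemma class_K_add:
  assumes "class_K g" "class_K h" shows "class_K (\<lambda>r. g r + h r)"
proof (rule class_KI)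
  show "continuous_on {0..} (\<lambda>r. g r + h r)"
    by (intro continuous_on_add class_K_continuous_on assms order_refl)
  show "g r + h r < g s + h s" if "0 \<le> r" "r < s" for r s
    using class_K_less[OF assms(1) that] class_K_less[OF assms(2) that] by simp
qed (simp add: class_K_0[OF assms(1)] class_K_0[OF assms(2)])

lemma class_K_inf_iff: "class_K_inf g \<longleftrightarrow> class_K g \<and> (\<forall>M. \<exists>r\<ge>0. M \<le> g r)"
proof (cases "class_K g")
  case True
  have "bounded (g ` {0..}) \<longleftrightarrow> (\<exists>M. \<forall>r\<ge>0. g r < M)"
  proof
    assume "bounded (g ` {0..})"
    then obtain B where "\<forall>r\<ge>0. \<bar>g r\<bar> \<le> B" unfolding bounded_iff by auto
    then show "\<exists>M. \<forall>r\<ge>0. g r < M" by (intro exI[of _ "B + 1"]) force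
  next
    assume "\<exists>M. \<forall>r\<ge>0. g r < M"
    then obtain M where "\<forall>r\<ge>0. g r < M" by blast
    then show "bounded (g ` {0..})"
      unfolding bounded_iff using class_K_nonneg[OF True] by (intro exI[of _ M]) force
  qed
  then have "\<not> bounded (g ` {0..}) \<longleftrightarrow> (\<forall>M. \<exists>r\<ge>0. M \<le> g r)"
    by (simp add: linorder_not_less)
  then show ?thesis by (simp add: class_K_inf_def True)
qed (simp add: class_K_inf_def)

lemma class_K_infD: "class_K_inf g \<Longrightarrow> class_K g"
  by (simp add: class_K_inf_def)

lemma class_K_inf_compose:
  assumes "class_K_inf g" "class_K_inf h" shows "class_K_inf (\<lambda>r. g (h r))"
proof -
  have "\<exists>r\<ge>0. M \<le> g (h r)" for M
  proof -
    obtain s where s: "s \<ge> 0" "M \<le> g s" using assms(1) class_K_inf_iff by blast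
    obtain r where r: "r \<ge> 0" "s \<le> h r" using assms(2) class_K_inf_iff by blast
    then show ?thesis using s class_K_mono[OF class_K_infD[OF assms(1)] s(1) r(2)] by force
  qed
  then show ?thesis using class_K_compose[of g h] assms by (simp add: class_K_inf_iff)
qed

lemma class_K_inf_ge:
  assumes "class_K g" "class_K_inf h" "\<And>r. 0 \<le> r \<Longrightarrow> h r \<le> g r" shows "class_K_inf g"
proof -
  have "\<exists>r\<ge>0. M \<le> g r" for M
  proof -
    obtain r where "r \<ge> 0" "M \<le> h r" using assms(2) class_K_inf_iff by blast
    then show ?thesis using assms(3)[of r] by (intro exI[of _ r]) simp
  qed
  then show ?thesis using assms(1) by (simp add: class_K_inf_iff)
qed

lemma class_K_inf_scale:
  assumes "c > 0" shows "class_K_inf (\<lambda>r. c * r)"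
proof -
  have "M \<le> c * (\<bar>M\<bar> / c)" for M using assms by simp
  then have "\<exists>r\<ge>0. M \<le> c * r" for M
    using assms by (meson abs_ge_zero divide_nonneg_pos)
  moreover have "class_K (\<lambda>r. c * r)"
    using assms by (intro class_KI) (auto intro: continuous_on_mult_left)
  ultimately show ?thesis by (simp add: class_K_inf_iff)
qed

lemma class_K_inf_min:
  assumes "class_K_inf g" "class_K_inf h" shows "class_K_inf (\<lambda>r. min (g r) (h r))"
proof -
  have K: "class_K g" "class_K h" using assms class_K_infD by auto
  have "\<exists>r\<ge>0. M \<le> min (g r) (h r)" for M
  proof -
    obtain s where s: "s \<ge> 0" "M \<le> g s" using assms(1) class_K_inf_iff by blast
    obtain r where r: "r \<ge> 0" "M \<le> h r" using assms(2) class_K_inf_iff by blast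
    have "g s \<le> g (max r s)" "h r \<le> h (max r s)" using K s r by (auto intro: class_K_mono)
    then show ?thesis using r s by (intro exI[of _ "max r s"]) auto
  qed
  moreover have "class_K (\<lambda>r. min (g r) (h r))"
  proof (rule class_KI)
    show "continuous_on {0..} (\<lambda>r. min (g r) (h r))"
      by (intro continuous_on_min class_K_continuous_on K order_refl)
    show "min (g r) (h r) < min (g s) (h s)" if "0 \<le> r" "r < s" for r s
      using class_K_less[OF K(1) that] class_K_less[OF K(2) that] by (simp add: min_less_iff_disj)
  qed (simp add: class_K_0[OF K(1)] class_K_0[OF K(2)])
  ultimately show ?thesis by (simp add: class_K_inf_iff)
qed

lemma class_K_inf_lower_bound:
  assumes "finite I" "\<And>i. i \<in> I \<Longrightarrow> class_K_inf (g i)"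
  shows "\<exists>h. class_K_inf h \<and> (\<forall>i\<in>I. \<forall>r\<ge>0. h r \<le> g i r)"
  using assms
proof (induction I)
  case empty
  then show ?case using class_K_inf_scale[of 1] by auto
next
  case (insert i I)
  then obtain h where "class_K_inf h" "\<forall>i\<in>I. \<forall>r\<ge>0. h r \<le> g i r" by auto
  then show ?case using insert.prems class_K_inf_min[of "g i" h]
    by (intro exI[of _ "\<lambda>r. min (g i r) (h r)"]) (auto simp: min_le_iff_disj)
qed

lemma class_K_upper_bound:
  assumes "finite I" "\<And>i. i \<in> I \<Longrightarrow> class_K (g i) \<or> zero_fun (g i)"
  shows "\<exists>h. class_K_inf h \<and> (\<forall>i\<in>I. \<forall>r\<ge>0. g i r \<le> h r)"
  using assms
proof (induction I)
  case empty
  then show ?case using class_K_inf_scale[of 1] by auto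
next
  case (insert i I)
  then obtain h where h: "class_K_inf h" "\<forall>i\<in>I. \<forall>r\<ge>0. g i r \<le> h r" by auto
  have hn: "0 \<le> h r" if "r \<ge> 0" for r using class_K_nonneg[OF class_K_infD[OF h(1)] that] .
  show ?case
  proof (cases "class_K (g i)")
    case True
    have "class_K_inf (\<lambda>r. g i r + h r)"
      using class_K_inf_ge[OF class_K_add[OF True class_K_infD[OF h(1)]] h(1)] class_K_nonneg[OF True] by simp
    moreover have "g j r \<le> g i r + h r" if "j \<in> insert i I" "r \<ge> 0" for j r
      using that h(2) hn[OF that(2)] class_K_nonneg[OF True that(2)]
      by (cases "j = i") (auto simp: add_increasing)
    ultimately show ?thesis by (intro exI[of _ "\<lambda>r. g i r + h r"]) blast
  next
    case False
    then have "zero_fun (g i)" using insert.prems by blast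
    then show ?thesis using h hn by (intro exI[of _ h]) (auto simp: zero_fun_def)
  qed
qed

lemma class_K_inf_onto:
  assumes "class_K_inf g" "0 \<le> y" shows "\<exists>x\<ge>0. g x = y"
proof -
  obtain r where r: "r \<ge> 0" "y \<le> g r" using assms class_K_inf_iff by blast
  have "continuous_on {0..r} g"
    by (rule class_K_continuous_on[OF class_K_infD[OF assms(1)]]) auto
  then obtain x where "0 \<le> x" "x \<le> r" "g x = y"
    using IVT'[of g 0 y r] r assms class_K_0[OF class_K_infD[OF assms(1)]] by auto
  then show ?thesis by blast
qed

lemma inv_K_props:
  assumes "class_K_inf g" "0 \<le> y"
  shows "0 \<le> inv_K g y" "g (inv_K g y) = y"
proof -
  have "y \<in> g ` {0..}" using class_K_inf_onto[OF assms] by auto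
  then show "0 \<le> inv_K g y" "g (inv_K g y) = y"
    using inv_into_into[of y g "{0..}"] f_inv_into_f[of y g "{0..}"] by auto
qed

lemma inv_K_eq:
  assumes "class_K_inf g" "0 \<le> x" shows "inv_K g (g x) = x"
proof -
  have "inj_on g {0..}" using assms(1) unfolding class_K_inf_def class_K_def
    by (auto intro: strict_mono_on_imp_inj_on)
  then show ?thesis using assms(2) by (intro inv_into_f_f) auto
qed

lemma inv_K_le_iff:
  assumes "class_K_inf g" "0 \<le> y" "0 \<le> r" shows "inv_K g y \<le> r \<longleftrightarrow> y \<le> g r"
  using class_K_le_iff[OF class_K_infD[OF assms(1)] inv_K_props(1)[OF assms(1,2)] assms(3)] inv_K_props(2)[OF assms(1,2)] by simp

lemma inv_K_ge_iff:
  assumes "class_K_inf g" "0 \<le> y" "0 \<le> r" shows "r \<le> inv_K g y \<longleftrightarrow> g r \<le> y"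
  using class_K_le_iff[OF class_K_infD[OF assms(1)] assms(3) inv_K_props(1)[OF assms(1,2)]] inv_K_props(2)[OF assms(1,2)] by simp

lemma class_K_inf_inv_K:
  assumes g: "class_K_inf g" shows "class_K_inf (inv_K g)"
proof -
  have K: "class_K g" using g class_K_infD by blast
  have "continuous_on {0..} (inv_K g)"
    unfolding continuous_on_eq_continuous_within
  proof
    fix y :: real assume y: "y \<in> {0..}"
    \<comment> \<open>Going up to y + 1 makes [0, y + 1] a neighbourhood of y in the half line. Its
      preimage [0, r] is compact, and a continuous injection on a compact set has a continuous
      inverse.\<close>
    obtain r where r: "r \<ge> 0" "g r = y + 1" using class_K_inf_onto[OF g, of "y + 1"] y by auto
    have im: "g ` {0..r} = {0..y+1}"
    proof
      show "g ` {0..r} \<subseteq> {0..y+1}" using class_K_nonneg[OF K] class_K_mono[OF K, of _ r] r by auto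
      show "{0..y+1} \<subseteq> g ` {0..r}"
      proof
        fix z assume z: "z \<in> {0..y+1}"
        then obtain x where x: "x \<ge> 0" "g x = z" using class_K_inf_onto[OF g, of z] by auto
        then have "x \<le> r" using class_K_le_iff[OF K x(1) r(1)] r z by auto
        then show "z \<in> g ` {0..r}" using x by auto
      qed
    qed
    have c: "continuous_on {0..r} g"
      by (rule class_K_continuous_on[OF K]) auto
    have "continuous_on (g ` {0..r}) (inv_K g)"
      by (rule continuous_on_inv[OF c compact_Icc]) (use inv_K_eq[OF g] in auto)
    then have "continuous (at y within {0..y+1}) (inv_K g)"
      unfolding im continuous_on_eq_continuous_within using y by auto
    moreover have "at y within {0..} = at y within {0..y+1}"
      by (rule at_within_nhd[of y "{y - 1<..<y+1}"]) auto
    ultimately show "continuous (at y within {0..}) (inv_K g)" by simp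
  qed
  moreover have "strict_mono_on {0..} (inv_K g)"
  proof (rule strict_mono_onI)
    fix a b :: real assume "a \<in> {0..}" "b \<in> {0..}" "a < b"
    then show "inv_K g a < inv_K g b"
      using inv_K_le_iff[OF g, of b "inv_K g a"] inv_K_props[OF g, of a] by auto
  qed
  moreover have "inv_K g 0 = 0" using inv_K_eq[OF g, of 0] class_K_0[OF K] by simp
  moreover have "\<exists>r\<ge>0. M \<le> inv_K g r" for M
    using inv_K_eq[OF g, of "max M 0"] class_K_nonneg[OF K, of "max M 0"] by (intro exI[of _ "g (max M 0)"]) auto
  ultimately show ?thesis by (simp add: class_K_inf_iff class_K_def)
qed

text \<open>The envelope is the 1-Lipschitz regularisation \<open>\<rho> \<mapsto> inf\<^sub>x (e x + \<bar>\<rho> - n x\<bar>)\<close>.\<close>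

lemma pos_def_lower_envelope:
  fixes n e :: "'x \<Rightarrow> real"
  assumes pos: "\<And>a b. 0 < a \<Longrightarrow> a \<le> b \<Longrightarrow> \<exists>\<kappa>>0. \<forall>x\<in>X. a \<le> n x \<and> n x \<le> b \<longrightarrow> \<kappa> \<le> e x"
    and n_pos: "\<And>x. x \<in> X \<Longrightarrow> 0 < n x"
  shows "\<exists>\<alpha>. pos_def_fun \<alpha> \<and> (\<forall>x\<in>X. \<alpha> (n x) \<le> e x) \<and> (\<forall>r\<ge>0. \<alpha> r \<le> r) \<and> (\<forall>r s. \<bar>\<alpha> r - \<alpha> s\<bar> \<le> \<bar>r - s\<bar>)"
proof -
  have e_pos: "0 \<le> e x" if "x \<in> X" for x
    using pos[of "n x" "n x"] n_pos[OF that] that by force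
  \<comment> \<open>The extra element \<open>\<bar>\<rho>\<bar>\<close> makes the set nonempty and
    forces \<open>\<alpha> 0 = 0\<close> and \<open>\<alpha> r \<le> r\<close>.\<close>
  define A where "A \<rho> = insert \<bar>\<rho>\<bar> ((\<lambda>x. e x + \<bar>\<rho> - n x\<bar>) ` X)" for \<rho>
  define \<alpha> where "\<alpha> \<rho> = Inf (A \<rho>)" for \<rho>
  have ne: "A \<rho> \<noteq> {}" for \<rho> by (simp add: A_def)
  have lb: "0 \<le> z" if "z \<in> A \<rho>" for z \<rho> using that e_pos by (auto simp: A_def)
  have bdd: "bdd_below (A \<rho>)" for \<rho> using lb by (meson bdd_belowI)
  have step: "\<alpha> r \<le> \<alpha> s + \<bar>r - s\<bar>" for r s
  proof -
    have "\<alpha> r - \<bar>r - s\<bar> \<le> Inf (A s)"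
    proof (rule cInf_greatest[OF ne])
      fix z assume "z \<in> A s"
      then consider "z = \<bar>s\<bar>" | x where "x \<in> X" "z = e x + \<bar>s - n x\<bar>" by (auto simp: A_def)
      then show "\<alpha> r - \<bar>r - s\<bar> \<le> z"
      proof cases
        case 1
        have "\<alpha> r \<le> \<bar>r\<bar>" unfolding \<alpha>_def by (rule cInf_lower[OF _ bdd]) (simp add: A_def)
        then show ?thesis using 1 by linarith
      next
        case 2
        have "\<alpha> r \<le> e x + \<bar>r - n x\<bar>" unfolding \<alpha>_def by (rule cInf_lower[OF _ bdd]) (use 2 in \<open>auto simp: A_def\<close>)
        then show ?thesis using 2 by linarith
      qed
    qed
    then show ?thesis by (simp add: \<alpha>_def)
  qed
  have lip: "\<bar>\<alpha> r - \<alpha> s\<bar> \<le> \<bar>r - s\<bar>" for r s using step[of r s] step[of s r] by (simp add: abs_minus_commute)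
  have nonneg: "0 \<le> \<alpha> r" for r unfolding \<alpha>_def by (rule cInf_greatest[OF ne lb])
  have le: "\<alpha> r \<le> \<bar>r\<bar>" for r unfolding \<alpha>_def by (rule cInf_lower[OF _ bdd]) (simp add: A_def)
  have le_e: "\<alpha> (n x) \<le> e x" if "x \<in> X" for x
  proof -
    have "e x + \<bar>n x - n x\<bar> \<in> A (n x)" using that unfolding A_def by blast
    from cInf_lower[OF this bdd] show ?thesis by (simp add: \<alpha>_def)
  qed
  have apos: "0 < \<alpha> r" if r: "r > 0" for r
  proof -
    \<comment> \<open>Points with n x between r/2 and 2 r have e x at least \<kappa>; for all others
      the penalty |r - n x| is at least r/2.\<close>
    obtain \<kappa> where \<kappa>: "\<kappa> > 0" "\<forall>x\<in>X. r / 2 \<le> n x \<and> n x \<le> 2 * r \<longrightarrow> \<kappa> \<le> e x"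
      using pos[of "r / 2" "2 * r"] r by auto
    have "min \<kappa> (r / 2) \<le> Inf (A r)"
    proof (rule cInf_greatest[OF ne])
      fix z assume "z \<in> A r"
      then consider "z = \<bar>r\<bar>" | x where "x \<in> X" "z = e x + \<bar>r - n x\<bar>" by (auto simp: A_def)
      then show "min \<kappa> (r / 2) \<le> z"
      proof cases
        case 2
        show ?thesis
        proof (cases "r / 2 \<le> n x \<and> n x \<le> 2 * r")
          case True
          then have "\<kappa> \<le> e x" using \<kappa>(2) 2 by blast
          then have "\<kappa> \<le> e x + \<bar>r - n x\<bar>" by linarith
          then show ?thesis using 2 by linarith
        next
          case False
          then have "r / 2 \<le> \<bar>r - n x\<bar>" using r by (auto simp: abs_if)
          then show ?thesis using 2 e_pos[OF 2(1)] by linarith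
        qed
      qed (use r in auto)
    qed
    then show ?thesis using \<kappa>(1) r by (auto simp: \<alpha>_def min_def split: if_splits)
  qed
  have cont: "continuous_on {0..} \<alpha>"
  proof (rule lipschitz_on_continuous_on)
    show "1-lipschitz_on {0..} \<alpha>" by (rule lipschitz_onI) (use lip in \<open>auto simp: dist_real_def\<close>)
  qed
  have a0: "\<alpha> 0 = 0" using le[of 0] nonneg[of 0] by simp
  show ?thesis
  proof (intro exI[of _ \<alpha>] conjI allI ballI impI le_e lip)
    show "pos_def_fun \<alpha>" unfolding pos_def_fun_def
    proof (intro conjI cont allI impI nonneg)
      fix r :: real assume "0 \<le> r"
      then show "(\<alpha> r = 0) = (r = 0)" using apos[of r] a0 by (cases "r = 0") auto
    qed
    show "\<alpha> r \<le> r" if "r \<ge> 0" for r using le[of r] that by simp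
  qed
qed


section \<open>Caratheodory solutions\<close>

lemma negligible_spike_bound:
  fixes g :: "real \<Rightarrow> 'a::euclidean_space"
  assumes g: "g integrable_on {a..b}" and N: "negligible N"
    and B: "\<And>s. s \<in> {a..b} - N \<Longrightarrow> norm (g s) \<le> B" and "0 \<le> B" "a \<le> b"
  shows "norm (integral {a..b} g) \<le> B * (b - a)"
proof -
  define g' where "g' s = (if s \<in> N then 0 else g s)" for s
  have g'i: "g' integrable_on {a..b}"
    by (rule integrable_spike[OF g N]) (simp add: g'_def)
  have "integral {a..b} g = integral {a..b} g'"
    by (rule integral_spike[OF N]) (simp add: g'_def)
  moreover have "norm (integral (cbox a b) g') \<le> B * measure lborel (cbox a b)"
    using B \<open>0 \<le> B\<close> g'i by (intro integrable_bound) (auto simp: g'_def)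
  ultimately show ?thesis using \<open>a \<le> b\<close> by simp
qed

lemma is_solution_cong_AE:
  assumes sol: "is_solution g I x0 x" and N: "negligible N"
    and eq: "\<And>t s. t \<in> I \<Longrightarrow> s \<in> {0..t} - N \<Longrightarrow> g' s (x s) = g s (x s)"
  shows "is_solution g' I x0 x"
  unfolding is_solution_def
proof (intro ballI conjI)
  fix t assume t: "t \<in> I"
  have 1: "(\<lambda>s. g s (x s)) absolutely_integrable_on {0..t}" and 2: "x t = x0 + integral {0..t} (\<lambda>s. g s (x s))"
    using sol t unfolding is_solution_def by auto
  show "(\<lambda>s. g' s (x s)) absolutely_integrable_on {0..t}"
    by (rule absolutely_integrable_spike[OF 1 N]) (rule eq[OF t])
  have "integral {0..t} (\<lambda>s. g' s (x s)) = integral {0..t} (\<lambda>s. g s (x s))"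
    by (rule integral_spike[OF N]) (metis eq[OF t])
  with 2 show "x t = x0 + integral {0..t} (\<lambda>s. g' s (x s))" by simp
qed

lemma Linf_norm_AE:
  fixes u :: "real \<Rightarrow> 'a::euclidean_space"
  assumes "Linf u"
  shows "\<exists>N. negligible N \<and> (\<forall>t\<ge>0. t \<notin> N \<longrightarrow> norm (u t) \<le> Linf_norm u)" and "0 \<le> Linf_norm u"
proof -
  let ?M = "lebesgue_on {0::real..}" and ?e = "esssup (lebesgue_on {0..}) (\<lambda>t. ereal (norm (u t)))"
  have 1: "AE t in ?M. ereal (norm (u t)) \<le> ?e" by (rule esssup_AE)
  have "AE t in lebesgue. t \<in> {0..} \<longrightarrow> ereal (norm (u t)) \<le> ?e"
    using 1 by (subst (asm) AE_restrict_space_iff) auto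
  then obtain N where N: "negligible N" "{t. \<not> (t \<in> {0..} \<longrightarrow> ereal (norm (u t)) \<le> ?e)} \<subseteq> N"
    unfolding eventually_ae_filter_negligible by blast
  have N2: "ereal (norm (u t)) \<le> ?e" if "t \<ge> 0" "t \<notin> N" for t using N(2) that by auto
  \<comment> \<open>One time outside \<open>N\<close> excludes the value minus infinity for the
    essential supremum. This matters because \<open>real_of_ereal\<close> turns infinite values into
    0.\<close>
  have "\<not> {0..1::real} \<subseteq> N"
    using N(1) negligible_subset[of N "{0..1}"] negligible_interval(1)[of 0 "1::real"] by auto
  then obtain t0 :: real where "t0 \<in> {0..1}" and t0N: "t0 \<notin> N" by blast
  then have t0: "t0 \<ge> 0" "t0 \<notin> N" by auto
  have fin: "\<bar>?e\<bar> \<noteq> \<infinity>"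
    using N2[OF t0] assms unfolding Linf_def by (cases "?e") auto
  then have e: "?e = ereal (Linf_norm u)" unfolding Linf_norm_def by (simp add: ereal_real)
  have b: "norm (u t) \<le> Linf_norm u" if "t \<ge> 0" "t \<notin> N" for t
    using N2[OF that] unfolding e by simp
  show "\<exists>N. negligible N \<and> (\<forall>t\<ge>0. t \<notin> N \<longrightarrow> norm (u t) \<le> Linf_norm u)"
    using N(1) b by blast
  show "0 \<le> Linf_norm u" using b[OF t0] norm_ge_zero order_trans by blast
qed

text \<open>
  Tonelli's delayed approximations \<open>z' = G t (z (t - \<delta>))\<close> are obtained by iterating the integral
  operator: the \<open>m\<close>-th iterate has already settled on \<open>(-\<infinity>, m \<delta>]\<close>. The weight \<open>1 + \<bar>t\<bar>\<close>
  makes the family uniformly bounded on the whole half line.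
\<close>

lemma Caratheodory_global:
  fixes G :: "real \<Rightarrow> 'a \<Rightarrow> 'a::euclidean_space"
  assumes M: "\<And>s z. norm (G s z) \<le> M"
    and cont: "\<And>s. continuous_on UNIV (G s)"
    and meas: "\<And>y t. continuous_on UNIV y \<Longrightarrow> (\<lambda>s. G s (y s)) absolutely_integrable_on {0..t}"
  shows "\<exists>x. is_solution G {0..} x0 x \<and> continuous_on UNIV x"
proof -
  have M0: "0 \<le> M" using M norm_ge_zero order_trans by blast
  \<comment> \<open>For negative t the interval {0..t} is empty and the value is \<open>x0\<close>.
    This is the history to which the delay refers at times below \<delta>.\<close>
  define op where "op \<delta> y t = x0 + integral {0..t} (\<lambda>s. G s (y (s - \<delta>)))" for \<delta> y t
  have op_lip: "M-lipschitz_on UNIV (op \<delta> y)" if y: "continuous_on UNIV y" for \<delta> y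
  proof -
    let ?g = "\<lambda>s. G s (y (s - \<delta>))"
    have "continuous_on UNIV (\<lambda>s. y (s - \<delta>))"
      by (rule continuous_on_compose2[OF y]) (auto intro: continuous_intros)
    from meas[OF this] have int: "?g integrable_on {0..t}" for t
      using absolutely_integrable_on_def by blast
    have pos: "norm (op \<delta> y t - op \<delta> y s) \<le> M * (t - s)" if "0 \<le> s" "s \<le> t" for s t
    proof -
      have "integral {0..s} ?g + integral {s..t} ?g = integral {0..t} ?g"
        by (rule Henstock_Kurzweil_Integration.integral_combine[OF that int])
      then have "op \<delta> y t - op \<delta> y s = integral {s..t} ?g" by (simp add: op_def algebra_simps)
      moreover have "?g integrable_on {s..t}" by (rule integrable_on_subinterval[OF int[of t]]) (use that in auto)
      ultimately show ?thesis using negligible_spike_bound[of ?g s t "{}" M] M M0 that by simp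
    qed
    have neg: "op \<delta> y t = op \<delta> y (max 0 t)" for t
    proof (cases "t \<ge> 0")
      case False
      then have "{0..t} = {}" by simp
      then show ?thesis using False by (simp add: op_def)
    qed (simp add: max_def)
    have le: "norm (op \<delta> y t - op \<delta> y s) \<le> M * (t - s)" if "s \<le> t" for s t
    proof -
      have "norm (op \<delta> y (max 0 t) - op \<delta> y (max 0 s)) \<le> M * (max 0 t - max 0 s)" using that by (intro pos) auto
      also have "\<dots> \<le> M * (t - s)" using M0 that by (intro mult_left_mono) auto
      finally show ?thesis using neg by metis
    qed
    show ?thesis
    proof (rule lipschitz_onI[OF _ M0])
      fix s t :: real
      show "dist (op \<delta> y s) (op \<delta> y t) \<le> M * dist s t"
        using le[of s t] le[of t s] by (cases "s \<le> t") (auto simp: dist_norm norm_minus_commute)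
    qed
  qed
  define Y where "Y \<delta> m = (op \<delta> ^^ m) (\<lambda>_. x0)" for \<delta> m
  have YS: "Y \<delta> (Suc m) = op \<delta> (Y \<delta> m)" for \<delta> m by (simp add: Y_def)
  have Y_lip: "M-lipschitz_on UNIV (Y \<delta> m)" for \<delta> m
  proof (induction m)
    case 0 show ?case using M0 by (auto simp: Y_def lipschitz_on_def)
  next
    case (Suc m)
    show ?case unfolding YS by (rule op_lip[OF lipschitz_on_continuous_on[OF Suc]])
  qed
  have settle: "Y \<delta> (Suc m) t = Y \<delta> m t" if "\<delta> > 0" "t \<le> real m * \<delta>" for \<delta> m t
    using that(2)
  proof (induction m arbitrary: t)
    case 0
    then have "{0..t} \<subseteq> {0}" by auto
    then have "integral {0..t} (\<lambda>s. G s (Y \<delta> 0 (s - \<delta>))) = 0"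
      using 0 by (cases "t = 0") auto
    then show ?case by (simp add: YS op_def) (simp add: Y_def)
  next
    case (Suc m)
    have "integral {0..t} (\<lambda>s. G s (Y \<delta> (Suc m) (s - \<delta>))) = integral {0..t} (\<lambda>s. G s (Y \<delta> m (s - \<delta>)))"
    proof (rule integral_cong)
      fix s assume "s \<in> {0..t}"
      then have "s - \<delta> \<le> real m * \<delta>" using Suc.prems by (simp add: algebra_simps)
      then show "G s (Y \<delta> (Suc m) (s - \<delta>)) = G s (Y \<delta> m (s - \<delta>))" using Suc.IH by simp
    qed
    then have "op \<delta> (Y \<delta> (Suc m)) t = op \<delta> (Y \<delta> m) t" by (simp only: op_def)
    then show ?case by (simp only: YS)
  qed
  define d where "d k = 1 / real (Suc k)" for k
  \<comment> \<open>With delay 1/(k+1) the iterate number (k+1)^2 has settled up to time k+1. The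
    additional \<open>Suc\<close> makes the integral equation hold with \<open>z k\<close> on both
    sides up to time k.\<close>
  define z where "z k = Y (d k) (Suc (Suc k * Suc k))" for k
  have dpos: "d k > 0" for k by (simp add: d_def)
  have z_lip: "M-lipschitz_on UNIV (z k)" for k unfolding z_def by (rule Y_lip)
  have z_cont: "continuous_on UNIV (z k)" for k by (rule lipschitz_on_continuous_on[OF z_lip])
  have zl: "norm (z k s - z k t) \<le> M * \<bar>s - t\<bar>" for k s t
    using lipschitz_onD[OF z_lip, of s t k] by (simp add: dist_norm)
  have z_eq: "z k t = x0 + integral {0..t} (\<lambda>s. G s (z k (s - d k)))" if "t \<le> real k" for k t
  proof -
    have "integral {0..t} (\<lambda>s. G s (Y (d k) (Suc k * Suc k) (s - d k))) = integral {0..t} (\<lambda>s. G s (z k (s - d k)))"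
    proof (rule integral_cong)
      fix s assume "s \<in> {0..t}"
      moreover have "real (Suc k * Suc k) * d k = real (Suc k)" unfolding d_def of_nat_mult by simp
      ultimately have "s - d k \<le> real (Suc k * Suc k) * d k" using that dpos[of k] by simp
      from settle[OF dpos this] show "G s (Y (d k) (Suc k * Suc k) (s - d k)) = G s (z k (s - d k))"
        by (simp only: z_def)
    qed
    then show ?thesis unfolding z_def YS op_def by (simp only: z_def YS)
  qed
  have z0: "z k 0 = x0" for k using z_eq[of 0 k] by simp
  have zb: "norm (z k t) \<le> norm x0 + M * \<bar>t\<bar>" for k t
    using zl[of k t 0] norm_triangle_ineq2[of "z k t" x0] by (simp add: z0)
  \<comment> \<open>A diagonal argument over the rational times; the common Lipschitz constant
    \<open>M\<close> then carries convergence over to all times.\<close>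
  have "\<exists>\<kappa>. strict_mono (\<kappa> :: nat \<Rightarrow> nat) \<and> (\<forall>q\<in>\<rat>. \<exists>l. (\<lambda>n. (1 / (1 + \<bar>q\<bar>)) *\<^sub>R z (\<kappa> n) q) \<longlonglongrightarrow> l)"
  proof -
    have "norm ((1 / (1 + \<bar>q\<bar>)) *\<^sub>R z k q) \<le> norm x0 + M" for k q
    proof -
      have "norm (z k q) \<le> (norm x0 + M) * (1 + \<bar>q\<bar>)"
      proof -
        have "(norm x0 + M) * (1 + \<bar>q\<bar>) = norm x0 + M * \<bar>q\<bar> + (M + norm x0 * \<bar>q\<bar>)" by (simp add: algebra_simps)
        moreover have "0 \<le> M + norm x0 * \<bar>q\<bar>" using M0 by simp
        ultimately show ?thesis using zb[of k q] by linarith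
      qed
      then show ?thesis by (simp add: field_simps)
    qed
    then show ?thesis
      using function_convergent_subsequence[of \<rat> "\<lambda>k q. (1 / (1 + \<bar>q\<bar>)) *\<^sub>R z k q" "norm x0 + M"] countable_rat
      by metis
  qed
  then obtain \<kappa> where \<kappa>: "strict_mono (\<kappa> :: nat \<Rightarrow> nat)"
    and \<kappa>l: "\<And>q. q \<in> \<rat> \<Longrightarrow> \<exists>l. (\<lambda>n. (1 / (1 + \<bar>q\<bar>)) *\<^sub>R z (\<kappa> n) q) \<longlonglongrightarrow> l" by blast
  have convq: "Cauchy (\<lambda>n. z (\<kappa> n) q)" if qr: "q \<in> \<rat>" for q
  proof -
    obtain l where "(\<lambda>n. (1 / (1 + \<bar>q\<bar>)) *\<^sub>R z (\<kappa> n) q) \<longlonglongrightarrow> l" using \<kappa>l[OF qr] by blast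
    from tendsto_scaleR[OF tendsto_const[of "1 + \<bar>q\<bar>"] this]
    have "(\<lambda>n. z (\<kappa> n) q) \<longlonglongrightarrow> (1 + \<bar>q\<bar>) *\<^sub>R l" by (simp add: add_nonneg_eq_0_iff)
    then show ?thesis using LIMSEQ_imp_Cauchy by blast
  qed
  have conv: "convergent (\<lambda>n. z (\<kappa> n) t)" for t
  proof -
    have "Cauchy (\<lambda>n. z (\<kappa> n) t)"
    proof (rule metric_CauchyI)
      fix e :: real assume e: "0 < e"
      define \<eta> where "\<eta> = (e / 4) / (M + 1)"
      have \<eta>: "\<eta> > 0" using e M0 by (simp add: \<eta>_def)
      obtain q where q: "q \<in> \<rat>" "t < q" "q < t + \<eta>" using Rats_dense_in_real[of t "t + \<eta>"] \<eta> by auto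
      have "M * \<bar>t - q\<bar> \<le> (M + 1) * \<eta>" using q M0 by (intro mult_mono) auto
      also have "\<dots> = e / 4"
      proof -
        have "M + 1 \<noteq> 0" using M0 by auto
        then have "(M + 1) * (e / 4) / (M + 1) = e / 4" by (rule nonzero_mult_div_cancel_left)
        then show ?thesis by (simp only: \<eta>_def times_divide_eq_right)
      qed
      finally have Mq: "M * \<bar>t - q\<bar> \<le> e / 4" .
      obtain K where K: "\<And>m n. m \<ge> K \<Longrightarrow> n \<ge> K \<Longrightarrow> dist (z (\<kappa> m) q) (z (\<kappa> n) q) < e / 4"
        using metric_CauchyD[OF convq[OF q(1)], of "e / 4"] e by auto
      have "dist (z (\<kappa> m) t) (z (\<kappa> n) t) < e" if "m \<ge> K" "n \<ge> K" for m n
      proof -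
        have "dist (z k t) (z k q) \<le> e / 4" for k using zl[of k t q] Mq by (simp add: dist_norm)
        from this[of "\<kappa> m"] this[of "\<kappa> n"] K[OF that]
        show ?thesis using dist_triangle[of "z (\<kappa> m) t" "z (\<kappa> n) t" "z (\<kappa> m) q"]
            dist_triangle[of "z (\<kappa> m) q" "z (\<kappa> n) t" "z (\<kappa> n) q"] e by (simp add: dist_commute)
      qed
      then show "\<exists>K. \<forall>m\<ge>K. \<forall>n\<ge>K. dist (z (\<kappa> m) t) (z (\<kappa> n) t) < e" by blast
    qed
    then show ?thesis using Cauchy_convergent by blast
  qed
  define x where "x t = lim (\<lambda>n. z (\<kappa> n) t)" for t
  have xl: "(\<lambda>n. z (\<kappa> n) t) \<longlonglongrightarrow> x t" for t
    using conv[of t] by (simp add: x_def convergent_LIMSEQ_iff)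
  have x_cont: "continuous_on UNIV x"
  proof (rule lipschitz_on_continuous_on)
    show "M-lipschitz_on UNIV x"
    proof (rule lipschitz_onI[OF _ M0])
      fix s t
      have "(\<lambda>n. dist (z (\<kappa> n) s) (z (\<kappa> n) t)) \<longlonglongrightarrow> dist (x s) (x t)" by (intro tendsto_dist xl)
      then show "dist (x s) (x t) \<le> M * dist s t"
        by (rule LIMSEQ_le_const2) (use zl in \<open>auto simp: dist_norm\<close>)
    qed
  qed
  have "is_solution G {0..} x0 x" unfolding is_solution_def
  proof (intro ballI conjI)
    fix t :: real assume "t \<in> {0..}"
    then have t: "t \<ge> 0" by simp
    show ai: "(\<lambda>s. G s (x s)) absolutely_integrable_on {0..t}" by (rule meas[OF x_cont])
    have d0: "(\<lambda>n. d (\<kappa> n)) \<longlonglongrightarrow> 0"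
    proof -
      have "d \<longlonglongrightarrow> 0" unfolding d_def using LIMSEQ_inverse_real_of_nat by (simp add: inverse_eq_divide)
      from LIMSEQ_subseq_LIMSEQ[OF this \<kappa>] show ?thesis by (simp add: o_def)
    qed
    have lim: "(\<lambda>n. G s (z (\<kappa> n) (s - d (\<kappa> n)))) \<longlonglongrightarrow> G s (x s)" for s
    proof -
      have "(\<lambda>n. z (\<kappa> n) (s - d (\<kappa> n)) - z (\<kappa> n) s) \<longlonglongrightarrow> 0"
      proof (rule Lim_null_comparison)
        show "\<forall>\<^sub>F n in sequentially. norm (z (\<kappa> n) (s - d (\<kappa> n)) - z (\<kappa> n) s) \<le> M * \<bar>d (\<kappa> n)\<bar>"
          using zl[of _ "s - d _" s] by (intro always_eventually allI) (metis abs_minus_cancel add_diff_cancel_left' diff_add_cancel minus_diff_eq)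
        show "(\<lambda>n. M * \<bar>d (\<kappa> n)\<bar>) \<longlonglongrightarrow> 0"
          using tendsto_mult[OF tendsto_const[of M] tendsto_rabs[OF d0]] by simp
      qed
      from tendsto_add[OF this xl[of s]] have "(\<lambda>n. z (\<kappa> n) (s - d (\<kappa> n))) \<longlonglongrightarrow> x s" by simp
      then show ?thesis using continuous_on_tendsto_compose[OF cont[of s], of "\<lambda>n. z (\<kappa> n) (s - d (\<kappa> n))" "x s" sequentially] by simp
    qed
    have "(\<lambda>n. integral {0..t} (\<lambda>s. G s (z (\<kappa> n) (s - d (\<kappa> n))))) \<longlonglongrightarrow> integral {0..t} (\<lambda>s. G s (x s))"
    proof (rule dominated_convergence(2))
      show "(\<lambda>s. G s (z (\<kappa> n) (s - d (\<kappa> n)))) integrable_on {0..t}" for n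
      proof -
        have "continuous_on UNIV (\<lambda>s. z (\<kappa> n) (s - d (\<kappa> n)))"
          by (rule continuous_on_compose2[OF z_cont]) (auto intro: continuous_intros)
        from meas[OF this] show ?thesis using absolutely_integrable_on_def by blast
      qed
      show "(\<lambda>s. M) integrable_on {0..t}" by (simp add: integrable_const_ivl)
    qed (use M lim in auto)
    then have "(\<lambda>n. x0 + integral {0..t} (\<lambda>s. G s (z (\<kappa> n) (s - d (\<kappa> n))))) \<longlonglongrightarrow> x0 + integral {0..t} (\<lambda>s. G s (x s))"
      by (intro tendsto_add tendsto_const)
    moreover have "\<forall>\<^sub>F n in sequentially. x0 + integral {0..t} (\<lambda>s. G s (z (\<kappa> n) (s - d (\<kappa> n)))) = z (\<kappa> n) t"
    proof -
      obtain K :: nat where "t \<le> real K" using real_arch_simple by blast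
      then have "t \<le> real (\<kappa> n)" if "n \<ge> K" for n
        using that strict_mono_imp_increasing[OF \<kappa>, of n] by linarith
      then show ?thesis unfolding eventually_sequentially using z_eq by (intro exI[of _ K]) auto
    qed
    ultimately have "(\<lambda>n. z (\<kappa> n) t) \<longlonglongrightarrow> x0 + integral {0..t} (\<lambda>s. G s (x s))"
      by (rule Lim_transform_eventually)
    then show "x t = x0 + integral {0..t} (\<lambda>s. G s (x s))" using xl[of t] LIMSEQ_unique by blast
  qed
  then show ?thesis using x_cont by blast
qed


section \<open>ISS Lyapunov functions imply ISS\<close>

text \<open>A finite subcover gives a radius \<epsilon> such that pairs closer than \<epsilon> share
  one local Lipschitz ball. Pairs farther apart are handled by boundedness: their images differ by
  at most B, which is at most B / \<epsilon> times their distance.\<close>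

lemma loc_lipschitz_on_compact:
  fixes f :: "'a::metric_space \<Rightarrow> 'b::metric_space"
  assumes f: "loc_lipschitz_on S f" and K: "compact K" "K \<subseteq> S"
  shows "\<exists>L. L-lipschitz_on K f"
proof (cases "K = {}")
  case True
  then show ?thesis by (intro exI[of _ 0]) (auto simp: lipschitz_on_def)
next
  case False
  have "\<exists>e L. e > 0 \<and> L-lipschitz_on (cball x e \<inter> S) f" if "x \<in> K" for x
    using f K that unfolding loc_lipschitz_on_def by blast
  then obtain e L where eL: "\<And>x. x \<in> K \<Longrightarrow> e x > 0" "\<And>x. x \<in> K \<Longrightarrow> (L x)-lipschitz_on (cball x (e x) \<inter> S) f"
    by metis
  have "K \<subseteq> (\<Union>x\<in>K. ball x (e x / 2))" using eL(1) by force
  then obtain F where F: "F \<subseteq> K" "finite F" "K \<subseteq> (\<Union>x\<in>F. ball x (e x / 2))"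
    using compactE_image[OF K(1), of K "\<lambda>x. ball x (e x / 2)"] by auto
  have Fne: "F \<noteq> {}" using F(3) False by auto
  define \<epsilon> where "\<epsilon> = Min ((\<lambda>x. e x / 2) ` F)"
  define L0 where "L0 = Max (L ` F)"
  have \<epsilon>: "\<epsilon> > 0" unfolding \<epsilon>_def using F Fne eL(1) by (subst Min_gr_iff) auto
  have \<epsilon>le: "\<epsilon> \<le> e x / 2" if "x \<in> F" for x unfolding \<epsilon>_def using F that by (intro Min_le) auto
  have L0: "L x \<le> L0" if "x \<in> F" for x unfolding L0_def using F that by (intro Max_ge) auto
  have near: "dist (f y) (f z) \<le> L0 * dist y z" if yz: "y \<in> K" "z \<in> K" "dist y z < \<epsilon>" for y z
  proof -
    obtain x where x: "x \<in> F" "dist x y < e x / 2" using F(3) yz(1) by (auto simp: subset_eq)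
    have "dist x z < e x" using dist_triangle[of x z y] x(2) that(3) \<epsilon>le[OF x(1)] by linarith
    then have "dist (f y) (f z) \<le> L x * dist y z"
      using x F(1) K(2) that eL(1)[of x] by (intro lipschitz_onD[OF eL(2)]) auto
    also have "\<dots> \<le> L0 * dist y z" using L0[OF x(1)] by (intro mult_right_mono) auto
    finally show ?thesis .
  qed
  have "bounded (f ` K)"
  proof (rule bounded_subset)
    show "bounded (\<Union>x\<in>F. cball (f x) (L x * e x))" using F(2) by (intro bounded_UN) auto
    show "f ` K \<subseteq> (\<Union>x\<in>F. cball (f x) (L x * e x))"
    proof
      fix w assume "w \<in> f ` K"
      then obtain y where y: "y \<in> K" "w = f y" by blast
      obtain x where x: "x \<in> F" "dist x y < e x / 2" using F(3) y(1) by (auto simp: subset_eq)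
      then have xK: "x \<in> K" using F(1) by blast
      have "dist (f x) (f y) \<le> L x * dist x y"
        using x xK K(2) y(1) eL(1)[OF xK] by (intro lipschitz_onD[OF eL(2)[OF xK]]) auto
      also have "\<dots> \<le> L x * e x"
        using x(2) eL(1)[OF xK] lipschitz_on_nonneg[OF eL(2)[OF xK]] by (intro mult_left_mono) auto
      finally show "w \<in> (\<Union>x\<in>F. cball (f x) (L x * e x))" using x(1) y(2) by auto
    qed
  qed
  then obtain B where B: "\<And>y z. y \<in> K \<Longrightarrow> z \<in> K \<Longrightarrow> dist (f y) (f z) \<le> B"
    unfolding bounded_two_points by blast
  define M where "M = max L0 (B / \<epsilon>)"
  obtain x0 where "x0 \<in> F" using Fne by blast
  then have "0 \<le> L0" using L0[of x0] lipschitz_on_nonneg[OF eL(2)[of x0]] F(1) by force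
  then have M0: "0 \<le> M" by (simp add: M_def)
  have "M-lipschitz_on K f"
  proof (rule lipschitz_onI[OF _ M0])
    fix y z assume yz: "y \<in> K" "z \<in> K"
    show "dist (f y) (f z) \<le> M * dist y z"
    proof (cases "dist y z < \<epsilon>")
      case True
      have "L0 * dist y z \<le> M * dist y z" unfolding M_def by (intro mult_right_mono) auto
      then show ?thesis using near[OF yz True] by linarith
    next
      case False
      have B0: "0 \<le> B" using B[OF yz] zero_le_dist order_trans by blast
      have "B = (B / \<epsilon>) * \<epsilon>" using \<epsilon> by simp
      also have "\<dots> \<le> (B / \<epsilon>) * dist y z" using False \<epsilon> B0 by (intro mult_left_mono) auto
      also have "\<dots> \<le> M * dist y z" unfolding M_def by (intro mult_right_mono) auto
      finally show ?thesis using B[OF yz] by linarith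
    qed
  qed
  then show ?thesis by blast
qed

text \<open>A solution of w' = - a w satisfies H(w t) = H(w 0) - t, so the exponential of H turns
  the flow into multiplication by exp(-t). The bound a r \<le> r makes H - ln nondecreasing;
  comparison with multiples of r then shows that the exponential of H tends to 0 at 0 and is
  unbounded.\<close>

lemma comparison_function:
  fixes a :: "real \<Rightarrow> real"
  assumes cont: "continuous_on {0..} a" and pos: "\<And>r. 0 < r \<Longrightarrow> 0 < a r" and le: "\<And>r. 0 \<le> r \<Longrightarrow> a r \<le> r"
  shows "\<exists>H. (\<forall>r>0. (H has_real_derivative 1 / a r) (at r)) \<and> class_K_inf (\<lambda>r. if r \<le> 0 then 0 else exp (H r))"
proof -
  have ic: "isCont a r" if "r > 0" for r
  proof -
    have "continuous_on {0<..} a" by (rule continuous_on_subset[OF cont]) auto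
    then show ?thesis using that by (simp add: continuous_on_eq_continuous_at)
  qed
  have "\<exists>H. \<forall>x::real. 0 < ereal x \<longrightarrow> ereal x < \<infinity> \<longrightarrow> (H has_vector_derivative 1 / a x) (at x)"
  proof (rule einterval_antiderivative)
    fix x :: real assume "0 < ereal x"
    then have "x > 0" by simp
    then show "isCont (\<lambda>x. 1 / a x) x" using ic pos[of x] by (intro continuous_intros) auto
  qed simp
  then obtain H where H: "\<And>r. r > 0 \<Longrightarrow> (H has_real_derivative 1 / a r) (at r)"
    by (auto simp: has_real_derivative_iff_has_vector_derivative)
  have Hless: "H r < H s" if "0 < r" "r < s" for r s
  proof (rule DERIV_pos_imp_increasing[OF that(2)])
    fix x assume "r \<le> x" "x \<le> s"
    then show "\<exists>y. (H has_real_derivative y) (at x) \<and> 0 < y"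
      using H[of x] pos[of x] that by (intro exI[of _ "1 / a x"]) auto
  qed
  have Hln: "H s - ln s \<ge> H r - ln r" if "0 < r" "r \<le> s" for r s
  proof (rule DERIV_nonneg_imp_nondecreasing[OF that(2)])
    fix x assume x: "r \<le> x" "x \<le> s"
    then have "x > 0" using that by simp
    then have "((\<lambda>x. H x - ln x) has_real_derivative 1 / a x - 1 / x) (at x)"
      using H[of x] by (auto intro!: derivative_eq_intros)
    moreover have "1 / x \<le> 1 / a x" using pos[of x] le[of x] \<open>x > 0\<close> by (intro divide_left_mono) auto
    ultimately show "\<exists>y. ((\<lambda>x. H x - ln x) has_real_derivative y) (at x) \<and> 0 \<le> y"
      by (intro exI[of _ "1 / a x - 1 / x"]) auto
  qed
  define \<Phi> where "\<Phi> r = (if r \<le> 0 then 0 else exp (H r))" for r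
  have lower: "exp (H 1) * r \<le> \<Phi> r" if "r \<ge> 1" for r
  proof -
    have "H 1 + ln r \<le> H r" using Hln[of 1 r] that by simp
    then have "exp (H 1 + ln r) \<le> exp (H r)" by simp
    then show ?thesis using that by (simp add: \<Phi>_def exp_add)
  qed
  have upper: "\<Phi> r \<le> exp (H 1) * r" if "0 \<le> r" "r \<le> 1" for r
  proof (cases "r = 0")
    case False
    then have r: "r > 0" using that by simp
    have "H r \<le> H 1 + ln r" using Hln[of r 1] that r by simp
    then have "exp (H r) \<le> exp (H 1 + ln r)" by simp
    then show ?thesis using r by (simp add: \<Phi>_def exp_add)
  qed (simp add: \<Phi>_def)
  have "class_K \<Phi>"
  proof (rule class_KI)
    show "\<Phi> r < \<Phi> s" if "0 \<le> r" "r < s" for r s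
      using Hless[of r s] that by (auto simp: \<Phi>_def)
    show "continuous_on {0..} \<Phi>"
      unfolding continuous_on_eq_continuous_within
    proof
      fix r :: real assume "r \<in> {0..}"
      then consider "r = 0" | "r > 0" by fastforce
      then show "continuous (at r within {0..}) \<Phi>"
      proof cases
        case 1
        have "((\<lambda>r. exp (H 1) * r) \<longlongrightarrow> exp (H 1) * 0) (at 0 within {0..})" by (intro tendsto_intros)
        then have l: "((\<lambda>r. exp (H 1) * r) \<longlongrightarrow> 0) (at 0 within {0..})" by simp
        have "(\<Phi> \<longlongrightarrow> 0) (at 0 within {0..})"
        proof (rule Lim_null_comparison[OF _ l])
          show "\<forall>\<^sub>F x in at 0 within {0..}. norm (\<Phi> x) \<le> exp (H 1) * x"
            unfolding eventually_at
          proof (intro exI[of _ 1] conjI ballI impI)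
            fix x :: real assume "x \<in> {0..}" "x \<noteq> 0 \<and> dist x 0 < 1"
            then have "0 < x" "x \<le> 1" by (auto simp: dist_real_def)
            then show "norm (\<Phi> x) \<le> exp (H 1) * x" using upper[of x] by (simp add: \<Phi>_def)
          qed simp
        qed
        then show ?thesis using 1 by (simp add: continuous_within \<Phi>_def)
      next
        case 2
        have "isCont (\<lambda>x. exp (H x)) r" using H[OF 2] DERIV_isCont by (intro continuous_intros) blast
        moreover have "\<forall>\<^sub>F x in nhds r. \<Phi> x = exp (H x)"
          using eventually_nhds_in_open[of "{0<..}" r] 2 by (auto simp: \<Phi>_def elim!: eventually_mono)
        ultimately have "isCont \<Phi> r" using isCont_cong[of \<Phi> "\<lambda>x. exp (H x)" r] by simp
        then show ?thesis using continuous_at_imp_continuous_at_within by blast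
      qed
    qed
  qed (simp add: \<Phi>_def)
  moreover have "\<exists>r\<ge>0. M \<le> \<Phi> r" for M
  proof -
    define r where "r = max 1 (M / exp (H 1))"
    have "M / exp (H 1) \<le> r" by (simp add: r_def)
    then have "M \<le> exp (H 1) * r" by (simp add: pos_divide_le_eq mult.commute)
    then show ?thesis using lower[of r] by (intro exI[of _ r]) (auto simp: r_def)
  qed
  ultimately have "class_K_inf \<Phi>" by (simp add: class_K_inf_iff)
  then show ?thesis using H unfolding \<Phi>_def by blast
qed

text \<open>The comparison flow with \<open>p\<close> and \<open>q\<close> on either side: the
  argument of \<open>p\<close> is the value w(t) with \<Phi>(w t) = exp(-t) \<Phi>(w 0) and w 0 = q
  s.\<close>

lemma class_KL_from_flow:
  assumes \<Phi>: "class_K_inf \<Phi>" and p: "class_K_inf p" and q: "class_K_inf q"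
  shows "class_KL (\<lambda>s t. p (inv_K \<Phi> (exp (- t) * \<Phi> (q s))))"
proof -
  let ?\<beta> = "\<lambda>s t. p (inv_K \<Phi> (exp (- t) * \<Phi> (q s)))"
  have iK: "class_K (inv_K \<Phi>)" using class_K_inf_inv_K[OF \<Phi>] class_K_infD by blast
  have K: "class_K \<Phi>" "class_K p" "class_K q" using assms class_K_infD by auto
  have "class_K (\<lambda>s. ?\<beta> s t)" for t
    using class_K_compose[OF K(2) class_K_compose[OF iK class_K_compose[OF class_K_infD[OF class_K_inf_scale[of "exp (- t)"]]
        class_K_compose[OF K(1,3)]]]] by simp
  moreover have "?\<beta> s t' < ?\<beta> s t" if "s > 0" "t' > t" for s t t'
  proof -
    have pos: "\<Phi> (q s) > 0" using K class_K_pos that by blast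
    show ?thesis
      using that pos by (intro class_K_less[OF K(2)] class_K_less[OF iK] class_K_nonneg[OF iK]) auto
  qed
  moreover have "((?\<beta> s) \<longlongrightarrow> 0) at_top" if "s > 0" for s
  proof -
    have pos: "\<Phi> (q s) > 0" using K class_K_pos that by blast
    have "((\<lambda>t::real. exp (- t)) \<longlongrightarrow> 0) at_top"
      using exp_at_bot filterlim_compose filterlim_uminus_at_bot_at_top by blast
    from tendsto_mult_left_zero[OF this, of "\<Phi> (q s)"]
    have e: "((\<lambda>t. exp (- t) * \<Phi> (q s)) \<longlongrightarrow> 0) at_top" .
    have c: "continuous_on {0..} (\<lambda>r. p (inv_K \<Phi> r))"
      using class_K_compose[OF K(2) iK] class_K_continuous_on[of "\<lambda>r. p (inv_K \<Phi> r)" "{0..}"] by simp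
    have "((\<lambda>t. p (inv_K \<Phi> (exp (- t) * \<Phi> (q s)))) \<longlongrightarrow> p (inv_K \<Phi> 0)) at_top"
      by (rule continuous_on_tendsto_compose[OF c e]) (use pos in \<open>auto intro: always_eventually\<close>)
    then show ?thesis by (simp add: class_K_0[OF iK] class_K_0[OF K(2)])
  qed
  ultimately show ?thesis unfolding class_KL_def by blast
qed

section \<open>Lyapunov functions along solutions\<close>

lemma solution_regularity:
  fixes f :: "'a::euclidean_space \<Rightarrow> 'b::euclidean_space \<Rightarrow> 'a"
  assumes sol: "is_solution (\<lambda>t z. f z (u t)) {0..<T} x0 x"
    and f: "continuous_on UNIV (\<lambda>(x, u). f x u)" and u: "Linf u" and b: "0 \<le> b" "b < T"
  shows "\<exists>K. K-lipschitz_on {0..b} x"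
    and "\<exists>N. negligible N \<and> (\<forall>t\<in>{0..<b} - N. ((\<lambda>h. (x (t + h) - x t) /\<^sub>R h) \<longlongrightarrow> f (x t) (u t)) (at_right 0))"
proof -
  define g where "g s = f (x s) (u s)" for s
  have int: "g integrable_on {0..t}" and eq: "x t = x0 + integral {0..t} g" if "t \<in> {0..b}" for t
  proof -
    have "t \<in> {0..<T}" using that b by auto
    then show "g integrable_on {0..t}" "x t = x0 + integral {0..t} g"
      using sol unfolding is_solution_def g_def using absolutely_integrable_on_def by blast+
  qed
  have intb: "g integrable_on {0..b}" using int[of b] b by simp
  have diff: "x t - x s = integral {s..t} g" if "0 \<le> s" "s \<le> t" "t \<le> b" for s t
  proof -
    have "integral {0..s} g + integral {s..t} g = integral {0..t} g"
      by (rule Henstock_Kurzweil_Integration.integral_combine[OF that(1,2) int]) (use that in auto)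
    then show ?thesis using eq[of s] eq[of t] that by (simp add: algebra_simps)
  qed
  have "continuous_on {0..b} (\<lambda>t. x0 + integral {0..t} g)"
    by (intro continuous_on_add continuous_on_const indefinite_integral_continuous_1 intb)
  then have xc: "continuous_on {0..b} x"
    using continuous_on_cong[of "{0..b}" "{0..b}" x "\<lambda>t. x0 + integral {0..t} g"] eq by auto
  then have "bounded (x ` {0..b})" by (intro compact_imp_bounded compact_continuous_image) auto
  then obtain X where X: "\<And>s. s \<in> {0..b} \<Longrightarrow> norm (x s) \<le> X" unfolding bounded_iff by blast
  \<comment> \<open>\<open>u\<close> is bounded outside a null set only, hence so is the integrand;
    this is enough for its integral to be Lipschitz.\<close>
  obtain Nu where Nu: "negligible Nu" "\<And>t. t \<ge> 0 \<Longrightarrow> t \<notin> Nu \<Longrightarrow> norm (u t) \<le> Linf_norm u"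
    using Linf_norm_AE(1)[OF u] by blast
  have "bounded ((\<lambda>(x, u). f x u) ` (cball 0 X \<times> cball 0 (Linf_norm u)))"
    by (intro compact_imp_bounded compact_continuous_image continuous_on_subset[OF f] compact_Times compact_cball) auto
  then obtain B0 where B0: "\<And>p. p \<in> cball 0 X \<times> cball 0 (Linf_norm u) \<Longrightarrow> norm ((\<lambda>(x, u). f x u) p) \<le> B0"
    unfolding bounded_iff by blast
  define B where "B = max B0 0"
  have gB: "norm (g s) \<le> B" if "s \<in> {0..b}" "s \<notin> Nu" for s
    using B0[of "(x s, u s)"] X[OF that(1)] Nu(2)[of s] that by (simp add: g_def B_def)
  have le: "norm (x t - x s) \<le> B * (t - s)" if "0 \<le> s" "s \<le> t" "t \<le> b" for s t
    unfolding diff[OF that]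
  proof (rule negligible_spike_bound[OF _ Nu(1)])
    show "g integrable_on {s..t}" by (rule integrable_on_subinterval[OF intb]) (use that in auto)
  qed (use gB that in \<open>auto simp: B_def\<close>)
  have "B-lipschitz_on {0..b} x"
  proof (rule lipschitz_onI)
    fix s t assume "s \<in> {0..b}" "t \<in> {0..b}"
    then show "dist (x s) (x t) \<le> B * dist s t"
      using le[of s t] le[of t s] by (cases "s \<le> t") (auto simp: dist_norm norm_minus_commute)
  qed (simp add: B_def)
  then show "\<exists>K. K-lipschitz_on {0..b} x" by blast
  \<comment> \<open>Extension by 0 makes the integrand integrable on every interval, as the
    differentiation lemma requires.\<close>
  define gg where "gg s = (if s \<in> {0..b} then g s else 0)" for s
  have ggU: "gg integrable_on UNIV" unfolding gg_def using integrable_restrict_UNIV[of "{0..b}" g] intb by simp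
  have "gg integrable_on {c..d}" for c d
    using integrable_on_subcbox[OF ggU, of c d] by simp
  from indefinite_integral_right_quotients_AE[OF this] obtain N where N: "negligible N"
    "\<forall>t. t \<notin> N \<longrightarrow> ((\<lambda>h. integral {t..t + h} gg /\<^sub>R h) \<longlongrightarrow> gg t) (at_right 0)"
    by (elim exE conjE)
  have "((\<lambda>h. (x (t + h) - x t) /\<^sub>R h) \<longlongrightarrow> f (x t) (u t)) (at_right 0)" if t: "t \<in> {0..<b} - N" for t
  proof (rule Lim_transform_eventually)
    show "((\<lambda>h. integral {t..t + h} gg /\<^sub>R h) \<longlongrightarrow> f (x t) (u t)) (at_right 0)"
      using N(2) t by (auto simp: gg_def g_def)
    show "\<forall>\<^sub>F h in at_right 0. integral {t..t + h} gg /\<^sub>R h = (x (t + h) - x t) /\<^sub>R h"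
      unfolding eventually_at_right_field
    proof (intro exI[of _ "b - t"] conjI allI impI)
      fix h assume h: "0 < h" "h < b - t"
      have "integral {t..t + h} gg = integral {t..t + h} g"
        by (rule integral_cong) (use h t in \<open>auto simp: gg_def\<close>)
      then show "integral {t..t + h} gg /\<^sub>R h = (x (t + h) - x t) /\<^sub>R h" using diff[of t "t + h"] h t by simp
    qed (use t in auto)
  qed
  then show "\<exists>N. negligible N \<and> (\<forall>t\<in>{0..<b} - N. ((\<lambda>h. (x (t + h) - x t) /\<^sub>R h) \<longlongrightarrow> f (x t) (u t)) (at_right 0))"
    using N(1) by blast
qed

text \<open>\<open>V\<close> need not be differentiable at x t, so the solution is compared with the
  straight line through x t in direction F (x t). The line obeys the local descent estimate, and the
  deviation from it is o(h), which changes \<open>V\<close> by at most L o(h).\<close>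

lemma lyapunov_right_descent:
  fixes V :: "'a::euclidean_space \<Rightarrow> real" and x :: "real \<Rightarrow> 'a"
  assumes Lip: "L-lipschitz_on (ball (x t) r) V" and r: "r > 0"
    and F: "isCont F (x t)" and a: "isCont a (x t)"
    and D: "\<And>y D. y \<in> ball (x t) r \<Longrightarrow> (V has_derivative D) (at y) \<Longrightarrow> D (F y) \<le> - a y"
    and x: "((\<lambda>h. (x (t + h) - x t) /\<^sub>R h) \<longlongrightarrow> F (x t)) (at_right 0)"
    and c: "- a (x t) < c"
  shows "\<forall>\<^sub>F h in at_right 0. V (x (t + h)) \<le> V (x t) + c * h"
proof -
  let ?y = "x t" and ?v = "F (x t)"
  have L0: "0 \<le> L" using Lip lipschitz_on_nonneg by blast
  \<comment> \<open>The midpoint of - a (x t) and c: half of the slack is spent on the straight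
    line, half on the deviation.\<close>
  define c' where "c' = (c - a ?y) / 2"
  have c': "- a ?y < c'" "c' < c" using c by (auto simp: c'_def)
  obtain \<delta> where \<delta>: "\<delta> > 0" "\<And>h. 0 < h \<Longrightarrow> h < \<delta> \<Longrightarrow> V (?y + h *\<^sub>R ?v) - V ?y \<le> c' * h"
  proof -
    have "\<exists>\<delta>>0. \<forall>h. 0 < h \<and> h < \<delta> \<longrightarrow> V (?y + h *\<^sub>R ?v) - V ?y \<le> c' * h"
      by (rule lipschitz_local_descent[where F = F and a = a, OF Lip r F a _ c'(1)]) (rule D)
    then show ?thesis using that by blast
  qed
  define \<epsilon> where "\<epsilon> = (c - c') / (L + 1)"
  have \<epsilon>: "\<epsilon> > 0" using c' L0 by (simp add: \<epsilon>_def)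
  have L\<epsilon>: "L * \<epsilon> \<le> c - c'"
  proof -
    have "L * \<epsilon> \<le> (L + 1) * \<epsilon>" using \<epsilon> by simp
    also have "\<dots> = c - c'" using L0 by (simp add: \<epsilon>_def)
    finally show ?thesis .
  qed
  have "\<forall>\<^sub>F h in at_right 0. dist ((x (t + h) - ?y) /\<^sub>R h) ?v < \<epsilon>" by (rule tendstoD[OF x \<epsilon>])
  moreover have "\<forall>\<^sub>F h in at_right 0. 0 < h \<and> h < \<delta>"
    unfolding eventually_at_right_field using \<delta>(1) by blast
  moreover have "\<forall>\<^sub>F h in at_right 0. h * (norm ?v + \<epsilon>) < r"
    unfolding eventually_at_right_field
  proof (intro exI[of _ "r / (norm ?v + \<epsilon>)"] conjI allI impI)
    have p: "norm ?v + \<epsilon> > 0" using \<epsilon> by (simp add: add_nonneg_pos)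
    then show "0 < r / (norm ?v + \<epsilon>)" using r by simp
    fix h assume "h < r / (norm ?v + \<epsilon>)"
    then show "h * (norm ?v + \<epsilon>) < r" using p by (simp add: pos_less_divide_eq)
  qed
  ultimately show ?thesis
  proof eventually_elim
    case (elim h)
    define e where "e = (x (t + h) - ?y) /\<^sub>R h - ?v"
    have e: "norm e < \<epsilon>" using elim(1) by (simp add: e_def dist_norm)
    have xe: "x (t + h) = ?y + h *\<^sub>R ?v + h *\<^sub>R e" using elim(2) by (simp add: e_def scaleR_diff_right)
    have "norm (h *\<^sub>R ?v) \<le> h * (norm ?v + \<epsilon>)" using elim(2) \<epsilon> by (simp add: mult_left_mono)
    then have b1: "?y + h *\<^sub>R ?v \<in> ball ?y r" using elim(3) by (simp add: dist_norm)
    have "norm (h *\<^sub>R ?v + h *\<^sub>R e) \<le> norm (h *\<^sub>R ?v) + norm (h *\<^sub>R e)" by (rule norm_triangle_ineq)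
    also have "\<dots> \<le> h * (norm ?v + \<epsilon>)" using elim(2) e by (simp add: distrib_left)
    finally have "norm (h *\<^sub>R ?v + h *\<^sub>R e) < r" using elim(3) by linarith
    moreover have "dist ?y (x (t + h)) = norm (h *\<^sub>R ?v + h *\<^sub>R e)"
      unfolding xe dist_norm by (metis add.assoc add_diff_cancel_left' norm_minus_commute)
    ultimately have b2: "x (t + h) \<in> ball ?y r" by simp
    have "\<bar>V (x (t + h)) - V (?y + h *\<^sub>R ?v)\<bar> \<le> L * norm (h *\<^sub>R e)"
      using lipschitz_abs_diff[OF Lip b2 b1] by (simp add: xe)
    also have "L * norm (h *\<^sub>R e) = h * (L * norm e)" using elim(2) by simp
    also have "\<dots> \<le> h * (c - c')"
    proof (rule mult_left_mono)
      have "L * norm e \<le> L * \<epsilon>" using e L0 by (intro mult_left_mono) auto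
      then show "L * norm e \<le> c - c'" using L\<epsilon> by linarith
    qed (use elim(2) in simp)
    finally have "V (x (t + h)) \<le> V (?y + h *\<^sub>R ?v) + h * (c - c')" by linarith
    with \<delta>(2)[of h] elim(2) show ?case by (simp add: algebra_simps)
  qed
qed

lemma loc_lipschitz_on_ballE:
  fixes V :: "'a::real_normed_vector \<Rightarrow> real"
  assumes "loc_lipschitz_on (UNIV - {0}) V" "y \<noteq> 0"
  obtains r L where "r > 0" "L-lipschitz_on (ball y r) V" "0 \<notin> ball y r"
proof -
  obtain e L where eL: "e > 0" "L-lipschitz_on (cball y e \<inter> (UNIV - {0})) V"
    using assms(1)[unfolded loc_lipschitz_on_def, rule_format, of y] assms(2) by blast
  define r where "r = min e (norm y)"
  have "r > 0" using eL(1) assms(2) by (simp add: r_def)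
  moreover have n0: "0 \<notin> ball y r" by (simp add: r_def)
  moreover have "L-lipschitz_on (ball y r) V"
    by (rule lipschitz_on_subset[OF eL(2)]) (use n0 in \<open>auto simp: r_def\<close>)
  ultimately show ?thesis using that by blast
qed

text \<open>\<open>H\<close> is the time the comparison system \<open>w' = - a w\<close> needs, so \<open>H (V (x t)) + t\<close> cannot increase.\<close>

lemma lyapunov_decrease:
  fixes f :: "'a::euclidean_space \<Rightarrow> 'b::euclidean_space \<Rightarrow> 'a"
  assumes sol: "is_solution (\<lambda>t z. f z (u t)) {0..<T} x0 x"
    and f: "continuous_on UNIV (\<lambda>(x, u). f x u)" and u: "Linf u"
    and Vc: "continuous_on UNIV V" and Vl: "loc_lipschitz_on (UNIV - {0}) V" and V0: "V 0 = 0"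
    and g: "class_K g" and al: "continuous_on {0..} al"
    and D: "\<And>y w D. (V has_derivative D) (at y) \<Longrightarrow> g (norm w) \<le> V y \<Longrightarrow> D (f y w) \<le> - al (norm y)"
    and a: "continuous_on {0..} a" "\<And>r. 0 < r \<Longrightarrow> 0 < a r" and aal: "\<And>y. y \<noteq> 0 \<Longrightarrow> a (V y) \<le> al (norm y)"
    and H: "\<And>r. 0 < r \<Longrightarrow> (H has_real_derivative 1 / a r) (at r)"
      "\<And>r s. 0 < r \<Longrightarrow> r \<le> s \<Longrightarrow> H r \<le> H s"
    and pq: "0 \<le> p" "p \<le> q" "q < T" and above: "\<And>s. s \<in> {p..q} \<Longrightarrow> g (Linf_norm u) < V (x s)"
  shows "H (V (x q)) + q \<le> H (V (x p)) + p"
proof -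
  let ?U = "Linf_norm u"
  have gU: "0 \<le> g ?U" by (rule class_K_nonneg[OF g Linf_norm_AE(2)[OF u]])
  have Vp: "0 < V (x s)" if "s \<in> {p..q}" for s using above[OF that] gU by linarith
  have xn0: "x s \<noteq> 0" if "s \<in> {p..q}" for s using Vp[OF that] V0 by auto
  have q0: "0 \<le> q" using pq by linarith
  obtain K where K0: "K-lipschitz_on {0..q} x" using solution_regularity(1)[OF sol f u q0 pq(3)] by blast
  have K: "K-lipschitz_on {p..q} x" by (rule lipschitz_on_subset[OF K0]) (use pq in auto)
  obtain N1 where N1: "negligible N1"
    "\<And>t. t \<in> {0..<q} - N1 \<Longrightarrow> ((\<lambda>h. (x (t + h) - x t) /\<^sub>R h) \<longlongrightarrow> f (x t) (u t)) (at_right 0)"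
    using solution_regularity(2)[OF sol f u q0 pq(3)] by blast
  obtain N2 where N2: "negligible N2" "\<And>t. t \<ge> 0 \<Longrightarrow> t \<notin> N2 \<Longrightarrow> norm (u t) \<le> ?U"
    using Linf_norm_AE(1)[OF u] by blast
  have cS: "compact (x ` {p..q})"
    by (intro compact_continuous_image lipschitz_on_continuous_on[OF K]) auto
  have "x ` {p..q} \<subseteq> UNIV - {0}" using xn0 by auto
  then obtain L where L: "L-lipschitz_on (x ` {p..q}) V"
    using loc_lipschitz_on_compact[OF Vl cS] by blast
  have W: "(L * K)-lipschitz_on {p..q} (V \<circ> x)" by (rule lipschitz_on_compose[OF K L])
  have cW: "compact ((V \<circ> x) ` {p..q})"
    by (intro compact_continuous_image lipschitz_on_continuous_on[OF W]) auto
  have neW: "(V \<circ> x) ` {p..q} \<noteq> {}" using pq by auto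
  \<comment> \<open>On the arc V stays in [w1, w2] with w1 > 0, where 1/a is bounded. So H is
    Lipschitz there, and so is the composition to which the one-dimensional descent lemma is
    applied.\<close>
  obtain w1 w2 where w1: "w1 \<in> (V \<circ> x) ` {p..q}" "\<forall>w\<in>(V \<circ> x) ` {p..q}. w1 \<le> w"
    and w2: "\<forall>w\<in>(V \<circ> x) ` {p..q}. w \<le> w2"
    using compact_attains_inf[OF cW neW] compact_attains_sup[OF cW neW] by blast
  have w1p: "w1 > 0" using w1(1) Vp by auto
  have w12: "w1 \<le> w2" using w1(1) w2 by blast
  have ca: "continuous_on {w1..w2} a" by (rule continuous_on_subset[OF a(1)]) (use w1p in auto)
  obtain w3 where w3: "w3 \<in> {w1..w2}" "\<forall>w\<in>{w1..w2}. a w3 \<le> a w"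
    using continuous_attains_inf[OF compact_Icc _ ca] w12 by fastforce
  have a3: "a w3 > 0" using a(2) w3(1) w1p by auto
  have Hl: "(1 / a w3)-lipschitz_on ((V \<circ> x) ` {p..q}) H"
  proof (rule lipschitz_on_subset)
    show "(1 / a w3)-lipschitz_on {w1..w2} H"
    proof (rule lipschitz_onI)
      fix r s assume rs: "r \<in> {w1..w2}" "s \<in> {w1..w2}"
      have "norm (H r - H s) \<le> 1 / a w3 * norm (r - s)"
      proof (rule field_differentiable_bound[of "{w1..w2}" H "\<lambda>r. 1 / a r"])
        fix z assume z: "z \<in> {w1..w2}"
        then have z0: "z > 0" using w1p by auto
        show "(H has_field_derivative 1 / a z) (at z within {w1..w2})"
          using H(1)[OF z0] has_field_derivative_at_within by blast
        show "norm (1 / a z) \<le> 1 / a w3" using a(2)[OF z0] a3 w3(2) z by (auto intro!: divide_left_mono)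
      qed (use rs in auto)
      then show "dist (H r) (H s) \<le> 1 / a w3 * dist r s" by (simp add: dist_norm)
    qed (use a3 in auto)
    show "(V \<circ> x) ` {p..q} \<subseteq> {w1..w2}" using w1(2) w2 by auto
  qed
  have lip: "(1 / a w3 * (L * K))-lipschitz_on {p..q} (H \<circ> (V \<circ> x))" by (rule lipschitz_on_compose[OF W Hl])
  have "(H \<circ> (V \<circ> x)) q - (H \<circ> (V \<circ> x)) p \<le> - 1 * (q - p)"
  proof (rule lipschitz_descent_real[OF pq(2) lip negligible_Un[OF N1(1) N2(1)]])
    fix t d assume t: "t \<in> {p<..<q} - (N1 \<union> N2)" and d: "(H \<circ> (V \<circ> x) has_real_derivative d) (at t)"
    have tpq: "t \<in> {p..q}" and t0: "t \<ge> 0" using t pq by auto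
    let ?y = "x t" and ?w = "V (x t)"
    have ut: "norm (u t) \<le> ?U" using N2(2)[OF t0] t by auto
    obtain r0 L0 where r0: "r0 > 0" "L0-lipschitz_on (ball ?y r0) V" "0 \<notin> ball ?y r0"
      using loc_lipschitz_on_ballE[OF Vl xn0[OF tpq]] by blast
    have "open {y. g ?U < V y}" by (intro open_Collect_less continuous_on_const Vc)
    then obtain r1 where r1: "r1 > 0" "ball ?y r1 \<subseteq> {y. g ?U < V y}"
      using above[OF tpq] open_contains_ball by (metis mem_Collect_eq)
    define r where "r = min r0 r1"
    have r: "r > 0" "L0-lipschitz_on (ball ?y r) V"
      using r0 r1 by (auto simp: r_def intro: lipschitz_on_subset[OF r0(2)])
    have F: "isCont (\<lambda>z. f z (u t)) ?y"
    proof -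
      have "continuous_on UNIV (\<lambda>z. (\<lambda>(x, u). f x u) (z, u t))"
        by (rule continuous_on_compose2[OF f]) (auto intro: continuous_intros)
      then show ?thesis by (simp add: continuous_on_eq_continuous_at)
    qed
    have A: "isCont (\<lambda>z. al (norm z)) ?y"
    proof -
      have "continuous_on UNIV (\<lambda>z::'a. al (norm z))"
        by (rule continuous_on_compose2[OF al]) (auto intro: continuous_intros)
      then show ?thesis by (simp add: continuous_on_eq_continuous_at)
    qed
    have DD: "D' (f y (u t)) \<le> - al (norm y)" if "y \<in> ball ?y r" "(V has_derivative D') (at y)" for y D'
    proof (rule D[OF that(2)])
      have "g (norm (u t)) \<le> g ?U" by (rule class_K_mono[OF g _ ut]) simp
      moreover have "g ?U < V y" using that(1) r1(2) by (auto simp: r_def)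
      ultimately show "g (norm (u t)) \<le> V y" by linarith
    qed
    have xt: "((\<lambda>h. (x (t + h) - x t) /\<^sub>R h) \<longlongrightarrow> f (x t) (u t)) (at_right 0)"
      by (rule N1(2)) (use t pq in auto)
    have w: "?w > 0" by (rule Vp[OF tpq])
    \<comment> \<open>Only an upper estimate of V to the right of t is at hand. So the right
      quotients of the composition are compared with those of h -> H(w + c h), whose slope at 0 is c
      / a w.\<close>
    have dle: "d * a ?w \<le> c" if c: "- al (norm ?y) < c" for c
    proof -
      have ev: "\<forall>\<^sub>F h in at_right 0. V (x (t + h)) \<le> ?w + c * h"
        by (rule lyapunov_right_descent[where x = x and t = t and F = "\<lambda>z. f z (u t)" and a = "\<lambda>z. al (norm z)", OF r(2,1) F A _ xt c]) (rule DD)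
      have l1: "((\<lambda>h. ((H \<circ> (V \<circ> x)) (t + h) - (H \<circ> (V \<circ> x)) t) / h) \<longlongrightarrow> d) (at_right 0)"
        using d unfolding DERIV_def by (rule filterlim_mono[OF _ order_refl]) (simp add: at_within_le_at)
      have Hc: "((\<lambda>h. H (?w + c * h)) has_real_derivative c * (1 / a ?w)) (at 0)"
      proof -
        have "(H has_real_derivative 1 / a ?w) (at (?w + c * 0))" using H(1)[OF w] by simp
        moreover have "((\<lambda>h. ?w + c * h) has_real_derivative c) (at 0)" by (auto intro!: derivative_eq_intros)
        ultimately show ?thesis using DERIV_chain2[of H "1 / a ?w" "\<lambda>h. ?w + c * h" 0 c] by (simp add: mult.commute)
      qed
      have "((\<lambda>h. (H (?w + c * (0 + h)) - H (?w + c * 0)) / h) \<longlongrightarrow> c * (1 / a ?w)) (at_right 0)"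
        using Hc unfolding DERIV_def by (rule filterlim_mono[OF _ order_refl]) (simp add: at_within_le_at)
      then have l2: "((\<lambda>h. (H (?w + c * h) - H ?w) / h) \<longlongrightarrow> c * (1 / a ?w)) (at_right 0)" by simp
      have pos: "\<forall>\<^sub>F h in at_right 0. 0 < h \<and> h < q - t"
        unfolding eventually_at_right_field using t by (intro exI[of _ "q - t"]) auto
      have "\<forall>\<^sub>F h in at_right 0. ((H \<circ> (V \<circ> x)) (t + h) - (H \<circ> (V \<circ> x)) t) / h \<le> (H (?w + c * h) - H ?w) / h"
        using ev pos
      proof eventually_elim
        case (elim h)
        have "t + h \<in> {p..q}" using elim(2) t by auto
        from Vp[OF this] have "H (V (x (t + h))) \<le> H (?w + c * h)" using H(2) elim(1) by blast
        then show ?case using elim(2) by (simp add: divide_right_mono)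
      qed
      from tendsto_le[OF _ l2 l1 this] have "d \<le> c * (1 / a ?w)" by simp
      then show ?thesis using a(2)[OF w] by (simp add: pos_le_divide_eq)
    qed
    have "d * a ?w \<le> - al (norm ?y)"
      by (rule dense_ge) (rule dle)
    also have "\<dots> \<le> - 1 * a ?w" using aal[OF xn0[OF tpq]] by simp
    finally show "d \<le> - 1" using a(2)[OF w] mult_right_le_imp_le by blast
  qed
  then show ?thesis by simp
qed

text \<open>The sublevel set of the threshold \<open>g (Linf_norm u)\<close> cannot be left. Hence a
  time with V above the threshold has had V above it since time 0, and the decrease of H(V) + t
  applies to all of [0, t].\<close>

lemma lyapunov_trajectory_bound:
  fixes f :: "'a::euclidean_space \<Rightarrow> 'b::euclidean_space \<Rightarrow> 'a"
  assumes sol: "is_solution (\<lambda>t z. f z (u t)) {0..<T} x0 x"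
    and f: "continuous_on UNIV (\<lambda>(x, u). f x u)" and u: "Linf u"
    and Vc: "continuous_on UNIV V" and Vl: "loc_lipschitz_on (UNIV - {0}) V" and V0: "V 0 = 0"
    and Vn: "\<And>z. 0 \<le> V z"
    and g: "class_K g" and al: "continuous_on {0..} al"
    and D: "\<And>y w D. (V has_derivative D) (at y) \<Longrightarrow> g (norm w) \<le> V y \<Longrightarrow> D (f y w) \<le> - al (norm y)"
    and a: "continuous_on {0..} a" "\<And>r. 0 < r \<Longrightarrow> 0 < a r" and aal: "\<And>y. y \<noteq> 0 \<Longrightarrow> a (V y) \<le> al (norm y)"
    and H: "\<And>r. 0 < r \<Longrightarrow> (H has_real_derivative 1 / a r) (at r)"
    and \<Phi>: "class_K_inf (\<lambda>r. if r \<le> 0 then 0 else exp (H r))" (is "class_K_inf ?\<Phi>")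
    and t: "0 \<le> t" "t < T"
  shows "V (x t) \<le> max (g (Linf_norm u)) (inv_K ?\<Phi> (exp (- t) * ?\<Phi> (V x0)))"
proof (cases "V (x t) \<le> g (Linf_norm u)")
  case False
  let ?U = "Linf_norm u"
  have gU: "0 \<le> g ?U" by (rule class_K_nonneg[OF g Linf_norm_AE(2)[OF u]])
  have K: "class_K ?\<Phi>" using \<Phi> class_K_infD by blast
  have Hm: "H r \<le> H s" if "0 < r" "r \<le> s" for r s
    using class_K_mono[OF K, of r s] that by simp
  have Hlt: "H r < H s \<Longrightarrow> r < s" if "0 < r" "0 < s" for r s
    using Hm[OF that(2), of r] by force
  have dec: "H (V (x t)) + t \<le> H (V (x p)) + p"
    if "0 \<le> p" "p \<le> t" "\<And>s. s \<in> {p..t} \<Longrightarrow> g ?U < V (x s)" for p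
    by (rule lyapunov_decrease[OF sol f u Vc Vl V0 g al _ a aal H Hm that(1,2) t(2) that(3)]) (rule D)
  obtain Kx where Kx: "Kx-lipschitz_on {0..t} x" using solution_regularity(1)[OF sol f u t] by blast
  have Wc: "continuous_on {0..t} (\<lambda>s. V (x s))"
    by (rule continuous_on_compose2[OF Vc lipschitz_on_continuous_on[OF Kx]]) auto
  have above: "g ?U < V (x s)" if "s \<in> {0..t}" for s
  proof (rule ccontr)
    assume "\<not> g ?U < V (x s)"
    \<comment> \<open>Let m be the last time in \<open>Q\<close>. Just after m, V is still smaller
      than V (x t) by continuity, yet from there on it is above the threshold and has to decrease up
      to t. \<open>p\<close> is such a time.\<close>
    define Q where "Q = {0..t} \<inter> (\<lambda>s. V (x s)) -` {..g ?U}"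
    have "closed Q" unfolding Q_def by (rule continuous_closed_preimage[OF Wc]) auto
    moreover have "bounded Q" by (rule bounded_subset[of "{0..t}"]) (auto simp: Q_def)
    ultimately have "compact Q" by (simp add: compact_eq_bounded_closed)
    moreover have "s \<in> Q" using \<open>\<not> g ?U < V (x s)\<close> that by (simp add: Q_def)
    ultimately obtain m where m: "m \<in> Q" "\<And>q. q \<in> Q \<Longrightarrow> q \<le> m"
      using compact_attains_sup[of Q] by blast
    have mt: "0 \<le> m" "m < t" "V (x m) \<le> g ?U" using m(1) False by (auto simp: Q_def less_le)
    have "V (x m) < V (x t)" using mt False by linarith
    moreover have "((\<lambda>s. V (x s)) \<longlongrightarrow> V (x m)) (at m within {0..t})"
      using Wc mt unfolding continuous_on_def by auto
    ultimately have "\<forall>\<^sub>F s in at m within {0..t}. V (x s) < V (x t)" by (intro order_tendstoD(2))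
    then obtain d where d: "d > 0" "\<And>s. s \<in> {0..t} \<Longrightarrow> s \<noteq> m \<Longrightarrow> dist s m < d \<Longrightarrow> V (x s) < V (x t)"
      unfolding eventually_at by blast
    define p where "p = min (m + d / 2) ((m + t) / 2)"
    have "p \<le> m + d / 2" "p \<le> (m + t) / 2" unfolding p_def by (rule min.cobounded1 min.cobounded2)+
    moreover have "m < p" using mt d(1) by (simp add: p_def)
    ultimately have p: "m < p" "p < t" "dist p m < d" using mt d(1) by (auto simp: dist_real_def)
    have up: "g ?U < V (x s)" if "s \<in> {p..t}" for s
      using m(2)[of s] that p mt by (force simp: Q_def)
    have "H (V (x t)) < H (V (x p))" using dec[of p] up p mt by fastforce
    moreover have "V (x p) > 0" "V (x t) > 0" using up[of p] up[of t] p gU by auto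
    ultimately have "V (x t) < V (x p)" using Hlt by blast
    then show False using d(2)[of p] p mt by auto
  qed
  have x00: "x 0 = x0" using sol t unfolding is_solution_def by force
  have pos: "0 < V x0" "0 < V (x t)" using above[of 0] above[of t] t gU x00 by auto
  have "H (V (x t)) \<le> H (V x0) + (- t)" using dec[of 0] above t x00 by simp
  then have "exp (H (V (x t))) \<le> exp (- t + H (V x0))" by simp
  then have "?\<Phi> (V (x t)) \<le> exp (- t) * ?\<Phi> (V x0)" unfolding exp_add using pos by simp
  moreover have "0 \<le> exp (- t) * ?\<Phi> (V x0)" by simp
  ultimately have "V (x t) \<le> inv_K ?\<Phi> (exp (- t) * ?\<Phi> (V x0))"
    using inv_K_ge_iff[OF \<Phi>, of "exp (- t) * ?\<Phi> (V x0)" "V (x t)"] pos by simp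
  then show ?thesis by simp
qed simp

text \<open>The bound is required of solutions on bounded intervals [0, T), because it is used
  before a solution of the original equation is known to be global.\<close>

lemma global_solution_if_bounded:
  fixes f :: "'a::euclidean_space \<Rightarrow> 'b::euclidean_space \<Rightarrow> 'a"
  assumes f: "continuous_on UNIV (\<lambda>(x, u). f x u)" and u: "Linf u"
    and bound: "\<And>T x t. is_solution (\<lambda>t z. f z (u t)) {0..<T} x0 x \<Longrightarrow> t \<in> {0..<T} \<Longrightarrow> norm (x t) \<le> R"
    and R: "norm x0 \<le> R"
  shows "\<exists>x. is_solution (\<lambda>t z. f z (u t)) {0..} x0 x"
proof -
  let ?U = "Linf_norm u"
  have U0: "0 \<le> ?U" by (rule Linf_norm_AE(2)[OF u])
  have R0: "0 \<le> R" using R norm_ge_zero order_trans by blast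
  obtain N where N: "negligible N" "\<And>t. t \<ge> 0 \<Longrightarrow> t \<notin> N \<Longrightarrow> norm (u t) \<le> ?U"
    using Linf_norm_AE(1)[OF u] by blast
  \<comment> \<open>\<open>P\<close> clamps the state to radius R + 1, one more than the a priori
    bound, so that a first time of reaching R + 1 contradicts that bound. \<open>Q\<close> clamps
    the input and changes it on a null set of times only.\<close>
  define P where "P = closest_point (cball (0::'a) (R + 1))"
  define Q where "Q = closest_point (cball (0::'b) ?U)"
  have Pc: "continuous_on S P" for S unfolding P_def by (rule continuous_on_closest_point) (use R0 in auto)
  have Qc: "continuous_on S Q" for S unfolding Q_def by (rule continuous_on_closest_point) (use U0 in auto)
  have Pin: "P z \<in> cball 0 (R + 1)" for z unfolding P_def by (rule closest_point_in_set) (use R0 in auto)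
  have Qin: "Q z \<in> cball 0 ?U" for z unfolding Q_def by (rule closest_point_in_set) (use U0 in auto)
  have Pid: "P z = z" if "norm z \<le> R + 1" for z unfolding P_def by (rule closest_point_self) (use that in auto)
  have Qid: "Q z = z" if "norm z \<le> ?U" for z unfolding Q_def by (rule closest_point_self) (use that in auto)
  define F where "F p = (\<lambda>(x, u). f x u) (P (fst p), Q (snd p))" for p
  have Fc: "continuous_on UNIV F" unfolding F_def
    by (intro continuous_on_compose2[OF f] continuous_on_Pair continuous_on_compose2[OF Pc] continuous_on_compose2[OF Qc]
        continuous_on_fst continuous_on_snd continuous_on_id) auto
  have "bounded ((\<lambda>(x, u). f x u) ` (cball 0 (R + 1) \<times> cball 0 ?U))"
    by (intro compact_imp_bounded compact_continuous_image continuous_on_subset[OF f] compact_Times compact_cball) auto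
  then obtain M where M: "\<And>p. p \<in> cball 0 (R + 1) \<times> cball 0 ?U \<Longrightarrow> norm ((\<lambda>(x, u). f x u) p) \<le> M"
    unfolding bounded_iff by blast
  have FM: "norm (F p) \<le> M" for p unfolding F_def using Pin Qin by (intro M) auto
  define G where "G t z = F (z, u t)" for t z
  have "\<exists>x. is_solution G {0..} x0 x \<and> continuous_on UNIV x"
  proof (rule Caratheodory_global)
    show "norm (G s z) \<le> M" for s z unfolding G_def by (rule FM)
    show "continuous_on UNIV (G s)" for s unfolding G_def
      by (intro continuous_on_compose2[OF Fc] continuous_on_Pair continuous_on_id continuous_on_const) auto
    fix y :: "real \<Rightarrow> 'a" and t :: real assume y: "continuous_on UNIV y"
    have um: "u \<in> borel_measurable (lebesgue_on {0..t})"
    proof (rule measurable_restrict_mono)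
      show "u \<in> borel_measurable (lebesgue_on {0..})" using u by (simp add: Linf_def)
    qed auto
    have ym: "y \<in> borel_measurable (lebesgue_on {0..t})"
      by (intro continuous_imp_measurable_on_sets_lebesgue continuous_on_subset[OF y]) auto
    have "(\<lambda>s. (y s, u s)) \<in> borel_measurable (lebesgue_on {0..t})"
      by (rule borel_measurable_Pair[OF ym um])
    from measurable_compose[OF this borel_measurable_continuous_onI[OF Fc]]
    have m: "(\<lambda>s. G s (y s)) \<in> borel_measurable (lebesgue_on {0..t})" by (simp add: G_def)
    show "(\<lambda>s. G s (y s)) absolutely_integrable_on {0..t}"
      by (rule measurable_bounded_by_integrable_imp_absolutely_integrable[OF m, of "\<lambda>_. M"])
        (use FM in \<open>auto simp: G_def integrable_const_ivl\<close>)
  qed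
  then obtain x where x: "is_solution G {0..} x0 x" and xc: "continuous_on UNIV x" by blast
  have x00: "x 0 = x0" using x unfolding is_solution_def by force
  have good: "f (x s) (u s) = G s (x s)" if "s \<ge> 0" "s \<notin> N" "norm (x s) \<le> R + 1" for s
    using that N(2)[of s] by (simp add: G_def F_def Pid Qid)
  have stay: "norm (x t) < R + 1" if "t \<ge> 0" for t
  proof (rule ccontr)
    assume far: "\<not> norm (x t) < R + 1"
    \<comment> \<open>Before the first time m in \<open>E\<close> the clamped and the original
      equation agree almost everywhere, so the a priori bound gives norm at most R on [0, m) and, by
      continuity, at m.\<close>
    define E where "E = {0..t} \<inter> (\<lambda>s. norm (x s)) -` {R + 1..}"
    have nc: "continuous_on {0..t} (\<lambda>s. norm (x s))"
      by (intro continuous_on_norm continuous_on_subset[OF xc]) auto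
    have "closed E" unfolding E_def by (rule continuous_closed_preimage[OF nc]) auto
    moreover have "bounded E" by (rule bounded_subset[of "{0..t}"]) (auto simp: E_def)
    ultimately have "compact E" by (simp add: compact_eq_bounded_closed)
    moreover have "t \<in> E" using far that by (simp add: E_def)
    ultimately obtain m where m: "m \<in> E" "\<And>q. q \<in> E \<Longrightarrow> m \<le> q"
      using compact_attains_inf[of E] by blast
    have mE: "0 \<le> m" "m \<le> t" "R + 1 \<le> norm (x m)" using m(1) by (auto simp: E_def)
    have m0: "0 < m" using mE x00 R by (cases "m = 0") auto
    have below: "norm (x s) \<le> R + 1" if "s \<in> {0..<m}" for s
      using m(2)[of s] that mE by (force simp: E_def)
    have "is_solution G {0..<m} x0 x" using x unfolding is_solution_def by auto
    then have "is_solution (\<lambda>t z. f z (u t)) {0..<m} x0 x"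
      by (rule is_solution_cong_AE[OF _ N(1)]) (use good below in auto)
    then have le: "norm (x s) \<le> R" if "s \<in> {0..<m}" for s using bound that by blast
    have "((\<lambda>s. norm (x s)) \<longlongrightarrow> norm (x m)) (at_left m)"
    proof -
      have "isCont x m" using xc by (simp add: continuous_on_eq_continuous_at)
      then have "((\<lambda>s. norm (x s)) \<longlongrightarrow> norm (x m)) (at m)" unfolding isCont_def by (rule tendsto_norm)
      then show ?thesis by (rule tendsto_within_subset) simp
    qed
    moreover have "\<forall>\<^sub>F s in at_left m. norm (x s) \<le> R"
      unfolding eventually_at_left_field using m0 le by (intro exI[of _ 0]) auto
    ultimately have "norm (x m) \<le> R" by (intro tendsto_upperbound) auto
    then show False using mE by simp
  qed
  have "is_solution (\<lambda>t z. f z (u t)) {0..} x0 x"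
    by (rule is_solution_cong_AE[OF x N(1)]) (use good stay in \<open>auto intro: less_imp_le\<close>)
  then show ?thesis by blast
qed

theorem ISS_lyapunov_imp_ISS:
  fixes f :: "'a::euclidean_space \<Rightarrow> 'b::euclidean_space \<Rightarrow> 'a"
  assumes f: "continuous_on UNIV (\<lambda>(x, u). f x u)" and V: "ISS_lyapunov f V"
  shows "ISS f"
proof -
  obtain p1 p2 where Vc: "continuous_on UNIV V" and p: "class_K_inf p1" "class_K_inf p2"
    and Vp: "\<And>x. p1 (norm x) \<le> V x" "\<And>x. V x \<le> p2 (norm x)" and Vl: "loc_lipschitz_on (UNIV - {0}) V"
    using V unfolding ISS_lyapunov_def lyapunov_candidate_def by auto
  obtain g al where g: "class_K g" and al: "pos_def_fun al"
    and D: "\<And>y w D. (V has_derivative D) (at y) \<Longrightarrow> g (norm w) \<le> V y \<Longrightarrow> D (f y w) \<le> - al (norm y)"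
    using V unfolding ISS_lyapunov_def by blast
  have K: "class_K p1" "class_K p2" using p class_K_infD by auto
  have alc: "continuous_on {0..} al" using al by (simp add: pos_def_fun_def)
  have alp: "0 < al r" if "r > 0" for r using al that unfolding pos_def_fun_def by (metis less_eq_real_def)
  have V0: "V 0 = 0" using Vp[of 0] class_K_0[OF K(1)] class_K_0[OF K(2)] by simp
  have Vpos: "0 < V y" if "y \<noteq> 0" for y using Vp(1)[of y] class_K_pos[OF K(1), of "norm y"] that by simp
  have Vn: "0 \<le> V y" for y using Vpos[of y] V0 by (cases "y = 0") auto
  \<comment> \<open>The decay rate is given in terms of \<open>norm y\<close>, while the comparison
    system needs a function of \<open>V y\<close>. On a layer b \<le> V y \<le> c the norm is
    confined to a compact interval away from 0.\<close>
  have "\<exists>a. pos_def_fun a \<and> (\<forall>y\<in>UNIV - {0}. a (V y) \<le> al (norm y)) \<and> (\<forall>r\<ge>0. a r \<le> r) \<and> (\<forall>r s. \<bar>a r - a s\<bar> \<le> \<bar>r - s\<bar>)"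
  proof (rule pos_def_lower_envelope)
    fix b c :: real assume bc: "0 < b" "b \<le> c"
    define r1 where "r1 = inv_K p2 b"
    define r2 where "r2 = inv_K p1 c"
    have i1: "class_K (inv_K p2)" using class_K_inf_inv_K[OF p(2)] class_K_infD by blast
    have r1: "r1 > 0" using class_K_pos[OF i1 bc(1)] by (simp add: r1_def)
    have norms: "norm y \<in> {r1..r2}" if "b \<le> V y" "V y \<le> c" for y
    proof -
      have "b \<le> p2 (norm y)" "p1 (norm y) \<le> c" using that Vp[of y] by linarith+
      then show ?thesis using inv_K_le_iff[OF p(2), of b "norm y"] inv_K_ge_iff[OF p(1), of c "norm y"] bc
        by (simp add: r1_def r2_def)
    qed
    show "\<exists>\<kappa>>0. \<forall>y\<in>UNIV - {0}. b \<le> V y \<and> V y \<le> c \<longrightarrow> \<kappa> \<le> al (norm y)"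
    proof (cases "r1 \<le> r2")
      case True
      have "continuous_on {r1..r2} al" by (rule continuous_on_subset[OF alc]) (use r1 in auto)
      then obtain m where m: "m \<in> {r1..r2}" "\<forall>r\<in>{r1..r2}. al m \<le> al r"
        using continuous_attains_inf[of "{r1..r2}" al] True by auto
      then show ?thesis using norms alp[of m] r1 by (intro exI[of _ "al m"]) auto
    next
      case False
      then show ?thesis using norms by (intro exI[of _ 1]) fastforce
    qed
  qed (use Vpos in auto)
  then obtain a where a: "pos_def_fun a" "\<And>y. y \<noteq> 0 \<Longrightarrow> a (V y) \<le> al (norm y)" "\<And>r. 0 \<le> r \<Longrightarrow> a r \<le> r"
    by auto
  have ac: "continuous_on {0..} a" using a(1) by (simp add: pos_def_fun_def)
  have ap: "0 < a r" if "0 < r" for r using a(1) that unfolding pos_def_fun_def by (metis less_eq_real_def)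
  obtain H where H: "\<And>r. r > 0 \<Longrightarrow> (H has_real_derivative 1 / a r) (at r)"
    and \<Phi>': "class_K_inf (\<lambda>r. if r \<le> 0 then 0 else exp (H r))"
    using comparison_function[OF ac ap a(3)] by blast
  define \<Phi> where "\<Phi> = (\<lambda>r. if r \<le> 0 then 0 else exp (H r))"
  have \<Phi>: "class_K_inf \<Phi>" unfolding \<Phi>_def by (rule \<Phi>')
  have K\<Phi>: "class_K \<Phi>" using \<Phi> class_K_infD by blast
  have i\<Phi>: "class_K (inv_K \<Phi>)" using class_K_inf_inv_K[OF \<Phi>] class_K_infD by blast
  have ip1: "class_K (inv_K p1)" using class_K_inf_inv_K[OF p(1)] class_K_infD by blast
  define \<beta> where "\<beta> s t = inv_K p1 (inv_K \<Phi> (exp (- t) * \<Phi> (p2 s)))" for s t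
  define \<gamma>' where "\<gamma>' r = inv_K p1 (g r)" for r
  have KL: "class_KL \<beta>" unfolding \<beta>_def by (rule class_KL_from_flow[OF \<Phi> class_K_inf_inv_K[OF p(1)] p(2)])
  have K\<gamma>: "class_K \<gamma>'" unfolding \<gamma>'_def by (rule class_K_compose[OF ip1 g])
  have est: "norm (x t) \<le> \<beta> (norm x0) t + \<gamma>' (Linf_norm u)"
    if sol: "is_solution (\<lambda>t z. f z (u t)) {0..<T} x0 x" and u: "Linf u" and t: "t \<in> {0..<T}" for T x u t x0
  proof -
    let ?U = "Linf_norm u"
    have gU: "0 \<le> g ?U" by (rule class_K_nonneg[OF g Linf_norm_AE(2)[OF u]])
    have "V (x t) \<le> max (g ?U) (inv_K \<Phi> (exp (- t) * \<Phi> (V x0)))"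
      unfolding \<Phi>_def
      by (rule lyapunov_trajectory_bound[OF sol f u Vc Vl V0 Vn g alc _ ac ap a(2) H \<Phi>']) (use D t in auto)
    also have "inv_K \<Phi> (exp (- t) * \<Phi> (V x0)) \<le> inv_K \<Phi> (exp (- t) * \<Phi> (p2 (norm x0)))"
      by (intro class_K_mono[OF i\<Phi>] mult_nonneg_nonneg mult_left_mono class_K_mono[OF K\<Phi>] class_K_nonneg[OF K\<Phi>] Vn Vp) auto
    finally have Vm: "V (x t) \<le> max (g ?U) (inv_K \<Phi> (exp (- t) * \<Phi> (p2 (norm x0))))" by linarith
    define b where "b = inv_K \<Phi> (exp (- t) * \<Phi> (p2 (norm x0)))"
    have b0: "0 \<le> b" unfolding b_def
      by (intro class_K_nonneg[OF i\<Phi>] mult_nonneg_nonneg class_K_nonneg[OF K\<Phi>] class_K_nonneg[OF K(2)]) auto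
    have "norm (x t) \<le> inv_K p1 (V (x t))" using inv_K_ge_iff[OF p(1) Vn[of "x t"], of "norm (x t)"] Vp(1) by simp
    also have "\<dots> \<le> inv_K p1 (max (g ?U) b)" using Vm by (intro class_K_mono[OF ip1] Vn) (simp add: b_def)
    also have "\<dots> \<le> inv_K p1 b + inv_K p1 (g ?U)"
      using class_K_nonneg[OF ip1 b0] class_K_nonneg[OF ip1 gU] by (auto simp: max_def)
    finally show ?thesis by (simp add: \<beta>_def b_def \<gamma>'_def)
  qed
  show ?thesis unfolding ISS_def
  proof (intro exI[of _ \<beta>] exI[of _ \<gamma>'] conjI KL K\<gamma> allI impI ballI est)
    fix x0 :: 'a and u :: "real \<Rightarrow> 'b" assume u: "Linf u"
    have K\<beta>: "class_K (\<lambda>s. \<beta> s t)" if "t \<ge> 0" for t using KL that unfolding class_KL_def by blast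
    \<comment> \<open>Since \<beta> is largest at t = 0, this bounds the solution at all times.
      \<open>norm x0\<close> is included because the clamping radius has to cover the initial
      value.\<close>
    define R where "R = max (norm x0) (\<beta> (norm x0) 0 + \<gamma>' (Linf_norm u))"
    have mono: "\<beta> (norm x0) t \<le> \<beta> (norm x0) 0" if "t \<ge> 0" for t
    proof (cases "norm x0 > 0 \<and> t > 0")
      case True
      then show ?thesis using KL unfolding class_KL_def by (meson less_imp_le order_refl)
    next
      case False
      then have "x0 = 0 \<or> t = 0" using that by auto
      then show ?thesis using class_K_0[OF K\<beta>[of t]] class_K_0[OF K\<beta>[of 0]] that by auto
    qed
    show "\<exists>x. is_solution (\<lambda>t z. f z (u t)) {0..} x0 x"
    proof (rule global_solution_if_bounded[OF f u, of x0 R])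
      fix T x t assume "is_solution (\<lambda>t z. f z (u t)) {0..<T} x0 x" "t \<in> {0..<T}"
      from est[OF this(1) u this(2)] mono[of t] this(2) show "norm (x t) \<le> R" by (auto simp: R_def)
    qed (simp add: R_def)
  qed
qed


section \<open>The Lyapunov function of the interconnection\<close>

lemma MAF_pos: "MAF m \<Longrightarrow> 0 \<le> s \<Longrightarrow> s \<noteq> 0 \<Longrightarrow> 0 < m s"
  unfolding MAF_def by blast

lemma MAF_nonneg: "MAF m \<Longrightarrow> 0 \<le> s \<Longrightarrow> 0 \<le> m s"
  unfolding MAF_def by blast

lemma vec_nonneg_iff: "(0 :: real ^ 'n) \<le> s \<longleftrightarrow> (\<forall>i. 0 \<le> s $ i)"
  by (simp add: less_eq_vec_def)

text \<open>\<open>MAF\<close> compares only points that differ in every component. Raising all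
  components of y by 1/(n+1) makes the comparison strict, and continuity removes the
  perturbation.\<close>

lemma MAF_mono:
  fixes m :: "real ^ 'k \<Rightarrow> real"
  assumes m: "MAF m" and x: "0 \<le> x" and xy: "x \<le> y"
  shows "m x \<le> m y"
proof -
  have y: "0 \<le> y" using x xy by order
  let ?y = "\<lambda>n. y + (\<chi> i. inverse (real (Suc n)))"
  have yn: "0 \<le> ?y n" for n using y by (simp add: vec_nonneg_iff add_nonneg_pos less_imp_le)
  have lt: "m x < m (?y n)" for n
  proof -
    have "x $ i < ?y n $ i" for i
    proof -
      have "x $ i \<le> y $ i" using xy by (simp add: less_eq_vec_def)
      moreover have "0 < inverse (real (Suc n))" by simp
      ultimately show ?thesis by (simp del: inverse_positive_iff_positive)
    qed
    then have "vless x (?y n)" by (simp add: vless_def)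
    then show ?thesis using m x yn unfolding MAF_def by blast
  qed
  have "?y \<longlonglongrightarrow> y"
  proof (rule vec_tendstoI)
    fix i
    have "(\<lambda>n. y $ i + inverse (real (Suc n))) \<longlonglongrightarrow> y $ i + 0"
      by (rule tendsto_add[OF tendsto_const LIMSEQ_inverse_real_of_nat])
    then show "(\<lambda>n. ?y n $ i) \<longlonglongrightarrow> y $ i" by simp
  qed
  have mc: "continuous_on {s. 0 \<le> s} m" using m by (simp add: MAF_def)
  have "(\<lambda>n. m (?y n)) \<longlonglongrightarrow> m y"
    by (rule continuous_on_tendsto_compose[OF mc \<open>?y \<longlonglongrightarrow> y\<close>]) (use y yn in auto)
  then show ?thesis by (rule LIMSEQ_le_const) (use lt less_imp_le in blast)
qed

lemma extend_nth [simp]: "extend s r $ None = r" "extend s r $ Some j = s $ j"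
  by (simp_all add: extend_def)

lemma extend_le_iff: "extend s r \<le> extend s' r' \<longleftrightarrow> s \<le> s' \<and> r \<le> r'"
  by (auto simp: less_eq_vec_def split_option_all)

lemma extend_nonneg_iff: "0 \<le> extend s r \<longleftrightarrow> 0 \<le> s \<and> 0 \<le> r"
  by (auto simp: vec_nonneg_iff split_option_all)

lemma continuous_on_extend:
  assumes "continuous_on S g" "continuous_on S h"
  shows "continuous_on S (\<lambda>x. extend (g x) (h x))"
  unfolding extend_def
proof (rule continuous_on_vec_lambda)
  fix k :: "'b option"
  show "continuous_on S (\<lambda>x. case k of None \<Rightarrow> h x | Some j \<Rightarrow> g x $ j)"
    using assms by (cases k) (auto intro!: continuous_intros)
qed

locale gain_network =
  fixes \<mu> :: "'n::finite \<Rightarrow> real ^ ('n option) \<Rightarrow> real"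
    and \<gamma> :: "'n \<Rightarrow> 'n \<Rightarrow> real \<Rightarrow> real"
    and \<gamma>u :: "'n \<Rightarrow> real \<Rightarrow> real"
  assumes \<mu>_MAF: "\<And>i. MAF (\<mu> i)"
    and gains: "\<And>i j. class_K_inf (\<gamma> i j) \<or> zero_fun (\<gamma> i j)"
    and gains_input: "\<And>i. class_K (\<gamma>u i) \<or> zero_fun (\<gamma>u i)"
begin

lemma gain_mono: "0 \<le> r \<Longrightarrow> r \<le> s \<Longrightarrow> \<gamma> i j r \<le> \<gamma> i j s"
  using gains[of i j] class_K_mono[of "\<gamma> i j" r s] class_K_infD[of "\<gamma> i j"] by (auto simp: zero_fun_def)

lemma gain_0: "\<gamma> i j 0 = 0"
  using gains[of i j] class_K_0 class_K_infD by (auto simp: zero_fun_def)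

lemma gain_nonneg: "0 \<le> r \<Longrightarrow> 0 \<le> \<gamma> i j r"
  using gain_mono[of 0 r i j] gain_0 by simp

lemma gain_continuous: "continuous_on {0..} (\<gamma> i j)"
proof (cases "zero_fun (\<gamma> i j)")
  case True
  then have "continuous_on {0..} (\<gamma> i j) \<longleftrightarrow> continuous_on {0..} (\<lambda>_. 0::real)"
    using continuous_on_cong[of "{0..}" "{0..}" "\<gamma> i j" "\<lambda>_. 0"] by (auto simp: zero_fun_def)
  then show ?thesis by simp
next
  case False
  then show ?thesis using gains class_K_infD class_K_continuous_on by blast
qed

lemma gain_input_nonneg: "0 \<le> r \<Longrightarrow> 0 \<le> \<gamma>u i r"
  using gains_input[of i] class_K_nonneg by (auto simp: zero_fun_def)

lemma gain_input_0: "\<gamma>u i 0 = 0"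
  using gains_input[of i] class_K_0 by (auto simp: zero_fun_def)

lemma gain_op_nth: "gain_op \<mu> \<gamma> \<gamma>u s $ i = \<mu> i (extend (\<chi> j. \<gamma> i j (s $ j)) 0)"
  by (simp add: gain_op_def gain_op_ext_def gain_input_0)

lemma gain_arg_nonneg: "0 \<le> s \<Longrightarrow> 0 \<le> r \<Longrightarrow> 0 \<le> extend (\<chi> j. \<gamma> i j (s $ j)) r"
  unfolding extend_nonneg_iff by (simp add: vec_nonneg_iff gain_nonneg)

lemma gain_op_nonneg: "0 \<le> s \<Longrightarrow> 0 \<le> gain_op \<mu> \<gamma> \<gamma>u s"
  using gain_arg_nonneg[of s 0] MAF_nonneg[OF \<mu>_MAF]
  unfolding vec_nonneg_iff[of "gain_op \<mu> \<gamma> \<gamma>u s"] gain_op_nth by blast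

lemma gain_op_mono:
  assumes "0 \<le> s" "s \<le> t" shows "gain_op \<mu> \<gamma> \<gamma>u s \<le> gain_op \<mu> \<gamma> \<gamma>u t"
proof -
  have "\<gamma> i j (s $ j) \<le> \<gamma> i j (t $ j)" for i j
    using assms by (intro gain_mono) (auto simp: less_eq_vec_def)
  then have "extend (\<chi> j. \<gamma> i j (s $ j)) 0 \<le> extend (\<chi> j. \<gamma> i j (t $ j)) 0" for i
    unfolding extend_le_iff by (simp add: less_eq_vec_def)
  then have "gain_op \<mu> \<gamma> \<gamma>u s $ i \<le> gain_op \<mu> \<gamma> \<gamma>u t $ i" for i
    unfolding gain_op_nth by (intro MAF_mono[OF \<mu>_MAF] gain_arg_nonneg assms) auto
  then show ?thesis by (simp add: less_eq_vec_def)
qed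

lemma continuous_on_gain_arg:
  assumes v: "\<And>j. continuous_on S (\<lambda>x. v x j)" "\<And>j x. x \<in> S \<Longrightarrow> 0 \<le> v x j" and r: "0 \<le> r"
  shows "continuous_on S (\<lambda>x. \<mu> i (extend (\<chi> j. \<gamma> i j (v x j)) r))"
proof (rule continuous_on_compose2[of "{s. 0 \<le> s}" "\<mu> i"])
  show "continuous_on {s. 0 \<le> s} (\<mu> i)" using \<mu>_MAF by (simp add: MAF_def)
  show "continuous_on S (\<lambda>x. extend (\<chi> j. \<gamma> i j (v x j)) r)"
    by (intro continuous_on_extend continuous_on_vec_lambda continuous_on_const
        continuous_on_compose2[OF gain_continuous] v) (use v(2) in auto)
  show "(\<lambda>x. extend (\<chi> j. \<gamma> i j (v x j)) r) ` S \<subseteq> {s. 0 \<le> s}"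
  proof clarify
    fix x assume "x \<in> S"
    then show "0 \<le> extend (\<chi> j. \<gamma> i j (v x j)) r"
      unfolding extend_nonneg_iff using v(2) r by (simp add: vec_nonneg_iff gain_nonneg)
  qed
qed

lemma Omega_path_input_margin:
  assumes \<alpha>: "class_K_inf \<alpha>" and \<sigma>: "Omega_path (diag_op \<alpha> \<circ> gain_op \<mu> \<gamma> \<gamma>u) \<sigma>"
  shows "\<exists>\<eta>. class_K_inf \<eta> \<and> (\<forall>r>0. \<forall>s\<ge>0. \<forall>i w. (\<forall>j. s $ j \<le> \<sigma> j r) \<longrightarrow> w \<le> \<eta> r \<longrightarrow>
    gain_op \<mu> \<gamma> \<gamma>u s $ i + w < \<sigma> i r)"
proof -
  have K: "class_K_inf (\<sigma> i)" for i using \<sigma> by (simp add: Omega_path_def)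
  have half: "class_K_inf (\<lambda>r. \<sigma> i r / 2)" for i
    using class_K_inf_compose[OF class_K_inf_scale[of "1 / 2"] K[of i]] by simp
  obtain \<eta> where \<eta>: "class_K_inf \<eta>" "\<And>i r. r \<ge> 0 \<Longrightarrow> \<eta> r \<le> min (\<alpha> (\<sigma> i r / 2)) (\<sigma> i r / 2)"
    using class_K_inf_lower_bound[of UNIV "\<lambda>i r. min (\<alpha> (\<sigma> i r / 2)) (\<sigma> i r / 2)"]
      class_K_inf_min[OF class_K_inf_compose[OF \<alpha> half] half] by auto
  have "gain_op \<mu> \<gamma> \<gamma>u s $ i + w < \<sigma> i r"
    if r: "r > 0" and s: "0 \<le> s" "\<And>j. s $ j \<le> \<sigma> j r" and w: "w \<le> \<eta> r" for r s i w
  proof -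
    let ?S = "\<chi> j. \<sigma> j r"
    define G where "G = gain_op \<mu> \<gamma> \<gamma>u ?S $ i"
    have S0: "0 \<le> ?S" using class_K_nonneg[OF class_K_infD[OF K]] r by (simp add: vec_nonneg_iff)
    have le: "gain_op \<mu> \<gamma> \<gamma>u s $ i \<le> G"
      using gain_op_mono[OF s(1), of ?S] s(2) by (simp add: G_def less_eq_vec_def)
    have G0: "0 \<le> G" using gain_op_nonneg[OF S0] by (simp add: G_def vec_nonneg_iff)
    have "vless ((diag_op \<alpha> \<circ> gain_op \<mu> \<gamma> \<gamma>u) ?S) ?S"
      using \<sigma> r by (simp add: Omega_path_def)
    then have lt: "G + \<alpha> G < \<sigma> i r" by (simp add: vless_def diag_op_def G_def)
    have a0: "0 \<le> \<alpha> G" by (rule class_K_nonneg[OF class_K_infD[OF \<alpha>] G0])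
    have e: "\<eta> r \<le> \<alpha> (\<sigma> i r / 2)" "\<eta> r \<le> \<sigma> i r / 2" using \<eta>(2)[of r i] r by auto
    \<comment> \<open>If G is at least half of \<open>\<sigma> i r\<close>, the term
      \<open>\<alpha> G\<close> contributed by D leaves room
      \<open>\<alpha> (\<sigma> i r / 2)\<close>; otherwise G itself stays
      \<open>\<sigma> i r / 2\<close> below.\<close>
    show ?thesis
    proof (cases "\<sigma> i r / 2 \<le> G")
      case True
      have "0 \<le> \<sigma> i r / 2" using class_K_nonneg[OF class_K_infD[OF half[of i]]] r by simp
      from class_K_mono[OF class_K_infD[OF \<alpha>] this True] show ?thesis using lt le e w by linarith
    qed (use e le w in linarith)
  qed
  then show ?thesis using \<eta>(1) by blast
qed

end

section \<open>Blocks of the state vector\<close>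

lemma block_nth: "block blk i x $ k = (if blk k = i then x $ k else 0)"
  by (simp add: block_def)

lemma block_in [simp]: "block blk i x \<in> block_space blk i"
  by (simp add: block_space_def block_nth)

lemma block_add: "block blk i (x + y) = block blk i x + block blk i y"
  by (simp add: vec_eq_iff block_nth)

lemma block_diff: "block blk i (x - y) = block blk i x - block blk i y"
  by (simp add: vec_eq_iff block_nth)

lemma block_scaleR: "block blk i (c *\<^sub>R x) = c *\<^sub>R block blk i x"
  by (simp add: vec_eq_iff block_nth)

lemma block_id: "x \<in> block_space blk i \<Longrightarrow> block blk i x = x"
  by (auto simp: vec_eq_iff block_nth block_space_def)

lemma linear_block: "linear (block blk i)"
  by (rule linearI) (simp_all add: block_add block_scaleR)

lemma norm_block_le: "norm (block blk i x) \<le> norm x"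
  by (intro norm_le_componentwise_cart) (simp add: block_nth)

lemma continuous_on_block: "continuous_on S (block blk i)"
  by (intro linear_continuous_on linear_conv_bounded_linear[THEN iffD1] linear_block)

lemma block_sum:
  fixes blk :: "'m::finite \<Rightarrow> 'n::finite"
  shows "(\<Sum>i\<in>UNIV. block blk i x) = x"
  by (simp add: vec_eq_iff block_nth)

lemma zero_block_space [simp]: "0 \<in> block_space blk i"
  by (simp add: block_space_def)

lemma lyapunov_candidate_onto:
  fixes V :: "real ^ 'm::finite \<Rightarrow> real" and blk :: "'m \<Rightarrow> 'n"
  assumes V: "lyapunov_candidate (block_space blk i) V" and k: "blk k = i" and y: "0 \<le> y"
  shows "\<exists>t. V (t *\<^sub>R axis k 1) = y"
proof -
  obtain p1 p2 where Vc: "continuous_on (block_space blk i) V" and p: "class_K_inf p1" "class_K_inf p2"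
    and Vp: "\<And>x. x \<in> block_space blk i \<Longrightarrow> p1 (norm x) \<le> V x \<and> V x \<le> p2 (norm x)"
    using V unfolding lyapunov_candidate_def by blast
  have ax: "t *\<^sub>R axis k 1 \<in> block_space blk i" for t using k by (auto simp: block_space_def axis_def)
  obtain r where r: "r \<ge> 0" "y \<le> p1 r" using p(1) class_K_inf_iff by blast
  have "continuous_on {0..r} (\<lambda>t. V (t *\<^sub>R axis k 1))"
    by (rule continuous_on_compose2[OF Vc]) (use ax in \<open>auto intro!: continuous_intros\<close>)
  moreover have "V (0 *\<^sub>R axis k 1) \<le> y"
    using Vp[of 0] y class_K_0[OF class_K_infD[OF p(2)]] by simp
  moreover have "y \<le> V (r *\<^sub>R axis k 1)" using Vp[OF ax[of r]] r by simp
  ultimately show ?thesis using IVT'[of "\<lambda>t. V (t *\<^sub>R axis k 1)" 0 y r] r(1) by blast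
qed

text \<open>The additivity hypothesis speaks about the values of the V_i only. That these fill the
  whole orthant turns it into an identity for all s \<ge> 0. Surjectivity of \<open>blk\<close>
  provides, in each block, one coordinate along which V_i takes every nonnegative value.\<close>

lemma lyapunov_values_onto:
  fixes V :: "'n::finite \<Rightarrow> real ^ 'm::finite \<Rightarrow> real" and blk :: "'m \<Rightarrow> 'n"
  assumes V: "\<And>i. lyapunov_candidate (block_space blk i) (V i)" and blk: "surj blk" and s: "0 \<le> s"
  shows "\<exists>x. \<forall>i. V i (block blk i x) = s $ i"
proof -
  obtain rep where rep: "\<And>i. blk (rep i) = i" using blk by (metis surjD)
  have "\<exists>t. V i (t *\<^sub>R axis (rep i) 1) = s $ i" for i
    using lyapunov_candidate_onto[OF V[of i] rep[of i], of "s $ i"] s by (simp add: vec_nonneg_iff)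
  then obtain t where t: "\<And>i. V i (t i *\<^sub>R axis (rep i) 1) = s $ i" by metis
  define x where "x = (\<chi> k. if k = rep (blk k) then t (blk k) else 0)"
  have "block blk i x = t i *\<^sub>R axis (rep i) 1" for i
    by (auto simp: vec_eq_iff block_nth x_def axis_def rep)
  then show ?thesis using t by metis
qed

lemma continuous_on_Max:
  fixes W :: "'i \<Rightarrow> 'a::topological_space \<Rightarrow> real"
  assumes "finite I" "I \<noteq> {}" "\<And>i. i \<in> I \<Longrightarrow> continuous_on S (W i)"
  shows "continuous_on S (\<lambda>x. Max ((\<lambda>i. W i x) ` I))"
  using assms
proof (induction I rule: finite_ne_induct)
  case (insert i I)
  then have "continuous_on S (\<lambda>x. max (W i x) (Max ((\<lambda>i. W i x) ` I)))"
    by (intro continuous_on_max) auto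
  then show ?case using insert.hyps by simp
qed simp

text \<open>The bound is given at points of differentiability only. Applied to the negative of the
  inverse, the one-dimensional descent lemma turns it into a bound on increments.\<close>

lemma inv_K_growth:
  assumes \<sigma>: "class_K_inf \<sigma>" and loc: "loc_lipschitz_on {0<..} (inv_K \<sigma>)"
    and d: "\<And>r d. r \<in> {l..h} \<Longrightarrow> (inv_K \<sigma> has_real_derivative d) (at r) \<Longrightarrow> c \<le> d"
    and AB: "0 < l" "l \<le> A" "A \<le> B" "B \<le> h"
  shows "c * (B - A) \<le> inv_K \<sigma> B - inv_K \<sigma> A"
proof -
  have "{A..B} \<subseteq> {0<..}" using AB by auto
  then obtain L where L: "L-lipschitz_on {A..B} (inv_K \<sigma>)"
    using loc_lipschitz_on_compact[OF loc compact_Icc] by blast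
  have L': "L-lipschitz_on {A..B} (\<lambda>r. - inv_K \<sigma> r)"
    using L by (simp add: lipschitz_on_def dist_real_def abs_minus_commute)
  have "(- inv_K \<sigma> B) - (- inv_K \<sigma> A) \<le> (- c) * (B - A)"
  proof (rule lipschitz_descent_real[OF AB(3) L' negligible_empty])
    fix t e assume t: "t \<in> {A<..<B} - {}" "((\<lambda>r. - inv_K \<sigma> r) has_real_derivative e) (at t)"
    have "(inv_K \<sigma> has_real_derivative - e) (at t)" using DERIV_minus[OF t(2)] by simp
    then show "e \<le> - c" using d[of t "- e"] t(1) AB by auto
  qed
  then show ?thesis by simp
qed

section \<open>Subsystem Lyapunov functions on the full state space\<close>

locale iss_network = gain_network \<mu> \<gamma> \<gamma>u
  for \<mu> :: "'n::finite \<Rightarrow> real ^ ('n option) \<Rightarrow> real"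
    and \<gamma> :: "'n \<Rightarrow> 'n \<Rightarrow> real \<Rightarrow> real"
    and \<gamma>u :: "'n \<Rightarrow> real \<Rightarrow> real" +
  fixes blk :: "'m::finite \<Rightarrow> 'n"
    and f :: "real ^ 'm \<Rightarrow> real ^ 'p::finite \<Rightarrow> real ^ 'm"
    and V :: "'n \<Rightarrow> real ^ 'm \<Rightarrow> real"
  assumes blocks_nonempty: "surj blk"
    and f_continuous: "continuous_on UNIV (\<lambda>(x, u). f x u)"
    and candidates: "\<And>i. lyapunov_candidate (block_space blk i) (V i)"
    and lyapunov: "\<And>i. subsystem_ISS_lyapunov blk f V \<mu> \<gamma> \<gamma>u i"
    and additive: "\<And>(x :: real ^ 'm) (u :: real ^ 'p).
      gain_op_ext \<mu> \<gamma> \<gamma>u (\<chi> i. V i (block blk i x)) (norm u) =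
      gain_op \<mu> \<gamma> \<gamma>u (\<chi> i. V i (block blk i x)) + (\<chi> i. \<gamma>u i (norm u))"
begin

abbreviation U :: "'n \<Rightarrow> real ^ 'm \<Rightarrow> real" where
  "U i x \<equiv> V i (block blk i x)"

lemma U_continuous: "continuous_on S (U i)"
proof -
  have "continuous_on (block_space blk i) (V i)" using candidates by (simp add: lyapunov_candidate_def)
  then show ?thesis by (rule continuous_on_compose2) (auto intro: continuous_on_block)
qed

lemma U_bounds:
  "\<exists>p1 p2. (\<forall>i. class_K_inf (p1 i) \<and> class_K_inf (p2 i) \<and>
     (\<forall>x. p1 i (norm (block blk i x)) \<le> U i x \<and> U i x \<le> p2 i (norm (block blk i x))))"
proof -
  have "\<exists>p1 p2. class_K_inf p1 \<and> class_K_inf p2 \<and>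
     (\<forall>x. p1 (norm (block blk i x)) \<le> U i x \<and> U i x \<le> p2 (norm (block blk i x)))" for i
    using candidates[of i] unfolding lyapunov_candidate_def by (metis block_in)
  then show ?thesis by metis
qed

lemma U_nonneg: "0 \<le> U i x"
proof -
  obtain p1 p2 where "class_K_inf (p1 i)" "p1 i (norm (block blk i x)) \<le> U i x" using U_bounds by blast
  then show ?thesis using class_K_nonneg[OF class_K_infD, of "p1 i" "norm (block blk i x)"] by simp
qed

lemma U_pos_iff: "0 < U i x \<longleftrightarrow> block blk i x \<noteq> 0"
proof -
  obtain p1 p2 where p: "\<forall>i. class_K_inf (p1 i) \<and> class_K_inf (p2 i) \<and>
     (\<forall>x. p1 i (norm (block blk i x)) \<le> U i x \<and> U i x \<le> p2 i (norm (block blk i x)))"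
    using U_bounds by blast
  have K: "class_K (p1 i)" "class_K (p2 i)" using p class_K_infD by auto
  show ?thesis
  proof
    assume "0 < U i x"
    then have "0 < p2 i (norm (block blk i x))" using p by (meson less_le_trans)
    then show "block blk i x \<noteq> 0" using class_K_0[OF K(2)] by auto
  next
    assume "block blk i x \<noteq> 0"
    then have "0 < p1 i (norm (block blk i x))" using class_K_pos[OF K(1)] by simp
    then show "0 < U i x" using p by (meson less_le_trans)
  qed
qed

lemma U_lipschitz_near:
  assumes "block blk i x \<noteq> 0"
  shows "\<exists>r>0. \<exists>L. L-lipschitz_on (ball x r) (U i)"
proof -
  have "loc_lipschitz_on (block_space blk i - {0}) (V i)" using candidates by (simp add: lyapunov_candidate_def)
  then obtain e L where e: "e > 0" "L-lipschitz_on (cball (block blk i x) e \<inter> (block_space blk i - {0})) (V i)"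
    unfolding loc_lipschitz_on_def using assms by (meson Diff_iff block_in singletonD)
  define r where "r = min e (norm (block blk i x))"
  have r: "r > 0" using e assms by (simp add: r_def)
  have d: "norm (block blk i y - block blk i z) \<le> norm (y - z)" for y z
    unfolding block_diff[symmetric] by (rule norm_block_le)
  have in_: "block blk i y \<in> cball (block blk i x) e \<inter> (block_space blk i - {0})" if "y \<in> ball x r" for y
  proof -
    have lt: "norm (block blk i x - block blk i y) < r" using d[of x y] that by (simp add: dist_norm)
    then have "block blk i y \<noteq> 0" by (auto simp: r_def)
    then show ?thesis using lt by (simp add: dist_norm r_def)
  qed
  have "L-lipschitz_on (ball x r) (U i)"
  proof (rule lipschitz_onI)
    show L0: "0 \<le> L" using e(2) lipschitz_on_nonneg by blast
    fix y z assume yz: "y \<in> ball x r" "z \<in> ball x r"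
    have "dist (U i y) (U i z) \<le> L * dist (block blk i y) (block blk i z)"
      by (rule lipschitz_onD[OF e(2) in_[OF yz(1)] in_[OF yz(2)]])
    also have "\<dots> \<le> L * dist y z" using d[of y z] L0 by (intro mult_left_mono) (auto simp: dist_norm)
    finally show "dist (U i y) (U i z) \<le> L * dist y z" .
  qed
  then show ?thesis using r by blast
qed

text \<open>The descent lemmas work on open sets of the full space, whereas V_i is differentiated
  within a coordinate subspace. Since \<open>U i\<close> is constant in the remaining coordinates,
  its derivative annihilates them and restricts to a derivative of V_i.\<close>

lemma U_derivative_restrict:
  assumes "(U i has_derivative D) (at z)"
  shows "(V i has_derivative D) (at (block blk i z) within block_space blk i)" and "D v = D (block blk i v)"
proof -
  let ?z = "block blk i z"
  \<comment> \<open>Shifting by the part of z outside the i-th block makes \<open>U i\<close>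
    coincide with \<open>V i\<close> on the block space.\<close>
  have inv: "U i (y + (z - ?z)) = V i y" if "y \<in> block_space blk i" for y
    using that by (simp add: block_add block_diff block_id)
  have "(U i has_derivative D) (at (?z + (z - ?z)))" using assms by simp
  then have "((\<lambda>y. U i (y + (z - ?z))) has_derivative D) (at ?z)"
    by (auto intro!: derivative_eq_intros has_derivative_compose[of "\<lambda>y. y + (z - ?z)" "\<lambda>y. y" ?z UNIV "U i" D])
  then have "((\<lambda>y. U i (y + (z - ?z))) has_derivative D) (at ?z within block_space blk i)"
    by (rule has_derivative_at_withinI)
  then show "(V i has_derivative D) (at ?z within block_space blk i)"
    by (rule has_derivative_transform[rotated 2]) (use inv in auto)
  have l: "linear D" using assms has_derivative_linear by blast
  have "((\<lambda>t. U i (z + t *\<^sub>R (v - block blk i v))) has_real_derivative D (v - block blk i v)) (at 0)"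
    by (rule has_derivative_imp_dir_DERIV[OF assms])
  moreover have "U i (z + t *\<^sub>R (v - block blk i v)) = U i z" for t
    by (simp add: block_add block_scaleR block_diff block_id)
  ultimately have "((\<lambda>t. U i z) has_real_derivative D (v - block blk i v)) (at (0::real))" by simp
  then have "D (v - block blk i v) = 0" using DERIV_unique DERIV_const by blast
  then show "D v = D (block blk i v)" using linear_diff[OF l] by simp
qed

lemma gain_additive:
  assumes s: "0 \<le> s" and r: "0 \<le> r"
  shows "\<mu> i (extend (\<chi> j. \<gamma> i j (s $ j)) (\<gamma>u i r)) = gain_op \<mu> \<gamma> \<gamma>u s $ i + \<gamma>u i r"
proof -
  obtain x where x: "\<And>i. U i x = s $ i"
    using lyapunov_values_onto[OF candidates blocks_nonempty s] by blast
  obtain u :: "real ^ 'p" where u: "norm u = r" using vector_choose_size[OF r] by blast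
  have "(\<chi> i. U i x) = s" by (simp add: x vec_eq_iff)
  with additive[of x u] u have "gain_op_ext \<mu> \<gamma> \<gamma>u s r = gain_op \<mu> \<gamma> \<gamma>u s + (\<chi> i. \<gamma>u i r)" by simp
  then have "gain_op_ext \<mu> \<gamma> \<gamma>u s r $ i = gain_op \<mu> \<gamma> \<gamma>u s $ i + \<gamma>u i r" by simp
  then show ?thesis by (simp add: gain_op_ext_def)
qed

end

section \<open>The maximum of the rescaled Lyapunov functions\<close>

locale omega_network = iss_network \<mu> \<gamma> \<gamma>u blk f V
  for \<mu> :: "'n::finite \<Rightarrow> real ^ ('n option) \<Rightarrow> real"
    and \<gamma> :: "'n \<Rightarrow> 'n \<Rightarrow> real \<Rightarrow> real"
    and \<gamma>u :: "'n \<Rightarrow> real \<Rightarrow> real"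
    and blk :: "'m::finite \<Rightarrow> 'n"
    and f :: "real ^ 'm \<Rightarrow> real ^ 'p::finite \<Rightarrow> real ^ 'm"
    and V :: "'n \<Rightarrow> real ^ 'm \<Rightarrow> real" +
  fixes \<alpha> :: "real \<Rightarrow> real" and \<sigma> :: "'n \<Rightarrow> real \<Rightarrow> real"
  assumes \<alpha>_K_inf: "class_K_inf \<alpha>"
    and \<sigma>: "Omega_path (diag_op \<alpha> \<circ> gain_op \<mu> \<gamma> \<gamma>u) \<sigma>"
begin

abbreviation W :: "'n \<Rightarrow> real ^ 'm \<Rightarrow> real" where
  "W i x \<equiv> inv_K (\<sigma> i) (U i x)"

abbreviation Vmax :: "real ^ 'm \<Rightarrow> real" where
  "Vmax x \<equiv> (MAX i. W i x)"

lemma K_path: "class_K_inf (\<sigma> i)"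
  using \<sigma> by (simp add: Omega_path_def)

lemma K_inv_path: "class_K_inf (inv_K (\<sigma> i))"
  by (rule class_K_inf_inv_K[OF K_path])

lemma inv_path_lipschitz: "loc_lipschitz_on {0<..} (inv_K (\<sigma> i))"
  using \<sigma> by (simp add: Omega_path_def)

lemma W_nonneg: "0 \<le> W i x"
  by (rule class_K_nonneg[OF class_K_infD[OF K_inv_path] U_nonneg])

lemma W_continuous: "continuous_on S (W i)"
  by (rule continuous_on_compose2[OF class_K_continuous_on[OF class_K_infD[OF K_inv_path] order_refl] U_continuous])
    (auto simp: U_nonneg)

lemma U_eq: "U i x = \<sigma> i (W i x)"
  using inv_K_props(2)[OF K_path U_nonneg] by simp

lemma W_le_Vmax: "W i x \<le> Vmax x"
  by (rule Max_ge) auto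

lemma Vmax_attained: "\<exists>i. Vmax x = W i x"
proof -
  have "Vmax x \<in> range (\<lambda>i. W i x)" by (rule Max_in) auto
  then show ?thesis by blast
qed

lemma Vmax_nonneg: "0 \<le> Vmax x"
  using Vmax_attained[of x] W_nonneg by metis

lemma Vmax_continuous: "continuous_on S Vmax"
  by (rule continuous_on_Max) (auto intro: W_continuous)

lemma W_pos_iff: "0 < W i x \<longleftrightarrow> block blk i x \<noteq> 0"
proof -
  have "0 < W i x \<longleftrightarrow> 0 < U i x"
    using inv_K_le_iff[OF K_path[of i] U_nonneg, of 0] class_K_0[OF class_K_infD[OF K_path[of i]]] by (auto simp: not_le[symmetric])
  then show ?thesis using U_pos_iff by simp
qed

lemma Vmax_bounds:
  "\<exists>p1 p2. class_K_inf p1 \<and> class_K_inf p2 \<and> (\<forall>x. p1 (norm x) \<le> Vmax x \<and> Vmax x \<le> p2 (norm x))"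
proof -
  obtain p1 p2 where p: "\<And>i. class_K_inf (p1 i)" "\<And>i. class_K_inf (p2 i)"
    "\<And>i x. p1 i (norm (block blk i x)) \<le> U i x" "\<And>i x. U i x \<le> p2 i (norm (block blk i x))"
    using U_bounds by blast
  have iK: "class_K (inv_K (\<sigma> i))" for i using K_inv_path class_K_infD by blast
  obtain h1 where h1: "class_K_inf h1" "\<And>i r. r \<ge> 0 \<Longrightarrow> h1 r \<le> inv_K (\<sigma> i) (p1 i r)"
    using class_K_inf_lower_bound[of UNIV "\<lambda>i r. inv_K (\<sigma> i) (p1 i r)"] class_K_inf_compose[OF K_inv_path p(1)] by auto
  obtain h2 where h2: "class_K_inf h2" "\<And>i r. r \<ge> 0 \<Longrightarrow> inv_K (\<sigma> i) (p2 i r) \<le> h2 r"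
    using class_K_upper_bound[of UNIV "\<lambda>i r. inv_K (\<sigma> i) (p2 i r)"]
      class_K_infD[OF class_K_inf_compose[OF K_inv_path p(2)]] by auto
  define n where "n = real CARD('n)"
  have n: "n > 0" by (simp add: n_def)
  have low: "h1 ((1 / n) * norm x) \<le> Vmax x" for x
  proof -
    have "norm x \<le> (\<Sum>i\<in>UNIV. norm (block blk i x))"
      using norm_sum[of "\<lambda>i. block blk i x" UNIV] by (simp add: block_sum)
    \<comment> \<open>Some block carries at least the average share of the norm, hence the factor
      1/n in the lower bound.\<close>
    have "\<exists>i. (1 / n) * norm x \<le> norm (block blk i x)"
    proof (rule ccontr)
      assume "\<not> ?thesis"
      then have "(\<Sum>i\<in>UNIV. norm (block blk i x)) < (\<Sum>i\<in>(UNIV::'n set). (1 / n) * norm x)"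
        by (intro sum_strict_mono) (auto simp: not_le)
      also have "\<dots> = norm x" using n by (simp add: n_def)
      finally show False using \<open>norm x \<le> _\<close> by simp
    qed
    then obtain i where i: "(1 / n) * norm x \<le> norm (block blk i x)" by blast
    have "h1 ((1 / n) * norm x) \<le> h1 (norm (block blk i x))"
      using i n by (intro class_K_mono[OF class_K_infD[OF h1(1)]]) auto
    also have "\<dots> \<le> inv_K (\<sigma> i) (p1 i (norm (block blk i x)))" by (rule h1(2)) simp
    also have "\<dots> \<le> W i x"
      by (intro class_K_mono[OF iK] p(3) class_K_nonneg[OF class_K_infD[OF p(1)]]) simp
    also have "\<dots> \<le> Vmax x" by (rule W_le_Vmax)
    finally show ?thesis .
  qed
  have up: "Vmax x \<le> h2 (norm x)" for x
  proof -
    obtain i where i: "Vmax x = W i x" using Vmax_attained by blast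
    have "W i x \<le> inv_K (\<sigma> i) (p2 i (norm (block blk i x)))"
      by (intro class_K_mono[OF iK] p(4) U_nonneg)
    also have "\<dots> \<le> h2 (norm (block blk i x))" by (rule h2(2)) simp
    also have "\<dots> \<le> h2 (norm x)"
      by (intro class_K_mono[OF class_K_infD[OF h2(1)]] norm_block_le) simp
    finally show ?thesis using i by simp
  qed
  have "class_K_inf (\<lambda>r. h1 ((1 / n) * r))"
    using class_K_inf_compose[OF h1(1) class_K_inf_scale[of "1 / n"]] n by simp
  then show ?thesis using h2(1) low up by blast
qed

lemma Vmax_pos: "x \<noteq> 0 \<Longrightarrow> 0 < Vmax x"
proof -
  assume x: "x \<noteq> 0"
  have "\<exists>i. block blk i x \<noteq> 0"
    using x block_sum[of blk x] by (metis sum.neutral)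
  then obtain i where "0 < W i x" using W_pos_iff by blast
  then show ?thesis using W_le_Vmax[of i x] by linarith
qed

lemma W_lipschitz_near:
  assumes "block blk i x \<noteq> 0"
  shows "\<exists>r>0. \<exists>L. L-lipschitz_on (ball x r) (W i)"
proof -
  obtain r1 L1 where r1: "r1 > 0" "L1-lipschitz_on (ball x r1) (U i)" using U_lipschitz_near[OF assms] by blast
  have "U i x \<in> {0<..}" using U_pos_iff assms by auto
  then obtain e L2 where e: "e > 0" "L2-lipschitz_on (cball (U i x) e \<inter> {0<..}) (inv_K (\<sigma> i))"
    using inv_path_lipschitz[of i] unfolding loc_lipschitz_on_def by blast
  have "open {y. U i y \<in> ball (U i x) e \<inter> {0<..}}"
    using continuous_open_preimage[OF U_continuous[of UNIV i] open_UNIV open_Int[OF open_ball[of "U i x" e] open_greaterThan[of 0]]]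
    by (simp add: vimage_def)
  moreover have "x \<in> {y. U i y \<in> ball (U i x) e \<inter> {0<..}}" using e(1) \<open>U i x \<in> {0<..}\<close> by simp
  ultimately obtain r2 where r2: "r2 > 0" "ball x r2 \<subseteq> {y. U i y \<in> ball (U i x) e \<inter> {0<..}}"
    using open_contains_ball by blast
  define r where "r = min r1 r2"
  have "(L2 * L1)-lipschitz_on (ball x r) (inv_K (\<sigma> i) \<circ> U i)"
  proof (rule lipschitz_on_compose)
    show "L1-lipschitz_on (ball x r) (U i)" by (rule lipschitz_on_subset[OF r1(2)]) (auto simp: r_def)
    show "L2-lipschitz_on (U i ` ball x r) (inv_K (\<sigma> i))"
    proof (rule lipschitz_on_subset[OF e(2)])
      have "U i y \<in> ball (U i x) e \<inter> {0<..}" if "y \<in> ball x r" for y using r2(2) that by (auto simp: r_def)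
      then show "U i ` ball x r \<subseteq> cball (U i x) e \<inter> {0<..}" by fastforce
    qed
  qed
  then show ?thesis using r1 r2 by (intro exI[of _ r]) (auto simp: r_def o_def)
qed

text \<open>\<open>W i\<close> need not be Lipschitz near points whose i-th block vanishes. Such an
  i does not attain the maximum nearby, so only values above Vmax x / 2 matter. The estimate in
  \<open>P\<close> is one-sided because the increment of a maximum from z to y is controlled by an
  index active at y.\<close>

lemma Vmax_loc_lipschitz: "loc_lipschitz_on (UNIV - {0}) Vmax"
  unfolding loc_lipschitz_on_def
proof
  fix x :: "real ^ 'm" assume "x \<in> UNIV - {0}"
  then have x: "0 < Vmax x" using Vmax_pos by simp
  define P where "P i r L \<longleftrightarrow> (\<forall>y\<in>ball x r. \<forall>z\<in>ball x r. W i y > Vmax x / 2 \<longrightarrow> W i y - W i z \<le> L * dist y z \<and> 0 \<le> L)" for i r L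
  have "\<exists>r>0. \<exists>L. P i r L" for i
  proof (cases "block blk i x = 0")
    case True
    then have "W i x < Vmax x / 2" using W_pos_iff[of i x] x W_nonneg[of i x] by simp
    moreover have "open {y. W i y < Vmax x / 2}" by (intro open_Collect_less W_continuous continuous_on_const)
    ultimately obtain r where "r > 0" and "ball x r \<subseteq> {y. W i y < Vmax x / 2}"
      using open_contains_ball by (metis (no_types, lifting) mem_Collect_eq)
    then have lt: "W i y < Vmax x / 2" if "y \<in> ball x r" for y using that by blast
    show ?thesis unfolding P_def
    proof (rule exI[of _ r], rule conjI[OF \<open>r > 0\<close>], rule exI[of _ 0], intro ballI impI conjI)
      fix y z assume "y \<in> ball x r" "W i y > Vmax x / 2"
      then show "W i y - W i z \<le> 0 * dist y z" using lt[of y] by linarith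
    qed simp
  next
    case False
    then obtain r L where r: "r > 0" "L-lipschitz_on (ball x r) (W i)" using W_lipschitz_near by blast
    have "W i y - W i z \<le> L * dist y z \<and> 0 \<le> L" if "y \<in> ball x r" "z \<in> ball x r" for y z
      using lipschitz_onD[OF r(2) that] lipschitz_on_nonneg[OF r(2)] by (auto simp: dist_real_def abs_le_iff)
    then have "P i r L" unfolding P_def by blast
    then show ?thesis using r(1) by blast
  qed
  then obtain r L where r: "\<And>i. r i > 0" and P: "\<And>i. P i (r i) (L i)" by metis
  have L: "W i y - W i z \<le> L i * dist y z" if "y \<in> ball x (r i)" "z \<in> ball x (r i)" "W i y > Vmax x / 2" for i y z
    using P[of i] that unfolding P_def by blast
  have "open {y. Vmax x / 2 < Vmax y}" by (intro open_Collect_less Vmax_continuous continuous_on_const)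
  moreover have "x \<in> {y. Vmax x / 2 < Vmax y}" unfolding mem_Collect_eq using x by linarith
  ultimately obtain r0 where r0: "r0 > 0" "ball x r0 \<subseteq> {y. Vmax x / 2 < Vmax y}"
    using open_contains_ball by blast
  define e where "e = min (r0 / 2) (Min (range (\<lambda>i. r i / 2)))"
  define M where "M = max 0 (Max (range L))"
  have e0: "e > 0" using r0 r by (simp add: e_def)
  have ei: "e \<le> r i / 2" for i unfolding e_def by (rule min.coboundedI2) (rule Min_le, auto)
  have LM: "L i \<le> M" for i unfolding M_def by (rule max.coboundedI2) (rule Max_ge, auto)
  have "Vmax y - Vmax z \<le> M * dist y z" if yz: "y \<in> cball x e" "z \<in> cball x e" for y z
  proof -
    obtain i where i: "Vmax y = W i y" using Vmax_attained by blast
    have e2: "e \<le> r0 / 2" unfolding e_def by (rule min.cobounded1)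
    have "y \<in> ball x r0" using yz(1) r0(1) e2 by simp
    then have big: "W i y > Vmax x / 2" using r0(2) i by auto
    have "y \<in> ball x (r i)" "z \<in> ball x (r i)" using yz ei[of i] r[of i] by auto
    then have "W i y - W i z \<le> L i * dist y z" using L big by blast
    also have "\<dots> \<le> M * dist y z" by (intro mult_right_mono LM) simp
    finally show ?thesis using i W_le_Vmax[of i z] by linarith
  qed
  note diff = this
  have "M-lipschitz_on (cball x e) Vmax"
  proof (rule lipschitz_onI)
    fix y z assume "y \<in> cball x e" "z \<in> cball x e"
    then show "dist (Vmax y) (Vmax z) \<le> M * dist y z"
      using diff[of y z] diff[of z y] unfolding dist_real_def dist_commute[of z y] by linarith
  qed (simp add: M_def)
  then have "M-lipschitz_on (cball x e \<inter> (UNIV - {0})) Vmax" by (rule lipschitz_on_subset) auto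
  then show "\<exists>e>0. \<exists>L. L-lipschitz_on (cball x e \<inter> (UNIV - {0})) Vmax" using e0 by blast
qed

text \<open>By continuity the strict inequality persists near x, so the decay estimate is available
  at all nearby points where \<open>U i\<close> is differentiable, x itself possibly not among
  them.\<close>

lemma U_descent:
  assumes i: "0 < W i x" and al: "pos_def_fun al"
    and D: "\<And>y u D. (V i has_derivative D) (at (block blk i y) within block_space blk i) \<Longrightarrow>
      \<mu> i (extend (\<chi> j. \<gamma> i j (U j y)) (\<gamma>u i (norm u))) \<le> U i y \<Longrightarrow>
      D (block blk i (f y u)) \<le> - al (norm (block blk i y))"
    and strict: "\<mu> i (extend (\<chi> j. \<gamma> i j (U j x)) (\<gamma>u i (norm u))) < U i x"
    and c: "- al (norm (block blk i x)) < c"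
  shows "\<exists>\<delta>>0. \<forall>h. 0 < h \<and> h < \<delta> \<longrightarrow> U i (x + h *\<^sub>R f x u) - U i x \<le> c * h"
proof -
  obtain r1 L where r1: "r1 > 0" "L-lipschitz_on (ball x r1) (U i)"
    using U_lipschitz_near W_pos_iff i by blast
  have "continuous_on UNIV (\<lambda>y. \<mu> i (extend (\<chi> j. \<gamma> i j (U j y)) (\<gamma>u i (norm u))))"
    by (intro continuous_on_gain_arg U_continuous U_nonneg gain_input_nonneg) simp
  then have "open {y. \<mu> i (extend (\<chi> j. \<gamma> i j (U j y)) (\<gamma>u i (norm u))) < U i y}"
    by (intro open_Collect_less U_continuous)
  then obtain r2 where r2: "r2 > 0" "ball x r2 \<subseteq> {y. \<mu> i (extend (\<chi> j. \<gamma> i j (U j y)) (\<gamma>u i (norm u))) < U i y}"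
    using strict open_contains_ball by (metis (no_types, lifting) mem_Collect_eq)
  define r where "r = min r1 r2"
  have r: "r > 0" using r1 r2 by (simp add: r_def)
  have Lip: "L-lipschitz_on (ball x r) (U i)" by (rule lipschitz_on_subset[OF r1(2)]) (auto simp: r_def)
  have F: "isCont (\<lambda>z. f z u) x"
  proof -
    have "continuous_on UNIV (\<lambda>z. (\<lambda>(x, u). f x u) (z, u))"
      by (rule continuous_on_compose2[OF f_continuous]) (auto intro: continuous_intros)
    then show ?thesis by (simp add: continuous_on_eq_continuous_at)
  qed
  have A: "isCont (\<lambda>z. al (norm (block blk i z))) x"
  proof -
    have "continuous_on {0..} al" using al by (simp add: pos_def_fun_def)
    then have "continuous_on UNIV (\<lambda>z. al (norm (block blk i z)))"
      by (rule continuous_on_compose2) (auto intro!: continuous_on_norm continuous_on_block)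
    then show ?thesis by (simp add: continuous_on_eq_continuous_at)
  qed
  show ?thesis
  proof (rule lipschitz_local_descent[where F = "\<lambda>z. f z u" and a = "\<lambda>z. al (norm (block blk i z))", OF Lip r F A _ c])
    fix y D' assume y: "y \<in> ball x r" and D': "(U i has_derivative D') (at y)"
    have "\<mu> i (extend (\<chi> j. \<gamma> i j (U j y)) (\<gamma>u i (norm u))) \<le> U i y"
      using r2(2) y by (auto simp: r_def intro: less_imp_le)
    from D[OF U_derivative_restrict(1)[OF D'] this]
    show "D' (f y u) \<le> - al (norm (block blk i y))" using U_derivative_restrict(2)[OF D', of "f y u"] by simp
  qed
qed

end

lemma pos_def_fun_lower:
  assumes "pos_def_fun al" "0 < \<rho>" shows "\<exists>\<kappa>>0. \<forall>t\<in>{\<rho>..b}. \<kappa> \<le> al t"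
proof (cases "\<rho> \<le> b")
  case True
  have "continuous_on {\<rho>..b} al"
    by (rule continuous_on_subset[of "{0..}"]) (use assms in \<open>auto simp: pos_def_fun_def\<close>)
  then obtain m where m: "m \<in> {\<rho>..b}" "\<forall>t\<in>{\<rho>..b}. al m \<le> al t"
    using continuous_attains_inf[of "{\<rho>..b}" al] True by auto
  have "0 < al m" using assms m(1) unfolding pos_def_fun_def by (metis atLeastAtMost_iff less_eq_real_def less_le_trans not_less)
  then show ?thesis using m(2) by blast
qed (auto intro: exI[of _ 1])

context omega_network
begin

lemma W_descent:
  assumes act: "W i x = r" and r: "r1 \<le> r" "r \<le> r2" "0 < r1"
    and c: "0 < c" and cd: "\<And>z d. z \<in> {\<sigma> i r1 / 2..\<sigma> i r2} \<Longrightarrow> (inv_K (\<sigma> i) has_real_derivative d) (at z) \<Longrightarrow> c \<le> d"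
    and k: "0 < k" and U: "\<exists>\<delta>>0. \<forall>h. 0 < h \<and> h < \<delta> \<longrightarrow> U i (x + h *\<^sub>R v) - U i x \<le> - k * h"
  shows "\<forall>\<^sub>F h in at_right 0. W i (x + h *\<^sub>R v) \<le> r - c * k * h"
proof -
  have Ux: "U i x = \<sigma> i r" using U_eq[of i x] unfolding act .
  have s1: "0 < \<sigma> i r1" by (rule class_K_pos[OF class_K_infD[OF K_path] r(3)])
  have s12: "\<sigma> i r1 \<le> U i x" "U i x \<le> \<sigma> i r2"
    unfolding Ux using class_K_mono[OF class_K_infD[OF K_path[of i]], of r1 r] class_K_mono[OF class_K_infD[OF K_path[of i]], of r r2] r
    by simp_all
  obtain \<delta> where \<delta>: "\<delta> > 0" "\<And>h. 0 < h \<Longrightarrow> h < \<delta> \<Longrightarrow> U i (x + h *\<^sub>R v) \<le> U i x - k * h"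
    using U by force
  have "\<forall>\<^sub>F h in at_right 0. 0 < h \<and> h < min \<delta> (\<sigma> i r1 / (2 * k))"
    unfolding eventually_at_right_field using \<delta>(1) s1 k by (intro exI[of _ "min \<delta> (\<sigma> i r1 / (2 * k))"]) auto
  then show ?thesis
  proof eventually_elim
    case (elim h)
    \<comment> \<open>The bound on h keeps A above \<open>\<sigma> i r1 / 2\<close>, the left end of
      the interval on which the slope of the inverse is at least c.\<close>
    define A where "A = U i x - k * h"
    have "k * h \<le> \<sigma> i r1 / 2"
    proof -
      have "h \<le> \<sigma> i r1 / (2 * k)" using elim by simp
      then have "h * (2 * k) \<le> \<sigma> i r1" using k by (simp add: pos_le_divide_eq)
      then show ?thesis by (simp add: mult_ac)
    qed
    then have A: "\<sigma> i r1 / 2 \<le> A" using s12(1) by (simp add: A_def)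
    have AU: "A \<le> U i x" using k elim by (simp add: A_def)
    have "W i (x + h *\<^sub>R v) \<le> inv_K (\<sigma> i) A"
      using \<delta>(2)[of h] elim by (intro class_K_mono[OF class_K_infD[OF K_inv_path] U_nonneg]) (simp add: A_def)
    moreover have "c * (U i x - A) \<le> W i x - inv_K (\<sigma> i) A"
      by (rule inv_K_growth[OF K_path inv_path_lipschitz cd _ A AU s12(2)]) (use s1 in simp_all)
    ultimately show ?case using act by (simp add: A_def)
  qed
qed

text \<open>All constants are uniform on the annulus: \<open>Vmax\<close> ranges over [r1, r2], an
  active block has norm at least \<open>\<rho> i\<close>, and compactness bounds the decay rates
  below by \<open>k i\<close> and the slopes of the inverses by \<open>c i\<close>. Inactive indices
  lie strictly below the maximum and, by continuity, do not interfere for small h.\<close>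

lemma Vmax_descent:
  assumes g: "class_K g"
    and strict: "\<And>i x (u :: real ^ 'p). 0 < Vmax x \<Longrightarrow> W i x = Vmax x \<Longrightarrow> g (norm u) \<le> Vmax x \<Longrightarrow>
      \<mu> i (extend (\<chi> j. \<gamma> i j (U j x)) (\<gamma>u i (norm u))) < U i x"
    and ab: "0 < a"
  shows "\<exists>\<kappa>>0. \<forall>x u D. a \<le> norm x \<and> norm x \<le> b \<and> (Vmax has_derivative D) (at x) \<and> g (norm u) \<le> Vmax x \<longrightarrow>
    \<kappa> \<le> - D (f x u)"
proof -
  obtain p1 p2 where p: "class_K_inf p1" "class_K_inf p2" "\<And>x. p1 (norm x) \<le> Vmax x" "\<And>x. Vmax x \<le> p2 (norm x)"
    using Vmax_bounds by blast
  obtain q2 where q: "\<And>i. class_K_inf (q2 i)" "\<And>i x. U i x \<le> q2 i (norm (block blk i x))"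
    using U_bounds by blast
  define P where "P i al \<longleftrightarrow> pos_def_fun al \<and> (\<forall>y u D. (V i has_derivative D) (at (block blk i y) within block_space blk i) \<longrightarrow>
      \<mu> i (extend (\<chi> j. \<gamma> i j (U j y)) (\<gamma>u i (norm u))) \<le> U i y \<longrightarrow>
      D (block blk i (f y u)) \<le> - al (norm (block blk i y)))" for i al
  have "\<exists>al. P i al" for i
    using lyapunov[of i] unfolding subsystem_ISS_lyapunov_def P_def .
  then obtain al where P: "\<And>i. P i (al i)" by metis
  have al: "pos_def_fun (al i)" for i using P[of i] by (simp add: P_def)
  have alD: "D (block blk i (f y u)) \<le> - al i (norm (block blk i y))"
    if "(V i has_derivative D) (at (block blk i y) within block_space blk i)"
      "\<mu> i (extend (\<chi> j. \<gamma> i j (U j y)) (\<gamma>u i (norm u))) \<le> U i y" for i y u D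
    using P[of i] that unfolding P_def by blast
  define r1 where "r1 = p1 a"
  define r2 where "r2 = p2 b"
  have r1: "0 < r1" unfolding r1_def by (rule class_K_pos[OF class_K_infD[OF p(1)] ab])
  have s1: "0 < \<sigma> i r1" for i by (rule class_K_pos[OF class_K_infD[OF K_path] r1])
  define \<rho> where "\<rho> i = inv_K (q2 i) (\<sigma> i r1)" for i
  have \<rho>: "0 < \<rho> i" for i unfolding \<rho>_def by (rule class_K_pos[OF class_K_infD[OF class_K_inf_inv_K[OF q(1)]] s1])
  have "\<exists>k>0. \<forall>t\<in>{\<rho> i..b}. k \<le> al i t" for i by (rule pos_def_fun_lower[OF al \<rho>])
  then obtain k where k: "\<And>i. 0 < k i" "\<And>i t. t \<in> {\<rho> i..b} \<Longrightarrow> k i \<le> al i t" by metis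
  define C where "C i c \<longleftrightarrow> 0 < c \<and> (\<forall>z\<in>{\<sigma> i r1 / 2..\<sigma> i r2}. \<forall>d. (inv_K (\<sigma> i) has_real_derivative d) (at z) \<longrightarrow> c \<le> d)" for i c
  have "\<exists>c. C i c" for i
  proof -
    have "compact {\<sigma> i r1 / 2..\<sigma> i r2} \<and> {\<sigma> i r1 / 2..\<sigma> i r2} \<subseteq> {0<..}" using s1[of i] by auto
    then have "\<exists>c C. 0 < c \<and> c < C \<and> (\<forall>j. \<forall>z\<in>{\<sigma> i r1 / 2..\<sigma> i r2}. \<forall>d. (inv_K (\<sigma> j) has_real_derivative d) (at z) \<longrightarrow> c \<le> d \<and> d \<le> C)"
      using \<sigma> unfolding Omega_path_def by blast
    then show ?thesis unfolding C_def by blast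
  qed
  then obtain c where C: "\<And>i. C i (c i)" by metis
  have c: "0 < c i" for i using C[of i] by (simp add: C_def)
  have cd: "c i \<le> d" if "z \<in> {\<sigma> i r1 / 2..\<sigma> i r2}" "(inv_K (\<sigma> i) has_real_derivative d) (at z)" for i z d
    using C[of i] that unfolding C_def by blast
  \<comment> \<open>Half of \<open>k i\<close> is kept because the local descent estimate holds for
    rates strictly smaller than the one supplied by the subsystem.\<close>
  define \<kappa> where "\<kappa> = Min (range (\<lambda>i. c i * (k i / 2)))"
  have \<kappa>: "0 < \<kappa>"
  proof -
    have "\<kappa> \<in> range (\<lambda>i. c i * (k i / 2))" unfolding \<kappa>_def by (rule Min_in) simp_all
    then obtain i where i: "\<kappa> = c i * (k i / 2)" by (elim rangeE)
    show ?thesis unfolding i using c k(1) by (intro mult_pos_pos) simp_all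
  qed
  have \<kappa>le: "\<kappa> \<le> c i * (k i / 2)" for i unfolding \<kappa>_def by (rule Min_le) simp_all
  have "\<kappa> \<le> - D (f x u)"
    if x: "a \<le> norm x" "norm x \<le> b" and D: "(Vmax has_derivative D) (at x)" and u: "g (norm u) \<le> Vmax x" for x u D
  proof -
    let ?v = "f x u" and ?r = "Vmax x"
    have r: "r1 \<le> ?r" "?r \<le> r2"
    proof -
      have "p1 a \<le> p1 (norm x)" by (rule class_K_mono[OF class_K_infD[OF p(1)] _ x(1)]) (use ab in simp)
      moreover have "p2 (norm x) \<le> p2 b" by (rule class_K_mono[OF class_K_infD[OF p(2)] _ x(2)]) simp
      ultimately show "r1 \<le> ?r" "?r \<le> r2" using p(3,4)[of x] unfolding r1_def r2_def by linarith+
    qed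
    have r0: "0 < ?r" using r r1 by linarith
    have "\<forall>\<^sub>F h in at_right 0. W i (x + h *\<^sub>R ?v) \<le> ?r - \<kappa> * h" for i
    proof (cases "W i x = ?r")
      case True
      have "\<sigma> i r1 \<le> \<sigma> i ?r"
        by (rule class_K_mono[OF class_K_infD[OF K_path] _ r(1)]) (use r1 in simp)
      moreover have "U i x = \<sigma> i ?r" using U_eq[of i x] unfolding True .
      ultimately have "\<sigma> i r1 \<le> U i x" by simp
      then have "\<sigma> i r1 \<le> q2 i (norm (block blk i x))" using q(2) order_trans by blast
      then have "\<rho> i \<le> norm (block blk i x)"
        unfolding \<rho>_def using inv_K_le_iff[OF q(1)] s1 by (simp add: less_imp_le)
      then have "norm (block blk i x) \<in> {\<rho> i..b}" using norm_block_le[of blk i x] x(2) by simp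
      from k(2)[OF this] have kal: "- al i (norm (block blk i x)) < - (k i / 2)" using k(1)[of i] by linarith
      have "\<exists>\<delta>>0. \<forall>h. 0 < h \<and> h < \<delta> \<longrightarrow> U i (x + h *\<^sub>R ?v) - U i x \<le> - (k i / 2) * h"
        by (rule U_descent[OF _ al _ strict[OF r0 True u] kal]) (use True r0 alD in auto)
      then have "\<forall>\<^sub>F h in at_right 0. W i (x + h *\<^sub>R ?v) \<le> ?r - c i * (k i / 2) * h"
        by (intro W_descent[OF True r r1 c cd]) (use k(1) in auto)
      moreover have "\<forall>\<^sub>F h in at_right (0::real). 0 < h" by (rule eventually_at_right_less)
      ultimately show ?thesis
      proof eventually_elim
        case (elim h)
        have "\<kappa> * h \<le> c i * (k i / 2) * h" using \<kappa>le[of i] elim(2) by (intro mult_right_mono) auto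
        then show ?case using elim(1) by linarith
      qed
    next
      case False
      then have lt: "W i x < ?r" using W_le_Vmax[of i x] by (rule le_neq_trans[rotated])
      have "continuous_on UNIV (\<lambda>h::real. W i (x + h *\<^sub>R ?v) + \<kappa> * h)"
        by (intro continuous_on_add continuous_on_compose2[OF W_continuous[of UNIV]] continuous_intros) auto
      then have "isCont (\<lambda>h::real. W i (x + h *\<^sub>R ?v) + \<kappa> * h) 0"
        using continuous_on_eq_continuous_at[OF open_UNIV] by blast
      then have "((\<lambda>h::real. W i (x + h *\<^sub>R ?v) + \<kappa> * h) \<longlongrightarrow> W i (x + 0 *\<^sub>R ?v) + \<kappa> * 0) (at 0)"
        by (simp only: isCont_def)
      then have "((\<lambda>h::real. W i (x + h *\<^sub>R ?v) + \<kappa> * h) \<longlongrightarrow> W i x) (at 0)" by simp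
      then have "((\<lambda>h::real. W i (x + h *\<^sub>R ?v) + \<kappa> * h) \<longlongrightarrow> W i x) (at_right 0)"
        by (rule tendsto_within_subset) simp
      then have "\<forall>\<^sub>F h in at_right 0. W i (x + h *\<^sub>R ?v) + \<kappa> * h < ?r" using lt by (rule order_tendstoD(2))
      then show ?thesis by eventually_elim simp
    qed
    then have "\<forall>\<^sub>F h in at_right 0. \<forall>i. W i (x + h *\<^sub>R ?v) \<le> ?r - \<kappa> * h"
      by (rule eventually_all_finite)
    moreover have "\<forall>\<^sub>F h in at_right (0::real). 0 < h" by (rule eventually_at_right_less)
    ultimately have ev: "\<forall>\<^sub>F h in at_right 0. (Vmax (x + h *\<^sub>R ?v) - Vmax x) / h \<le> - \<kappa>"
    proof eventually_elim
      case (elim h)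
      obtain i where i: "Vmax (x + h *\<^sub>R ?v) = W i (x + h *\<^sub>R ?v)" using Vmax_attained by blast
      have "W i (x + h *\<^sub>R ?v) \<le> Vmax x - \<kappa> * h" using elim(1) by blast
      then have "Vmax (x + h *\<^sub>R ?v) - Vmax x \<le> - \<kappa> * h" unfolding i by linarith
      then show ?case using elim(2) pos_divide_le_eq by blast
    qed
    have "((\<lambda>h. (Vmax (x + h *\<^sub>R ?v) - Vmax x) / h) \<longlongrightarrow> D ?v) (at 0)"
      using has_derivative_imp_dir_DERIV[OF D, of ?v] by (simp add: has_field_derivative_iff)
    then have "((\<lambda>h. (Vmax (x + h *\<^sub>R ?v) - Vmax x) / h) \<longlongrightarrow> D ?v) (at_right 0)"
      by (rule tendsto_within_subset) simp
    from tendsto_upperbound[OF this ev] show ?thesis by simp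
  qed
  then show ?thesis using \<kappa> by blast
qed

theorem Vmax_ISS_lyapunov: "ISS_lyapunov f Vmax"
proof -
  obtain \<eta> where \<eta>: "class_K_inf \<eta>" and margin: "\<And>r s i w. r > 0 \<Longrightarrow> 0 \<le> s \<Longrightarrow> (\<And>j. s $ j \<le> \<sigma> j r) \<Longrightarrow> w \<le> \<eta> r \<Longrightarrow>
      gain_op \<mu> \<gamma> \<gamma>u s $ i + w < \<sigma> i r"
    using Omega_path_input_margin[OF \<alpha>_K_inf \<sigma>] by blast
  obtain h where h: "class_K_inf h" "\<And>i r. r \<ge> 0 \<Longrightarrow> \<gamma>u i r \<le> h r"
    using class_K_upper_bound[of UNIV \<gamma>u] gains_input by auto
  \<comment> \<open>With this gain, Vmax x \<ge> g |u| implies that every \<gamma>u i |u| is at most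
    \<eta> (Vmax x), the margin along the path.\<close>
  define g where "g r = inv_K \<eta> (h r)" for r
  have g: "class_K g"
    unfolding g_def by (rule class_K_compose[OF class_K_infD[OF class_K_inf_inv_K[OF \<eta>]] class_K_infD[OF h(1)]])
  have strict: "\<mu> i (extend (\<chi> j. \<gamma> i j (U j x)) (\<gamma>u i (norm u))) < U i x"
    if r: "0 < Vmax x" and act: "W i x = Vmax x" and u: "g (norm u) \<le> Vmax x" for i x and u :: "real ^ 'p"
  proof -
    let ?s = "\<chi> j. U j x"
    have s0: "0 \<le> ?s" by (simp add: vec_nonneg_iff U_nonneg)
    have "h (norm u) \<le> \<eta> (Vmax x)"
      using u inv_K_le_iff[OF \<eta> class_K_nonneg[OF class_K_infD[OF h(1)]], of "norm u" "Vmax x"] r by (simp add: g_def)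
    then have w: "\<gamma>u i (norm u) \<le> \<eta> (Vmax x)" using h(2)[of "norm u" i] by simp
    have "?s $ j \<le> \<sigma> j (Vmax x)" for j
      using inv_K_le_iff[OF K_path[of j] U_nonneg[of j x], of "Vmax x"] W_le_Vmax[of j x] r by simp
    from margin[OF r s0 this w, of i] show ?thesis
      using gain_additive[OF s0, of "norm u" i] U_eq[of i x] act by simp
  qed
  \<comment> \<open>Triples, so that one envelope serves all inputs and derivatives at points of the
    same norm. The origin is treated apart: \<open>Vmax\<close> has its minimum there, so a
    derivative at 0 vanishes.\<close>
  define X :: "((real ^ 'm) \<times> (real ^ 'p) \<times> (real ^ 'm \<Rightarrow> real)) set" where "X = {(x, u, D). x \<noteq> 0 \<and> (Vmax has_derivative D) (at x) \<and> g (norm u) \<le> Vmax x}"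
  have "\<exists>al. pos_def_fun al \<and> (\<forall>p\<in>X. al (norm (fst p)) \<le> - (snd (snd p)) (f (fst p) (fst (snd p)))) \<and>
      (\<forall>r\<ge>0. al r \<le> r) \<and> (\<forall>r s. \<bar>al r - al s\<bar> \<le> \<bar>r - s\<bar>)"
  proof (rule pos_def_lower_envelope)
    fix a b :: real assume ab: "0 < a" "a \<le> b"
    from Vmax_descent[OF g strict ab(1), of b] obtain \<kappa> where \<kappa>: "\<kappa> > 0" "\<And>x u D. a \<le> norm x \<Longrightarrow> norm x \<le> b \<Longrightarrow>
        (Vmax has_derivative D) (at x) \<Longrightarrow> g (norm u) \<le> Vmax x \<Longrightarrow> \<kappa> \<le> - D (f x u)" by blast
    show "\<exists>\<kappa>>0. \<forall>p\<in>X. a \<le> norm (fst p) \<and> norm (fst p) \<le> b \<longrightarrow> \<kappa> \<le> - (snd (snd p)) (f (fst p) (fst (snd p)))"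
      by (intro exI[of _ \<kappa>] conjI \<kappa>(1) ballI impI) (auto simp: X_def intro!: \<kappa>(2))
  qed (auto simp: X_def)
  then obtain al where al: "pos_def_fun al" "\<And>p. p \<in> X \<Longrightarrow> al (norm (fst p)) \<le> - (snd (snd p)) (f (fst p) (fst (snd p)))"
    by blast
  have D: "D (f x u) \<le> - al (norm x)" if D: "(Vmax has_derivative D) (at x)" and u: "g (norm u) \<le> Vmax x" for x u D
  proof (cases "x = 0")
    case True
    have "Vmax 0 = 0"
    proof -
      obtain i where "Vmax 0 = W i 0" using Vmax_attained by blast
      moreover have "\<not> 0 < W i 0" unfolding W_pos_iff by (simp add: block_def vec_eq_iff)
      ultimately show ?thesis using W_nonneg[of i 0] by simp
    qed
    then have "\<forall>\<^sub>F y in at x. Vmax x \<le> Vmax y" using True Vmax_nonneg by (intro always_eventually) simp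
    from has_derivative_local_min[OF D this] have "D = (\<lambda>h. 0)" .
    moreover have "al 0 = 0" using al(1) by (auto simp: pos_def_fun_def)
    ultimately show ?thesis using True by simp
  next
    case False
    then have "(x, u, D) \<in> X" using D u by (simp add: X_def)
    from al(2)[OF this] show ?thesis by simp
  qed
  have "lyapunov_candidate UNIV Vmax"
    unfolding lyapunov_candidate_def using Vmax_continuous Vmax_bounds Vmax_loc_lipschitz by auto
  then show ?thesis unfolding ISS_lyapunov_def using g al(1) D by blast
qed

end


section \<open>Existence of Omega-paths\<close>

lemma incseq_vec_convergent:
  fixes X :: "nat \<Rightarrow> real ^ 'n"
  assumes inc: "\<And>n. X n \<le> X (Suc n)" and bd: "\<And>n i. X n $ i \<le> B i"
  shows "\<exists>l. X \<longlonglongrightarrow> l"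
proof -
  have "\<exists>l. (\<lambda>n. X n $ i) \<longlonglongrightarrow> l" for i
  proof -
    have "incseq (\<lambda>n. X n $ i)" by (rule incseq_SucI) (use inc in \<open>simp add: less_eq_vec_def\<close>)
    then show ?thesis using incseq_convergent[of "\<lambda>n. X n $ i" "B i"] bd by blast
  qed
  then obtain l where "\<And>i. (\<lambda>n. X n $ i) \<longlonglongrightarrow> l i" by metis
  then have "X \<longlonglongrightarrow> (\<chi> i. l i)" by (intro vec_tendstoI) simp
  then show ?thesis by blast
qed

lemma decseq_vec_convergent:
  fixes X :: "nat \<Rightarrow> real ^ 'n"
  assumes dec: "\<And>n. X (Suc n) \<le> X n" and bd: "\<And>n. 0 \<le> X n"
  shows "\<exists>l. X \<longlonglongrightarrow> l"
proof -
  have "\<exists>l. (\<lambda>n. - X n) \<longlonglongrightarrow> l"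
    by (rule incseq_vec_convergent[where B = "\<lambda>_. 0"]) (use dec bd in \<open>auto simp: less_eq_vec_def\<close>)
  then obtain l where "(\<lambda>n. - X n) \<longlonglongrightarrow> l" by blast
  from tendsto_minus[OF this] show ?thesis by auto
qed

lemma tendsto_vec_le:
  fixes X Y :: "nat \<Rightarrow> real ^ 'n"
  assumes "X \<longlonglongrightarrow> x" "Y \<longlonglongrightarrow> y" "\<And>n. X n \<le> Y n" shows "x \<le> y"
proof -
  have "x $ i \<le> y $ i" for i
    by (rule LIMSEQ_le[OF tendsto_vec_nth[OF assms(1)] tendsto_vec_nth[OF assms(2)]])
      (use assms(3) in \<open>auto simp: less_eq_vec_def\<close>)
  then show ?thesis by (simp add: less_eq_vec_def)
qed

section \<open>Monotone operators with a small gain condition\<close>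

locale monotone_operator =
  fixes T :: "real ^ 'n::finite \<Rightarrow> real ^ 'n"
  assumes T_mono: "\<And>s t. 0 \<le> s \<Longrightarrow> s \<le> t \<Longrightarrow> T s \<le> T t"
    and T_cont: "continuous_on {s. 0 \<le> s} T"
    and T_0: "T 0 = 0"
    and small_gain: "\<And>s. 0 \<le> s \<Longrightarrow> s \<noteq> 0 \<Longrightarrow> \<not> s \<le> T s"
begin

lemma T_nonneg: "0 \<le> s \<Longrightarrow> 0 \<le> T s"
  using T_mono[of 0 s] T_0 by simp

lemma iterate_nonneg: "0 \<le> s \<Longrightarrow> 0 \<le> (T ^^ m) s"
  by (induction m) (simp_all add: T_nonneg)

lemma fixed_point_zero: "0 \<le> s \<Longrightarrow> T s = s \<Longrightarrow> s = 0"
  using small_gain[of s] by auto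

lemma T_tendsto:
  assumes "X \<longlonglongrightarrow> l" "\<And>n. 0 \<le> X n" shows "(\<lambda>n. T (X n)) \<longlonglongrightarrow> T l"
proof -
  have "0 \<le> l" by (rule tendsto_vec_le[OF tendsto_const assms])
  then show ?thesis by (intro continuous_on_tendsto_compose[OF T_cont assms(1)]) (use assms(2) in auto)
qed

lemma orbit_decreasing:
  assumes "0 \<le> b" "T b \<le> b" shows "(T ^^ Suc m) b \<le> (T ^^ m) b"
proof (induction m)
  case (Suc m)
  have "0 \<le> (T ^^ Suc m) b" by (rule iterate_nonneg[OF assms(1)])
  from T_mono[OF this Suc] show ?case by simp
qed (use assms in simp)

text \<open>The decreasing orbit converges to a fixed point, and a nonzero fixed point would violate
  the small gain condition.\<close>

lemma orbit_tendsto_zero: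
  assumes b: "0 \<le> b" "T b \<le> b" shows "(\<lambda>m. (T ^^ m) b) \<longlonglongrightarrow> 0"
proof -
  obtain l where l: "(\<lambda>m. (T ^^ m) b) \<longlonglongrightarrow> l"
    using decseq_vec_convergent[of "\<lambda>m. (T ^^ m) b"] orbit_decreasing[OF b] iterate_nonneg[OF b(1)] by blast
  have l0: "0 \<le> l" by (rule tendsto_vec_le[OF tendsto_const l]) (rule iterate_nonneg[OF b(1)])
  have "(\<lambda>m. T ((T ^^ m) b)) \<longlonglongrightarrow> T l" by (rule T_tendsto[OF l iterate_nonneg[OF b(1)]])
  moreover have "(\<lambda>m. T ((T ^^ m) b)) \<longlonglongrightarrow> l" using LIMSEQ_Suc[OF l] by simp
  ultimately have "T l = l" using LIMSEQ_unique by blast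
  with fixed_point_zero[OF l0] l show ?thesis by simp
qed

text \<open>
  A fixed point of \<open>s \<mapsto> (s + h s) / (1 + \<Sum> h s / \<rho>)\<close> on the simplex, where \<open>h\<close> is the positive part of
  \<open>T s - s\<close>, either has \<open>h s = 0\<close> or satisfies \<open>s \<le> T s\<close>.
\<close>

lemma decay_point_exists:
  assumes \<rho>: "0 < \<rho>" shows "\<exists>b\<ge>0. (\<Sum>i\<in>UNIV. b $ i) = \<rho> \<and> T b \<le> b"
proof -
  define C where "C = {s :: real ^ 'n. 0 \<le> s \<and> (\<Sum>i\<in>UNIV. s $ i) = \<rho>}"
  define h where "h s i = max 0 (T s $ i - s $ i)" for s i
  define k where "k s = 1 + (\<Sum>i\<in>UNIV. h s i) / \<rho>" for s
  define \<phi> where "\<phi> s = (\<chi> i. (s $ i + h s i) / k s)" for s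
  have h0: "0 \<le> h s i" for s i by (simp add: h_def)
  have k1: "1 \<le> k s" for s unfolding k_def using \<rho> h0 by (simp add: sum_nonneg)
  have C_le: "s $ i \<le> \<rho>" if "s \<in> C" for s i
    using that member_le_sum[of i UNIV "\<lambda>i. s $ i"] by (auto simp: C_def vec_nonneg_iff)
  have "C = {s. 0 \<le> s} \<inter> {s. (\<Sum>i\<in>UNIV. s $ i) = \<rho>}" by (auto simp: C_def)
  moreover have "closed {s :: real ^ 'n. 0 \<le> s}"
    unfolding vec_nonneg_iff by (intro closed_Collect_all closed_Collect_le continuous_intros)
  moreover have "closed {s :: real ^ 'n. (\<Sum>i\<in>UNIV. s $ i) = \<rho>}"
    by (intro closed_Collect_eq continuous_intros)
  ultimately have "closed C" by (simp add: closed_Int)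
  moreover have "bounded C"
  proof -
    have "norm s \<le> real CARD('n) * \<rho>" if "s \<in> C" for s
    proof -
      have "norm s \<le> (\<Sum>i\<in>UNIV. \<bar>s $ i\<bar>)" by (rule norm_le_l1_cart)
      also have "\<dots> = \<rho>" using that by (auto simp: C_def vec_nonneg_iff)
      also have "\<dots> \<le> real CARD('n) * \<rho>" using \<rho> by (simp add: Suc_le_eq)
      finally show ?thesis .
    qed
    then show ?thesis unfolding bounded_iff by blast
  qed
  ultimately have "compact C" by (simp add: compact_eq_bounded_closed)
  moreover have "convex C"
  proof (rule convexI)
    fix x y :: "real ^ 'n" and u v :: real assume xy: "x \<in> C" "y \<in> C" and uv: "0 \<le> u" "0 \<le> v" "u + v = 1"
    have "(\<Sum>i\<in>UNIV. (u *\<^sub>R x + v *\<^sub>R y) $ i) = u * \<rho> + v * \<rho>"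
      using xy by (simp add: C_def sum.distrib flip: sum_distrib_left)
    also have "\<dots> = \<rho>" using uv by (simp flip: distrib_right)
    finally show "u *\<^sub>R x + v *\<^sub>R y \<in> C" using xy uv by (simp add: C_def vec_nonneg_iff)
  qed
  moreover have "C \<noteq> {}"
  proof -
    have "(\<chi> i. \<rho> / real CARD('n)) \<in> C" using \<rho> by (simp add: C_def vec_nonneg_iff)
    then show ?thesis by blast
  qed
  moreover have "continuous_on C \<phi>"
  proof -
    have Tc: "continuous_on C T" by (rule continuous_on_subset[OF T_cont]) (auto simp: C_def)
    then have hc: "continuous_on C (\<lambda>s. h s i)" for i unfolding h_def by (intro continuous_intros)
    then have "continuous_on C k" unfolding k_def using \<rho> by (intro continuous_intros) auto
    moreover have "\<forall>s\<in>C. k s \<noteq> 0" using k1 by (metis not_one_le_zero)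
    ultimately show ?thesis unfolding \<phi>_def using hc
      by (intro continuous_on_vec_lambda continuous_on_divide continuous_on_add continuous_on_component continuous_on_id) auto
  qed
  moreover have "\<phi> \<in> C \<rightarrow> C"
  proof
    fix s assume s: "s \<in> C"
    have k0: "0 < k s" using k1[of s] by linarith
    have "(\<Sum>i\<in>UNIV. \<phi> s $ i) = ((\<Sum>i\<in>UNIV. s $ i) + (\<Sum>i\<in>UNIV. h s i)) / k s"
      by (simp add: \<phi>_def sum.distrib flip: sum_divide_distrib)
    also have "(\<Sum>i\<in>UNIV. s $ i) + (\<Sum>i\<in>UNIV. h s i) = \<rho> * k s"
      using s \<rho> by (simp add: C_def k_def distrib_left)
    finally have "(\<Sum>i\<in>UNIV. \<phi> s $ i) = \<rho>" using k0 by simp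
    moreover have "0 \<le> \<phi> s" using s k0 h0 by (auto simp: \<phi>_def C_def vec_nonneg_iff)
    ultimately show "\<phi> s \<in> C" by (simp add: C_def)
  qed
  ultimately obtain b where b: "b \<in> C" "\<phi> b = b" using brouwer[of C \<phi>] by blast
  have b0: "0 \<le> b" and bn: "b \<noteq> 0" and bs: "(\<Sum>i\<in>UNIV. b $ i) = \<rho>" using b(1) \<rho> by (auto simp: C_def)
  \<comment> \<open>The fixed point equation, componentwise. If the sum of the \<open>h b i\<close>
    were positive, every positive component of b would be strictly below its image, while zero
    components are trivially below theirs; so b \<le> T b.\<close>
  have eq: "h b i = b $ i * ((\<Sum>i\<in>UNIV. h b i) / \<rho>)" for i
  proof -
    have k0: "k b \<noteq> 0" using k1[of b] by linarith
    have "(b $ i + h b i) / k b = b $ i" using b(2) by (simp add: \<phi>_def vec_eq_iff)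
    then have "b $ i + h b i = b $ i * k b" using k0 by (simp add: divide_eq_eq)
    then show ?thesis by (simp add: k_def distrib_left)
  qed
  have "(\<Sum>i\<in>UNIV. h b i) = 0"
  proof (rule ccontr)
    assume ne: "(\<Sum>i\<in>UNIV. h b i) \<noteq> 0"
    have "0 \<le> (\<Sum>i\<in>UNIV. h b i)" by (rule sum_nonneg) (rule h0)
    with ne \<rho> have pos: "0 < (\<Sum>i\<in>UNIV. h b i) / \<rho>" by simp
    have "b $ i \<le> T b $ i" for i
    proof (cases "b $ i = 0")
      case True
      then show ?thesis using T_nonneg[OF b0] by (simp add: vec_nonneg_iff)
    next
      case False
      then have "0 < b $ i" using b0 by (simp add: vec_nonneg_iff less_le)
      then have "0 < h b i" using eq[of i] pos by (metis mult_pos_pos)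
      then show ?thesis by (simp add: h_def less_max_iff_disj)
    qed
    then show False using small_gain[OF b0 bn] by (simp add: less_eq_vec_def)
  qed
  then have "h b i = 0" for i using eq[of i] by simp
  then have "T b \<le> b" unfolding h_def less_eq_vec_def by (metis diff_le_0_iff_le max.cobounded2)
  then show ?thesis using b0 bs by blast
qed

end

section \<open>Irreducible operators and robustness of the small gain condition\<close>

locale irreducible_operator = monotone_operator T
  for T :: "real ^ 'n::finite \<Rightarrow> real ^ 'n" +
  fixes E :: "'n \<Rightarrow> 'n \<Rightarrow> bool"
  assumes E_pos: "\<And>i j s. E i j \<Longrightarrow> 0 \<le> s \<Longrightarrow> 0 < s $ j \<Longrightarrow> 0 < T s $ i"
    and E_proper: "\<And>i j M. E i j \<Longrightarrow> \<exists>C. \<forall>s\<ge>0. C \<le> s $ j \<longrightarrow> M \<le> T s $ i"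
    and E_irreducible: "\<And>I. I \<noteq> {} \<Longrightarrow> I \<noteq> UNIV \<Longrightarrow> \<exists>i\<in>I. \<exists>j\<in>- I. E i j"
    and E_column: "\<And>j. \<exists>i. E i j"
begin

text \<open>Taking the maximum with s keeps everything that earlier iterates have reached, so that
  one exponent serves all pairs of components although the connecting paths have different
  lengths.\<close>

definition T_up :: "real ^ 'n \<Rightarrow> real ^ 'n" where
  "T_up s = (\<chi> i. max (s $ i) (T s $ i))"

lemma T_up_ge: "s \<le> T_up s" "T s \<le> T_up s"
  by (simp_all add: T_up_def less_eq_vec_def)

lemma T_up_mono: "0 \<le> s \<Longrightarrow> s \<le> t \<Longrightarrow> T_up s \<le> T_up t"
  using T_mono[of s t] by (auto simp: T_up_def less_eq_vec_def intro: max.coboundedI1 max.coboundedI2)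

lemma T_up_nonneg: "0 \<le> s \<Longrightarrow> 0 \<le> T_up s"
  using T_up_ge(1) order_trans by blast

lemma T_up_iterate_nonneg: "0 \<le> s \<Longrightarrow> 0 \<le> (T_up ^^ k) s"
  by (induction k) (simp_all add: T_up_nonneg)

lemma T_up_iterate_mono_exp:
  "k \<le> l \<Longrightarrow> (T_up ^^ k) s \<le> (T_up ^^ l) s"
proof (induction l)
  case (Suc l)
  show ?case
  proof (cases "k = Suc l")
    case False
    then have "(T_up ^^ k) s \<le> (T_up ^^ l) s" using Suc by simp
    also have "\<dots> \<le> (T_up ^^ Suc l) s" using T_up_ge(1) by simp
    finally show ?thesis .
  qed simp
qed simp

text \<open>If a component j' becomes large with \<open>s $ j\<close>, then every i with an edge
  \<open>E i j'\<close> does so one step later. By irreducibility all components are reached, and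
  the exponent is the largest number of steps.\<close>

lemma T_up_iterate_proper:
  "\<exists>k. \<forall>M. \<exists>C. \<forall>s\<ge>0. \<forall>i j. C \<le> s $ j \<longrightarrow> M \<le> (T_up ^^ k) s $ i"
proof -
  define good where "good j k i \<longleftrightarrow> (\<forall>M. \<exists>C. \<forall>s\<ge>0. C \<le> s $ j \<longrightarrow> M \<le> (T_up ^^ k) s $ i)" for j k i
  have good_mono: "good j l i" if "good j k i" "k \<le> l" for j k l i
    unfolding good_def
  proof
    fix M
    obtain C where C: "\<forall>s\<ge>0. C \<le> s $ j \<longrightarrow> M \<le> (T_up ^^ k) s $ i" using \<open>good j k i\<close> good_def by blast
    have "(T_up ^^ k) s $ i \<le> (T_up ^^ l) s $ i" for s
      using T_up_iterate_mono_exp[OF that(2), of s] by (simp add: less_eq_vec_def)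
    then have "\<forall>s\<ge>0. C \<le> s $ j \<longrightarrow> M \<le> (T_up ^^ l) s $ i" using C order_trans by fast
    then show "\<exists>C. \<forall>s\<ge>0. C \<le> s $ j \<longrightarrow> M \<le> (T_up ^^ l) s $ i" by blast
  qed
  have good_step: "good j (Suc k) i" if "good j k j'" "E i j'" for j k i j'
    unfolding good_def
  proof
    fix M
    obtain C' where C': "\<forall>s\<ge>0. C' \<le> s $ j' \<longrightarrow> M \<le> T s $ i" using E_proper[OF \<open>E i j'\<close>] by blast
    obtain C where C: "\<forall>s\<ge>0. C \<le> s $ j \<longrightarrow> C' \<le> (T_up ^^ k) s $ j'" using \<open>good j k j'\<close> good_def by blast
    have "M \<le> (T_up ^^ Suc k) s $ i" if "0 \<le> s" "C \<le> s $ j" for s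
    proof -
      have "M \<le> T ((T_up ^^ k) s) $ i" using C C' that T_up_iterate_nonneg by blast
      also have "\<dots> \<le> T_up ((T_up ^^ k) s) $ i" using T_up_ge(2) by (simp add: less_eq_vec_def)
      finally show ?thesis by simp
    qed
    then show "\<exists>C. \<forall>s\<ge>0. C \<le> s $ j \<longrightarrow> M \<le> (T_up ^^ Suc k) s $ i" by blast
  qed
  have "\<exists>k. good j k i" for i j
  proof -
    define G where "G = {i. \<exists>k. good j k i}"
    have "good j 0 j" unfolding good_def by auto
    then have "j \<in> G" by (auto simp: G_def)
    have "- G = {}"
    proof (rule ccontr)
      assume "- G \<noteq> {}"
      moreover have "- G \<noteq> UNIV" using \<open>j \<in> G\<close> by blast
      ultimately obtain i j' where ij: "i \<in> - G" "j' \<in> - (- G)" "E i j'" using E_irreducible[of "- G"] by blast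
      then obtain k where "good j k j'" by (auto simp: G_def)
      from good_step[OF this ij(3)] ij(1) show False by (auto simp: G_def)
    qed
    then show ?thesis unfolding G_def by blast
  qed
  then have "\<forall>i. \<forall>j. \<exists>k. good j k i" by blast
  then obtain k where "\<forall>i. \<forall>j. good j (k i j) i" unfolding choice_iff by (elim exE)
  then have k: "good j (k i j) i" for i j by blast
  define K where "K = Max (range (\<lambda>(i, j). k i j))"
  have kK: "k i j \<le> K" for i j unfolding K_def by (rule Max_ge) auto
  have good: "good j K i" for i j by (rule good_mono[OF k kK])
  have "\<exists>C. \<forall>s\<ge>0. \<forall>i j. C \<le> s $ j \<longrightarrow> M \<le> (T_up ^^ K) s $ i" for M
  proof -
    have "\<exists>C. \<forall>s\<ge>0. C \<le> s $ j \<longrightarrow> M \<le> (T_up ^^ K) s $ i" for i j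
      using good[of j i] unfolding good_def by blast
    then have "\<forall>i. \<forall>j. \<exists>C. \<forall>s\<ge>0. C \<le> s $ j \<longrightarrow> M \<le> (T_up ^^ K) s $ i" by blast
    then obtain C where "\<forall>i. \<forall>j. \<forall>s\<ge>0. C i j \<le> s $ j \<longrightarrow> M \<le> (T_up ^^ K) s $ i"
      unfolding choice_iff by (elim exE)
    then have C: "M \<le> (T_up ^^ K) s $ i" if "0 \<le> s" "C i j \<le> s $ j" for i j s using that by blast
    define D where "D = Max (range (\<lambda>(i, j). C i j))"
    have D: "C i j \<le> D" for i j unfolding D_def by (rule Max_ge) auto
    show ?thesis
    proof (intro exI[of _ D] allI impI)
      fix s :: "real ^ 'n" and i j assume s: "0 \<le> s" "D \<le> s $ j"
      show "M \<le> (T_up ^^ K) s $ i" by (rule C[OF s(1) order_trans[OF D s(2)]])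
    qed
  qed
  then show ?thesis by blast
qed

text \<open>
  A violation \<open>s \<le> (id + \<epsilon>) (T s)\<close> propagates upwards to a point \<open>s'\<close> all of whose components are
  comparable in size to \<open>s\<close>; at such points the margin of \<open>T\<close> is bounded below in terms of any single component.
\<close>

lemma robust_small_gain:
  "\<exists>\<epsilon>. pos_def_fun \<epsilon> \<and> (\<forall>r s. \<bar>\<epsilon> r - \<epsilon> s\<bar> \<le> \<bar>r - s\<bar>) \<and>
    (\<forall>s\<ge>0. s \<noteq> 0 \<longrightarrow> \<not> s \<le> (\<chi> i. T s $ i + \<epsilon> (T s $ i) / 2))"
proof -
  obtain K where K: "\<And>M. \<exists>C. \<forall>s\<ge>0. \<forall>i j. C \<le> s $ j \<longrightarrow> M \<le> (T_up ^^ K) s $ i"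
    using T_up_iterate_proper by blast
  \<comment> \<open>\<open>Q\<close> dominates the perturbed operator for every \<epsilon> with
    \<epsilon> r \<le> r. A bound on perturbed orbits that does not refer to \<epsilon> avoids a
    circle, since \<epsilon> is chosen from the set \<open>X\<close> below.\<close>
  define Q where "Q = (\<lambda>s. 2 *\<^sub>R T_up s)"
  have Q_mono: "Q s \<le> Q t" if "0 \<le> s" "s \<le> t" for s t
    using T_up_mono[OF that] by (simp add: Q_def less_eq_vec_def)
  have Q_nonneg: "0 \<le> Q s" if "0 \<le> s" for s
    using T_up_nonneg[OF that] by (simp add: Q_def vec_nonneg_iff)
  have Qk_nonneg: "0 \<le> (Q ^^ k) s" if "0 \<le> s" for s k by (induction k) (simp_all add: Q_nonneg that)
  have Qk_mono: "(Q ^^ k) s \<le> (Q ^^ k) t" if "0 \<le> s" "s \<le> t" for s t k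
    by (induction k) (simp_all add: that Q_mono Qk_nonneg)
  \<comment> \<open>The margin of T at s; positive off 0 by the small gain condition, and
    continuous.\<close>
  define g where "g s = Max (range (\<lambda>i. s $ i - T s $ i))" for s
  have g_ge: "s $ i - T s $ i \<le> g s" for s i unfolding g_def by (rule Max_ge) auto
  have g_att: "\<exists>i. g s = s $ i - T s $ i" for s
  proof -
    have "g s \<in> range (\<lambda>i. s $ i - T s $ i)" unfolding g_def by (rule Max_in) auto
    then show ?thesis by blast
  qed
  have g_pos: "0 < g s" if s: "0 \<le> s" "s \<noteq> 0" for s
  proof -
    obtain i where "\<not> s $ i \<le> T s $ i" using small_gain[OF s] by (auto simp: less_eq_vec_def)
    then show ?thesis using g_ge[of s i] by linarith
  qed
  have g_cont: "continuous_on S g" if "S \<subseteq> {s. 0 \<le> s}" for S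
    unfolding g_def
    by (rule continuous_on_Max) (auto intro!: continuous_intros continuous_on_subset[OF T_cont that])
  \<comment> \<open>The points w to which K perturbed steps from a violation s can lead, paired with
    an index of a positive component.\<close>
  define X where "X = {(w, i). 0 \<le> w \<and> 0 < w $ i \<and> (\<exists>s\<ge>0. (T_up ^^ K) s \<le> w \<and> w \<le> (Q ^^ K) s)}"
  have "\<exists>\<epsilon>. pos_def_fun \<epsilon> \<and> (\<forall>p\<in>X. \<epsilon> (fst p $ snd p) \<le> g (fst p) / 2) \<and> (\<forall>r\<ge>0. \<epsilon> r \<le> r) \<and> (\<forall>r s. \<bar>\<epsilon> r - \<epsilon> s\<bar> \<le> \<bar>r - s\<bar>)"
  proof (rule pos_def_lower_envelope)
    fix a b :: real assume ab: "0 < a" "a \<le> b"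
    \<comment> \<open>Since b + 1 exceeds b, the bound w $ i \<le> b forces every component of s
      below C, and then w lies in the compact box up to \<open>B\<close>.\<close>
    obtain C where C: "\<forall>s\<ge>0. \<forall>i j. C \<le> s $ j \<longrightarrow> b + 1 \<le> (T_up ^^ K) s $ i" using K by blast
    define c1 where "c1 = (\<chi> i::'n. max C 0)"
    define B where "B = (Q ^^ K) c1"
    have bound: "w \<le> B" if w: "(w, i) \<in> X" and wb: "w $ i \<le> b" for w i
    proof -
      obtain s where s: "0 \<le> s" "(T_up ^^ K) s \<le> w" "w \<le> (Q ^^ K) s" using w by (auto simp: X_def)
      have "s $ j < C" for j
      proof (rule ccontr)
        assume "\<not> s $ j < C"
        then have "C \<le> s $ j" by simp
        then have "b + 1 \<le> (T_up ^^ K) s $ i" using C s(1) by blast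
        also have "\<dots> \<le> w $ i" using s(2) by (simp add: less_eq_vec_def)
        finally show False using wb by simp
      qed
      then have "s \<le> c1" by (simp add: c1_def less_eq_vec_def less_imp_le max.coboundedI1)
      then show ?thesis using s Qk_mono[of s c1 K] unfolding B_def by (meson order_trans)
    qed
    define Z where "Z = (\<Union>i. {w. 0 \<le> w \<and> w \<le> B \<and> a \<le> w $ i})"
    have "compact Z" unfolding Z_def
    proof (intro compact_UN finite_UNIV)
      fix i
      have "closed {w. 0 \<le> w \<and> w \<le> B \<and> a \<le> w $ i}"
        unfolding less_eq_vec_def by (intro closed_Collect_conj closed_Collect_all closed_Collect_le continuous_intros)
      moreover have "bounded {w. 0 \<le> w \<and> w \<le> B \<and> a \<le> w $ i}"
        by (rule bounded_subset[OF bounded_cbox[of 0 B]]) (auto simp: mem_box_cart less_eq_vec_def)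
      ultimately show "compact {w. 0 \<le> w \<and> w \<le> B \<and> a \<le> w $ i}" by (simp add: compact_eq_bounded_closed)
    qed simp
    have Z0: "0 \<le> w" "w \<noteq> 0" if "w \<in> Z" for w using that ab(1) by (auto simp: Z_def)
    show "\<exists>\<kappa>>0. \<forall>p\<in>X. a \<le> fst p $ snd p \<and> fst p $ snd p \<le> b \<longrightarrow> \<kappa> \<le> g (fst p) / 2"
    proof (cases "Z = {}")
      case True
      have "\<not> (a \<le> w $ i \<and> w $ i \<le> b)" if "(w, i) \<in> X" for w i
        using bound[OF that] True that unfolding Z_def X_def by blast
      then show ?thesis by (intro exI[of _ 1]) auto
    next
      case False
      have "continuous_on Z g" by (rule g_cont) (use Z0 in auto)
      then obtain m where m: "m \<in> Z" "\<forall>w\<in>Z. g m \<le> g w"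
        using continuous_attains_inf[OF \<open>compact Z\<close> False] by blast
      have "w \<in> Z" if "(w, i) \<in> X" "a \<le> w $ i" "w $ i \<le> b" for w i
        using bound[OF that(1,3)] that unfolding Z_def X_def by blast
      then show ?thesis using m(2) g_pos[OF Z0[OF m(1)]] by (intro exI[of _ "g m / 2"]) force
    qed
  qed (auto simp: X_def)
  then obtain \<epsilon> where \<epsilon>: "pos_def_fun \<epsilon>" "\<And>w i. (w, i) \<in> X \<Longrightarrow> \<epsilon> (w $ i) \<le> g w / 2"
    "\<And>r. 0 \<le> r \<Longrightarrow> \<epsilon> r \<le> r" "\<And>r s. \<bar>\<epsilon> r - \<epsilon> s\<bar> \<le> \<bar>r - s\<bar>" by fastforce
  have \<epsilon>0: "0 \<le> \<epsilon> r" if "0 \<le> r" for r using \<epsilon>(1) that by (simp add: pos_def_fun_def)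
  define T' where "T' s = (\<chi> i. T s $ i + \<epsilon> (T s $ i) / 2)" for s
  have e_mono: "r + \<epsilon> r / 2 \<le> t + \<epsilon> t / 2" if "r \<le> t" for r t
    using \<epsilon>(4)[of r t] that by linarith
  have T'_mono: "T' s \<le> T' t" if "0 \<le> s" "s \<le> t" for s t
    using T_mono[OF that] e_mono by (simp add: T'_def less_eq_vec_def)
  have T'_ge: "T s \<le> T' s" if "0 \<le> s" for s
    using T_nonneg[OF that] \<epsilon>0 by (simp add: T'_def less_eq_vec_def)
  have T'_le: "T' s \<le> Q s" if "0 \<le> s" for s
  proof -
    have "T' s $ i \<le> Q s $ i" for i
    proof -
      have t: "0 \<le> T s $ i" using T_nonneg[OF that] by (simp add: vec_nonneg_iff)
      have "T s $ i \<le> T_up s $ i" using T_up_ge(2) by (simp add: less_eq_vec_def)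
      then show ?thesis using \<epsilon>(3)[OF t] t by (simp add: T'_def Q_def)
    qed
    then show ?thesis by (simp add: less_eq_vec_def)
  qed
  have "\<not> s \<le> T' s" if s: "0 \<le> s" "s \<noteq> 0" for s
  proof
    assume viol: "s \<le> T' s"
    have nn: "0 \<le> (T' ^^ k) s" and inc: "(T' ^^ k) s \<le> (T' ^^ Suc k) s" for k
    proof (induction k)
      case 0
      show "0 \<le> (T' ^^ 0) s" "(T' ^^ 0) s \<le> (T' ^^ Suc 0) s" using s viol by simp_all
    next
      case (Suc k)
      show "0 \<le> (T' ^^ Suc k) s" using Suc by (rule order_trans)
      show "(T' ^^ Suc k) s \<le> (T' ^^ Suc (Suc k)) s" using T'_mono[OF Suc] by simp
    qed
    have lower: "(T_up ^^ k) s \<le> (T' ^^ k) s" for k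
    proof (induction k)
      case (Suc k)
      have "T_up ((T_up ^^ k) s) \<le> T_up ((T' ^^ k) s)" by (rule T_up_mono[OF T_up_iterate_nonneg[OF s(1)] Suc])
      also have "\<dots> \<le> (T' ^^ Suc k) s"
        using inc[of k] T'_ge[OF nn[of k]] by (simp add: T_up_def less_eq_vec_def)
      finally show ?case by simp
    qed simp
    have upper: "(T' ^^ k) s \<le> (Q ^^ k) s" for k
    proof (induction k)
      case (Suc k)
      have "T' ((T' ^^ k) s) \<le> Q ((T' ^^ k) s)" by (rule T'_le[OF nn])
      also have "\<dots> \<le> Q ((Q ^^ k) s)" by (rule Q_mono[OF nn Suc])
      finally show ?case by simp
    qed simp
    \<comment> \<open>w still violates the perturbed condition. At the index of the largest gap g w,
      the value \<epsilon>(T w $ i) is at most \<epsilon>(w $ i) + g w \<le> 3/2 g w because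
      \<epsilon> is 1-Lipschitz; half of that is less than the gap, a contradiction.\<close>
    define w where "w = (T' ^^ K) s"
    have w0: "0 \<le> w" unfolding w_def by (rule nn)
    have "s \<le> w" using T_up_iterate_mono_exp[of 0 K s] lower[of K] by (simp add: w_def)
    then have wn: "w \<noteq> 0" using s by (metis order_antisym)
    obtain i where i: "g w = w $ i - T w $ i" using g_att by blast
    have gp: "0 < g w" by (rule g_pos[OF w0 wn])
    have Tw: "0 \<le> T w $ i" using T_nonneg[OF w0] by (simp add: vec_nonneg_iff)
    have "(w, i) \<in> X"
      using w0 gp i Tw s(1) lower[of K] upper[of K] by (auto simp: X_def w_def)
    from \<epsilon>(2)[OF this] have "\<epsilon> (w $ i) \<le> g w / 2" .
    moreover have "w $ i \<le> T w $ i + \<epsilon> (T w $ i) / 2"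
      using inc[of K] by (simp add: w_def[symmetric] T'_def less_eq_vec_def)
    ultimately show False using \<epsilon>(4)[of "T w $ i" "w $ i"] gp i by linarith
  qed
  then show ?thesis using \<epsilon>(1,4) unfolding T'_def by blast
qed

end

text \<open>The shifts are normalised by the threshold 1 for the component sum: index 0 carries the
  last value of each orbit at or above 1, which keeps the limit away from 0. The properness
  assumption bounds the entries at later indices uniformly in the starting points.\<close>

lemma (in monotone_operator) bi_infinite_orbit:
  assumes proper: "\<And>B. \<exists>C. \<forall>s\<ge>0. (\<Sum>i\<in>UNIV. T s $ i) \<le> B \<longrightarrow> (\<Sum>i\<in>UNIV. s $ i) \<le> C"
  shows "\<exists>q :: int \<Rightarrow> real ^ 'n. (\<forall>z. 0 \<le> q z \<and> q z \<le> q (z + 1) \<and> q z = T (q (z + 1))) \<and> q 0 \<noteq> 0"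
proof -
  define N where "N s = (\<Sum>i\<in>UNIV. s $ i)" for s :: "real ^ 'n"
  have N_tendsto: "(\<lambda>n. N (X n)) \<longlonglongrightarrow> N l" if "X \<longlonglongrightarrow> l" for X l
    unfolding N_def by (intro tendsto_sum tendsto_vec_nth that)
  have norm_le_N: "norm s \<le> N s" if "0 \<le> s" for s
    using norm_le_l1_cart[of s] that by (simp add: N_def vec_nonneg_iff)
  have "\<exists>b\<ge>0. N b = real k + 1 \<and> T b \<le> b" for k :: nat
    using decay_point_exists[of "real k + 1"] by (simp add: N_def)
  then obtain b where b: "\<And>k. 0 \<le> b k" "\<And>k. N (b k) = real k + 1" "\<And>k. T (b k) \<le> b k" by metis
  have ex: "\<exists>m. N ((T ^^ m) (b k)) < 1" for k
  proof -
    have "(\<lambda>m. N ((T ^^ m) (b k))) \<longlonglongrightarrow> N 0" by (rule N_tendsto[OF orbit_tendsto_zero[OF b(1,3)]])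
    moreover have "N 0 < 1" by (simp add: N_def)
    ultimately have "\<forall>\<^sub>F m in sequentially. N ((T ^^ m) (b k)) < 1" by (rule order_tendstoD(2))
    then show ?thesis unfolding eventually_sequentially by blast
  qed
  define m where "m k = (LEAST m. N ((T ^^ m) (b k)) < 1)" for k
  have m1: "N ((T ^^ m k) (b k)) < 1" for k unfolding m_def by (rule LeastI_ex[OF ex])
  have m2: "1 \<le> N ((T ^^ l) (b k))" if "l < m k" for k l
    using not_less_Least[of l "\<lambda>m. N ((T ^^ m) (b k)) < 1"] that unfolding m_def by linarith
  have m0: "0 < m k" for k using m1[of k] b(2)[of k] by (cases "m k") auto
  \<comment> \<open>The orbit is run through backwards as z grows. Beyond the start of the orbit
    \<open>nat\<close> cuts off at 0, and the value is the constant \<open>b k\<close>.\<close>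
  define a where "a k z = (T ^^ nat (int (m k) - 1 - z)) (b k)" for k and z :: int
  have a_nn: "0 \<le> a k z" for k z unfolding a_def by (rule iterate_nonneg[OF b(1)])
  have a_step: "a k z = T (a k (z + 1))" if "z < int (m k) - 1" for k z
  proof -
    have "nat (int (m k) - 1 - z) = Suc (nat (int (m k) - 1 - (z + 1)))" using that by linarith
    then show ?thesis by (simp add: a_def)
  qed
  have a_top: "a k z = b k" if "int (m k) - 1 \<le> z" for k z using that by (simp add: a_def)
  have a_mono: "a k z \<le> a k (z + 1)" for k z
  proof (cases "z < int (m k) - 1")
    case True
    then have "nat (int (m k) - 1 - z) = Suc (nat (int (m k) - 1 - (z + 1)))" by linarith
    then show ?thesis unfolding a_def using orbit_decreasing[OF b(1,3)] by metis
  qed (simp add: a_top)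
  have N_mono: "N s \<le> N t" if "s \<le> t" for s t
    unfolding N_def using that by (intro sum_mono) (simp add: less_eq_vec_def)
  have a_le: "a k (z - int n) \<le> a k z" for k z n
  proof (induction n)
    case (Suc n)
    have "a k (z - int (Suc n)) \<le> a k (z - int n)" using a_mono[of k "z - int (Suc n)"] by (simp add: algebra_simps)
    then show ?case using Suc by (rule order_trans)
  qed simp
  have a0: "1 \<le> N (a k 0)" for k using m2[of "m k - 1" k] m0[of k] by (simp add: a_def nat_diff_distrib)
  have am1: "N (a k (- 1)) < 1" for k using m1[of k] by (simp add: a_def)
  \<comment> \<open>Induction upwards from index -1, where the sum is below 1; each further entry is
    a preimage under T of the previous one, which \<open>proper\<close> bounds, or repeats
    it.\<close>
  have "\<exists>B. \<forall>k. N (a k (int n - 1)) \<le> B" for n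
  proof (induction n)
    case 0 show ?case using am1 by (intro exI[of _ 1]) (auto intro: less_imp_le)
  next
    case (Suc n)
    then obtain B where B: "\<And>k. N (a k (int n - 1)) \<le> B" by blast
    obtain C where C: "\<forall>s\<ge>0. N (T s) \<le> B \<longrightarrow> N s \<le> C" using proper[of B] unfolding N_def by blast
    have "N (a k (int n)) \<le> max B C" for k
    proof (cases "int n - 1 < int (m k) - 1")
      case True
      then have "N (T (a k (int n))) \<le> B" using a_step[of "int n - 1" k] B[of k] by simp
      then show ?thesis using C a_nn by (simp add: le_max_iff_disj)
    next
      case False
      then have "a k (int n) = a k (int n - 1)" using a_top[of k "int n"] a_top[of k "int n - 1"] by simp
      then show ?thesis using B[of k] by simp
    qed
    then show ?case by (intro exI[of _ "max B C"]) simp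
  qed
  then have "\<exists>B. \<forall>k. N (a k z) \<le> B" for z
  proof (cases "0 \<le> z")
    case True
    obtain B where "\<forall>k. N (a k (int (nat (z + 1)) - 1)) \<le> B" using \<open>\<And>n. \<exists>B. \<forall>k. N (a k (int n - 1)) \<le> B\<close> by blast
    then show ?thesis using True by auto
  next
    case False
    have "N (a k z) \<le> 1" for k
    proof -
      have "a k z \<le> a k (- 1)" using a_le[of k "- 1" "nat (- 1 - z)"] False by simp
      then show ?thesis using N_mono am1[of k] by (meson less_imp_le order_trans)
    qed
    then show ?thesis by blast
  qed
  then obtain B where B: "\<And>z k. N (a k z) \<le> B z" by metis
  have B0: "0 \<le> B z" for z
    using B[of 0 z] norm_le_N[OF a_nn[of 0 z]] norm_ge_zero[of "a 0 z"] by linarith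
  \<comment> \<open>Countably many indices allow a diagonal subsequence; the scaling by 1 + B z
    produces the uniform bound it asks for.\<close>
  have "\<exists>\<kappa>. strict_mono (\<kappa> :: nat \<Rightarrow> nat) \<and> (\<forall>z\<in>(UNIV :: int set). \<exists>l. (\<lambda>n. (1 / (1 + B z)) *\<^sub>R a (\<kappa> n) z) \<longlonglongrightarrow> l)"
  proof -
    have "norm ((1 / (1 + B z)) *\<^sub>R a k z) \<le> 1" for k z
    proof -
      have "norm (a k z) \<le> 1 + B z" using norm_le_N[OF a_nn[of k z]] B[of k z] by linarith
      then show ?thesis using B0[of z] by (simp add: divide_le_eq)
    qed
    then show ?thesis
      using function_convergent_subsequence[of "UNIV :: int set" "\<lambda>k z. (1 / (1 + B z)) *\<^sub>R a k z" 1] by (metis countableI_type)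
  qed
  then obtain \<kappa> where \<kappa>: "strict_mono (\<kappa> :: nat \<Rightarrow> nat)"
    and \<kappa>l: "\<And>z. \<exists>l. (\<lambda>n. (1 / (1 + B z)) *\<^sub>R a (\<kappa> n) z) \<longlonglongrightarrow> l" by blast
  have "\<exists>l. (\<lambda>n. a (\<kappa> n) z) \<longlonglongrightarrow> l" for z
  proof -
    obtain l where l: "(\<lambda>n. (1 / (1 + B z)) *\<^sub>R a (\<kappa> n) z) \<longlonglongrightarrow> l" using \<kappa>l by blast
    have "1 + B z \<noteq> 0" using B0[of z] by linarith
    with tendsto_scaleR[OF tendsto_const[of "1 + B z"] l] show ?thesis by auto
  qed
  then obtain q where q: "\<And>z. (\<lambda>n. a (\<kappa> n) z) \<longlonglongrightarrow> q z" by metis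
  have q_nn: "0 \<le> q z" for z by (rule tendsto_vec_le[OF tendsto_const q a_nn])
  have q_mono: "q z \<le> q (z + 1)" for z by (rule tendsto_vec_le[OF q q a_mono])
  have q_step: "q z = T (q (z + 1))" for z
  proof (rule LIMSEQ_unique[OF q])
    have "(\<lambda>n. T (a (\<kappa> n) (z + 1))) \<longlonglongrightarrow> T (q (z + 1))" by (rule T_tendsto[OF q a_nn])
    moreover have "\<forall>\<^sub>F n in sequentially. T (a (\<kappa> n) (z + 1)) = a (\<kappa> n) z"
    proof -
      \<comment> \<open>The component sum of \<open>b k\<close> is k + 1, which exceeds the bound at
        z for large k. So z eventually lies inside the orbit, where the recursion holds.\<close>
      obtain n0 :: nat where n0: "B z < real n0" using reals_Archimedean2 by blast
      have "z < int (m (\<kappa> n)) - 1" if "n0 \<le> n" for n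
      proof (rule ccontr)
        assume "\<not> ?thesis"
        then have "N (a (\<kappa> n) z) = real (\<kappa> n) + 1" using a_top b(2) by simp
        moreover have "n \<le> \<kappa> n" by (rule strict_mono_imp_increasing[OF \<kappa>])
        ultimately show False using B[of "\<kappa> n" z] n0 that by linarith
      qed
      then show ?thesis unfolding eventually_sequentially using a_step by (intro exI[of _ n0]) auto
    qed
    ultimately show "(\<lambda>n. a (\<kappa> n) z) \<longlonglongrightarrow> T (q (z + 1))" by (rule Lim_transform_eventually)
  qed
  have "1 \<le> N (q 0)" by (rule LIMSEQ_le_const[OF N_tendsto[OF q]]) (use a0 in blast)
  then have "q 0 \<noteq> 0" by (auto simp: N_def)
  then show ?thesis using q_nn q_mono q_step by blast
qed

section \<open>A strictly decaying sequence of knots\<close>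

context irreducible_operator
begin

text \<open>With q an orbit of T o (id + \<epsilon>/2), put p z = q z + c z \<epsilon>(q z)/2 for
  weights c increasing strictly inside (0,1). Then p (z+1) lies below (id + \<epsilon>/2)(q (z+1)),
  so T maps it below q z, which is strictly below p z. Moreover p increases strictly even where q
  does so only weakly.\<close>

lemma strict_decay_sequence:
  "\<exists>p :: int \<Rightarrow> real ^ 'n. (\<forall>z i. 0 < p z $ i \<and> p z $ i < p (z + 1) $ i \<and> T (p (z + 1)) $ i < p z $ i) \<and>
     (\<forall>i. (\<lambda>n. p (- int n) $ i) \<longlonglongrightarrow> 0) \<and> (\<forall>i M. \<exists>z. M \<le> p z $ i)"
proof -
  obtain \<epsilon> where \<epsilon>: "pos_def_fun \<epsilon>" "\<And>r s. \<bar>\<epsilon> r - \<epsilon> s\<bar> \<le> \<bar>r - s\<bar>"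
    and robust: "\<And>s. 0 \<le> s \<Longrightarrow> s \<noteq> 0 \<Longrightarrow> \<not> s \<le> (\<chi> i. T s $ i + \<epsilon> (T s $ i) / 2)"
    using robust_small_gain by blast
  have \<epsilon>0: "0 \<le> \<epsilon> r" if "0 \<le> r" for r using \<epsilon>(1) that by (simp add: pos_def_fun_def)
  have \<epsilon>pos: "0 < \<epsilon> r" if "0 < r" for r using \<epsilon>(1) that unfolding pos_def_fun_def by (metis less_eq_real_def)
  define F where "F c s = (\<chi> i. s $ i + c * \<epsilon> (s $ i) / 2)" for c :: real and s :: "real ^ 'n"
  have F_mono: "F c s \<le> F c t" if c: "0 \<le> c" "c \<le> 1" and st: "s \<le> t" for c s t
  proof -
    have "s $ i + c * \<epsilon> (s $ i) / 2 \<le> t $ i + c * \<epsilon> (t $ i) / 2" for i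
    proof -
      have le: "s $ i \<le> t $ i" using st by (simp add: less_eq_vec_def)
      have "c * (\<epsilon> (s $ i) - \<epsilon> (t $ i)) \<le> c * (t $ i - s $ i)"
        using \<epsilon>(2)[of "s $ i" "t $ i"] c(1) le by (intro mult_left_mono) auto
      also have "\<dots> \<le> 1 * (t $ i - s $ i)" using c(2) le by (intro mult_right_mono) auto
      finally show ?thesis using le by (simp add: right_diff_distrib)
    qed
    then show ?thesis by (simp add: F_def less_eq_vec_def)
  qed
  have F_ge: "s \<le> F c s" if "0 \<le> c" "0 \<le> s" for c s
    using that \<epsilon>0 by (simp add: F_def less_eq_vec_def)
  have F_nn: "0 \<le> F 1 s" if "0 \<le> s" for s using F_ge[of 1 s] that order_trans by fastforce
  have F0: "F 1 0 = 0" using \<epsilon>(1) by (simp add: F_def vec_eq_iff pos_def_fun_def)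
  interpret R: monotone_operator "\<lambda>s. T (F 1 s)"
  proof
    show "T (F 1 s) \<le> T (F 1 t)" if "0 \<le> s" "s \<le> t" for s t
      by (rule T_mono[OF F_nn[OF that(1)] F_mono]) (use that in auto)
    have "continuous_on {s. 0 \<le> s} (F 1)"
    proof -
      have e: "continuous_on {0..} \<epsilon>" using \<epsilon>(1) by (simp add: pos_def_fun_def)
      show ?thesis unfolding F_def
        by (intro continuous_on_vec_lambda continuous_on_add continuous_on_divide continuous_on_mult continuous_on_const
            continuous_on_component continuous_on_id continuous_on_compose2[OF e]) (auto simp: vec_nonneg_iff)
    qed
    then show "continuous_on {s. 0 \<le> s} (\<lambda>s. T (F 1 s))"
      by (rule continuous_on_compose2[OF T_cont]) (use F_nn in auto)
    show "T (F 1 0) = 0" using F0 T_0 by simp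
    fix s :: "real ^ 'n" assume s: "0 \<le> s" "s \<noteq> 0"
    \<comment> \<open>The robust condition concerns a perturbation after T, the orbit one before T.
      Applying the monotone map \<open>F 1\<close> to a violation of the latter gives a violation of
      the former at \<open>F 1 s\<close>.\<close>
    show "\<not> s \<le> T (F 1 s)"
    proof
      assume "s \<le> T (F 1 s)"
      then have "F 1 s \<le> F 1 (T (F 1 s))" by (intro F_mono) auto
      moreover have "F 1 s \<noteq> 0" using F_ge[of 1 s] s by (metis order_antisym zero_le_one)
      ultimately show False using robust[OF F_nn[OF s(1)]] by (simp add: F_def)
    qed
  qed
  \<comment> \<open>Every column has an edge, through which a large component of s makes some
    component of T s large; so a bound on the sum of T s bounds each component of s.\<close>
  have proper: "\<exists>C. \<forall>s\<ge>0. (\<Sum>i\<in>UNIV. T (F 1 s) $ i) \<le> B \<longrightarrow> (\<Sum>i\<in>UNIV. s $ i) \<le> C" for B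
  proof -
    have "\<exists>C. \<forall>s\<ge>0. C \<le> s $ j \<longrightarrow> B < (\<Sum>i\<in>UNIV. T s $ i)" for j
    proof -
      obtain i where i: "E i j" using E_column by blast
      obtain C where C: "\<forall>s\<ge>0. C \<le> s $ j \<longrightarrow> B + 1 \<le> T s $ i" using E_proper[OF i] by blast
      have "B < (\<Sum>i\<in>UNIV. T s $ i)" if "0 \<le> s" "C \<le> s $ j" for s
      proof -
        have "T s $ i \<le> (\<Sum>i\<in>UNIV. T s $ i)"
          using T_nonneg[OF that(1)] by (intro member_le_sum) (auto simp: vec_nonneg_iff)
        then show ?thesis using C that by force
      qed
      then show ?thesis by blast
    qed
    then obtain C where C: "\<And>j s. 0 \<le> s \<Longrightarrow> C j \<le> s $ j \<Longrightarrow> B < (\<Sum>i\<in>UNIV. T s $ i)" by metis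
    have "(\<Sum>i\<in>UNIV. s $ i) \<le> (\<Sum>i\<in>UNIV. C i)" if s: "0 \<le> s" "(\<Sum>i\<in>UNIV. T (F 1 s) $ i) \<le> B" for s
    proof (rule sum_mono)
      fix j
      have "s $ j \<le> F 1 s $ j" using F_ge[of 1 s] s(1) by (simp add: less_eq_vec_def)
      moreover have "F 1 s $ j < C j" using C[OF F_nn[OF s(1)], of j] s(2) by force
      ultimately show "s $ j \<le> C j" by linarith
    qed
    then show ?thesis by blast
  qed
  obtain q where q: "\<And>z. 0 \<le> q z" "\<And>z. q z \<le> q (z + 1)" "\<And>z. q z = T (F 1 (q (z + 1)))" "q (0::int) \<noteq> 0"
    using R.bi_infinite_orbit[OF proper] by blast
  have q_le: "q z \<le> q (z + int n)" for z n
  proof (induction n)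
    case (Suc n)
    then show ?case using q(2)[of "z + int n"] by (simp add: add.assoc add.commute[of 1])
  qed simp
  have edge: "0 < q z $ i" if "E i j" "0 < q (z + 1) $ j" for i j z
  proof -
    have "q (z + 1) $ j \<le> F 1 (q (z + 1)) $ j" using F_ge[of 1] q(1) by (simp add: less_eq_vec_def)
    then show ?thesis using E_pos[OF that(1) F_nn[OF q(1)], of "z + 1"] that(2) q(3)[of z] by simp
  qed
  have q_ne0: "q z \<noteq> 0" for z
  proof (cases "0 \<le> z")
    case True
    then have "q 0 \<le> q z" using q_le[of 0 "nat z"] by simp
    then show ?thesis using q(1)[of 0] q(4) by (metis order_antisym)
  next
    case False
    have "q (- int n) \<noteq> 0" for n
    proof (induction n)
      case 0 show ?case using q(4) by simp
    next
      case (Suc n)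
      then obtain j where "q (- int n) $ j \<noteq> 0" by (auto simp: vec_eq_iff)
      then have "0 < q (- int n) $ j" using q(1)[of "- int n"] by (simp add: vec_nonneg_iff less_le)
      moreover obtain i where "E i j" using E_column by blast
      ultimately have "0 < q (- int (Suc n)) $ i" using edge[of i j "- int (Suc n)"] by simp
      then show ?case by auto
    qed
    from this[of "nat (- z)"] show ?thesis using False by simp
  qed
  \<comment> \<open>By irreducibility a zero component would have an edge from a positive one, and
    positivity passes along edges from q (z+1) to q z.\<close>
  have q_pos: "0 < q z $ i" for z i
  proof (rule ccontr)
    assume a: "\<not> 0 < q z $ i"
    define Z where "Z = {i. q z $ i = 0}"
    have "q z $ i = 0" using a q(1)[of z] by (simp add: vec_nonneg_iff order_antisym not_less)
    then have "i \<in> Z" by (simp add: Z_def)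
    moreover have "Z \<noteq> UNIV" using q_ne0[of z] by (auto simp: Z_def vec_eq_iff)
    ultimately obtain k j where kj: "k \<in> Z" "j \<in> - Z" "E k j" using E_irreducible by blast
    have "0 < q z $ j" using kj(2) q(1)[of z] by (simp add: Z_def vec_nonneg_iff less_le)
    then have "0 < q (z + 1) $ j" using q(2)[of z] unfolding less_eq_vec_def by (meson less_le_trans)
    from edge[OF kj(3) this] kj(1) show False by (simp add: Z_def)
  qed
  \<comment> \<open>If all components were bounded, the orbit would converge to a nonzero fixed
    point. If only some were, an edge from an unbounded to a bounded one would make the latter
    unbounded.\<close>
  have q_unbounded: "\<exists>z. M \<le> q z $ i" for i M
  proof -
    define I where "I = {i. \<exists>M. \<forall>z. q z $ i < M}"
    have "I \<noteq> UNIV"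
    proof
      assume "I = UNIV"
      then have "\<forall>i. \<exists>M. \<forall>z. q z $ i < M" by (auto simp: I_def)
      then obtain M where M: "\<And>i z. q z $ i < M i" by metis
      have inc: "q (int n) \<le> q (int (Suc n))" for n using q(2)[of "int n"] by (simp add: add.commute)
      have "\<exists>l. (\<lambda>n. q (int n)) \<longlonglongrightarrow> l"
      proof (rule incseq_vec_convergent[where B = M])
        show "q (int n) \<le> q (int (Suc n))" for n by (rule inc)
        show "q (int n) $ i \<le> M i" for n i by (rule less_imp_le[OF M])
      qed
      then obtain l where l: "(\<lambda>n. q (int n)) \<longlonglongrightarrow> l" by blast
      have "(\<lambda>n. q (int n + 1)) \<longlonglongrightarrow> l" using LIMSEQ_Suc[OF l] by (simp add: add.commute)
      from R.T_tendsto[OF this q(1)] have "(\<lambda>n. q (int n)) \<longlonglongrightarrow> T (F 1 l)" by (simp flip: q(3))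
      then have "T (F 1 l) = l" using l LIMSEQ_unique by blast
      moreover have "q 0 \<le> l" by (rule tendsto_vec_le[OF tendsto_const l]) (use q_le[of 0] in simp)
      ultimately show False using R.fixed_point_zero[of l] q(1)[of 0] q(4) by (metis order_antisym order_trans)
    qed
    have "I = {}"
    proof (rule ccontr)
      assume "I \<noteq> {}"
      then obtain k j where kj: "k \<in> I" "j \<in> - I" "E k j" using E_irreducible \<open>I \<noteq> UNIV\<close> by blast
      obtain M where M: "\<And>z. q z $ k < M" using kj(1) by (auto simp: I_def)
      obtain C where C: "\<forall>s\<ge>0. C \<le> s $ j \<longrightarrow> M \<le> T s $ k" using E_proper[OF kj(3)] by blast
      obtain z where z: "C \<le> q z $ j" using kj(2) by (auto simp: I_def not_less)
      have "q z $ j \<le> F 1 (q z) $ j" using F_ge[of 1] q(1) by (simp add: less_eq_vec_def)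
      then have "M \<le> T (F 1 (q z)) $ k" using C F_nn[OF q(1)] z by force
      then show False using M[of "z - 1"] q(3)[of "z - 1"] by simp
    qed
    then have "i \<notin> I" by simp
    then show ?thesis by (auto simp: I_def not_less)
  qed
  have q_zero: "(\<lambda>n. q (- int n)) \<longlonglongrightarrow> 0"
  proof -
    have dec: "q (- int (Suc n)) \<le> q (- int n)" for n using q(2)[of "- int (Suc n)"] by simp
    obtain l where l: "(\<lambda>n. q (- int n)) \<longlonglongrightarrow> l"
      using decseq_vec_convergent[of "\<lambda>n. q (- int n)"] dec q(1) by blast
    from R.T_tendsto[OF this q(1)] have "(\<lambda>n. T (F 1 (q (- int n)))) \<longlonglongrightarrow> T (F 1 l)" .
    moreover have "T (F 1 (q (- int n))) = q (- int (Suc n))" for n using q(3)[of "- int (Suc n)"] by simp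
    ultimately have "(\<lambda>n. q (- int (Suc n))) \<longlonglongrightarrow> T (F 1 l)" by simp
    then have "T (F 1 l) = l" using LIMSEQ_Suc[OF l] LIMSEQ_unique by blast
    moreover have "0 \<le> l" by (rule tendsto_vec_le[OF tendsto_const l q(1)])
    ultimately show ?thesis using R.fixed_point_zero l by blast
  qed
  \<comment> \<open>A strictly increasing map from the integers into (0,1), with the two branches
    joined by 1/3 at -1 and 1/2 at 0.\<close>
  define c where "c z = (if 0 \<le> z then 1 - 1 / (real_of_int z + 2) else 1 / (2 - real_of_int z))" for z :: int
  have c01: "0 < c z" "c z < 1" for z by (auto simp: c_def field_simps)
  have c_less: "c z < c (z + 1)" for z
  proof (cases "0 \<le> z")
    case True
    then show ?thesis by (simp add: c_def frac_less2)
  next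
    case False
    then consider "z = - 1" | "z < - 1" by linarith
    then show ?thesis
    proof cases
      case 2
      then show ?thesis using False by (simp add: c_def frac_less2)
    qed (simp add: c_def)
  qed
  define p where "p z = F (c z) (q z)" for z
  have p_gt: "q z $ i < p z $ i" for z i
    using c01(1)[of z] \<epsilon>pos[OF q_pos[of z i]] by (simp add: p_def F_def)
  have p_less: "p z $ i < p (z + 1) $ i" for z i
  proof -
    have "p z $ i \<le> F (c z) (q (z + 1)) $ i"
      using F_mono[of "c z", OF _ _ q(2)[of z]] c01[of z] by (simp add: p_def less_eq_vec_def less_imp_le)
    also have "\<dots> < p (z + 1) $ i"
      using c_less[of z] \<epsilon>pos[OF q_pos[of "z + 1" i]] by (simp add: p_def F_def)
    finally show ?thesis .
  qed
  have p_decay: "T (p (z + 1)) $ i < p z $ i" for z i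
  proof -
    have "p (z + 1) \<le> F 1 (q (z + 1))"
      using c01(2)[of "z + 1"] \<epsilon>0 q(1)[of "z + 1"]
      by (simp add: p_def F_def less_eq_vec_def mult_left_le_one_le vec_nonneg_iff c01 less_imp_le)
    moreover have "0 \<le> p (z + 1)" using p_gt q_pos by (simp add: vec_nonneg_iff) (meson less_imp_le less_trans)
    ultimately have "T (p (z + 1)) \<le> T (F 1 (q (z + 1)))" by (intro T_mono)
    then have "T (p (z + 1)) $ i \<le> q z $ i" using q(3)[of z] by (simp add: less_eq_vec_def)
    then show ?thesis using p_gt[of z i] by linarith
  qed
  have \<epsilon>00: "\<epsilon> 0 = 0" using \<epsilon>(1) by (simp add: pos_def_fun_def)
  have p_pos: "0 < p z $ i" for z i using p_gt[of z i] q_pos[of z i] by linarith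
  have p_zero: "(\<lambda>n. p (- int n) $ i) \<longlonglongrightarrow> 0" for i
  proof -
    have up: "p z $ i \<le> 2 * q z $ i" for z
    proof -
      have "\<epsilon> (q z $ i) \<le> q z $ i"
        using \<epsilon>(2)[of "q z $ i" 0] \<epsilon>00 q_pos[of z i] by linarith
      moreover have "c z * \<epsilon> (q z $ i) \<le> 1 * \<epsilon> (q z $ i)"
        using c01(2)[of z] \<epsilon>pos[OF q_pos[of z i]] by (intro mult_right_mono) auto
      ultimately show ?thesis using q_pos[of z i] by (simp add: p_def F_def)
    qed
    have "(\<lambda>n. 2 * q (- int n) $ i) \<longlonglongrightarrow> 2 * (0 :: real ^ 'n) $ i"
      by (intro tendsto_mult tendsto_const tendsto_vec_nth q_zero)
    then have l0: "(\<lambda>n. 2 * q (- int n) $ i) \<longlonglongrightarrow> 0" by simp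
    show ?thesis
    proof (rule tendsto_sandwich[OF _ _ tendsto_const l0])
      show "\<forall>\<^sub>F n in sequentially. 0 \<le> p (- int n) $ i"
        by (intro always_eventually allI less_imp_le p_pos)
      show "\<forall>\<^sub>F n in sequentially. p (- int n) $ i \<le> 2 * q (- int n) $ i"
        by (intro always_eventually allI up)
    qed
  qed
  have p_unb: "\<exists>z. M \<le> p z $ i" for i M
  proof -
    obtain z where "M \<le> q z $ i" using q_unbounded by blast
    then show ?thesis using p_gt[of z i] by (intro exI[of _ z]) simp
  qed
  show ?thesis using p_pos p_less p_decay p_zero p_unb by (intro exI[of _ p]) blast
qed

end

section \<open>Piecewise linear interpolation\<close>

definition interp :: "(int \<Rightarrow> real) \<Rightarrow> real \<Rightarrow> real" where
  "interp p t = p \<lfloor>t\<rfloor> + frac t * (p (\<lfloor>t\<rfloor> + 1) - p \<lfloor>t\<rfloor>)"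

lemma interp_of_int [simp]: "interp p (of_int z) = p z"
  by (simp add: interp_def)

lemma interp_bounds:
  assumes "p \<lfloor>t\<rfloor> \<le> p (\<lfloor>t\<rfloor> + 1)" shows "p \<lfloor>t\<rfloor> \<le> interp p t" "interp p t \<le> p (\<lfloor>t\<rfloor> + 1)"
proof -
  show "p \<lfloor>t\<rfloor> \<le> interp p t" using assms frac_ge_0[of t] by (simp add: interp_def)
  have "frac t * (p (\<lfloor>t\<rfloor> + 1) - p \<lfloor>t\<rfloor>) \<le> 1 * (p (\<lfloor>t\<rfloor> + 1) - p \<lfloor>t\<rfloor>)"
    using assms frac_lt_1[of t] by (intro mult_right_mono) auto
  then show "interp p t \<le> p (\<lfloor>t\<rfloor> + 1)" by (simp add: interp_def)
qed

text \<open>Monotonicity of the knots is asked for on a finite range only, because the lemma is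
  applied after subtracting a linear function whose slope is adapted to that range.\<close>

lemma interp_mono:
  assumes p: "\<And>z. m \<le> z \<Longrightarrow> z < n \<Longrightarrow> p z \<le> p (z + 1)"
    and st: "of_int m \<le> s" "s \<le> t" "t \<le> of_int n"
  shows "interp p s \<le> interp p t"
proof -
  have chain: "p a \<le> p (a + int k)" if "m \<le> a" "a + int k \<le> n" for a k
    using that
  proof (induction k)
    case (Suc k)
    then have "p a \<le> p (a + int k)" by simp
    also have "\<dots> \<le> p (a + int k + 1)" using Suc.prems by (intro p) auto
    finally show ?case by (simp add: algebra_simps)
  qed simp
  have fl: "m \<le> \<lfloor>s\<rfloor>" "\<lfloor>s\<rfloor> \<le> \<lfloor>t\<rfloor>" using st(1) floor_mono[OF st(2)] by (simp_all only: le_floor_iff)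
  \<comment> \<open>At t = n the formula involves the uncontrolled knot p (n+1), but with factor
    frac t = 0.\<close>
  have tn: "\<lfloor>t\<rfloor> < n \<or> t = of_int n" using st(3) by linarith
  have tl: "p \<lfloor>t\<rfloor> \<le> interp p t"
    using tn interp_bounds(1)[of p t] p[of "\<lfloor>t\<rfloor>"] fl by auto
  show ?thesis
  proof (cases "\<lfloor>s\<rfloor> = \<lfloor>t\<rfloor>")
    case True
    show ?thesis
    proof (cases "\<lfloor>t\<rfloor> < n")
      case False
      then have t: "t = of_int n" using tn by blast
      then have "\<lfloor>s\<rfloor> = n" using True by simp
      then have "of_int n \<le> s" using of_int_floor_le[of s] by simp
      then have "s = t" using t st(2) by simp
      then show ?thesis by simp
    next
      case False': True
      have "frac s \<le> frac t" using True st(2) by (simp add: frac_def)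
      moreover have "0 \<le> p (\<lfloor>t\<rfloor> + 1) - p \<lfloor>t\<rfloor>" using p[of "\<lfloor>t\<rfloor>"] fl False' by simp
      ultimately show ?thesis unfolding interp_def True by (intro add_left_mono mult_right_mono)
    qed
  next
    case False
    then have lt: "\<lfloor>s\<rfloor> < \<lfloor>t\<rfloor>" using fl by simp
    have tle: "\<lfloor>t\<rfloor> \<le> n" using st(3) by linarith
    have "interp p s \<le> p (\<lfloor>s\<rfloor> + 1)" using interp_bounds(2)[of p s] p[of "\<lfloor>s\<rfloor>"] fl lt tle by simp
    also have "\<dots> \<le> p \<lfloor>t\<rfloor>" using chain[of "\<lfloor>s\<rfloor> + 1" "nat (\<lfloor>t\<rfloor> - (\<lfloor>s\<rfloor> + 1))"] fl lt tle by simp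
    also have "\<dots> \<le> interp p t" by (rule tl)
    finally show ?thesis .
  qed
qed

text \<open>Interpolation commutes with subtracting a linear function, so both slope bounds become
  monotonicity statements, with c and C the extreme knot increments.\<close>

lemma interp_bilipschitz:
  assumes p: "\<And>z. p z < p (z + 1)" and N: "0 < N"
  shows "\<exists>c>0. \<exists>C>0. \<forall>s t. - of_int N \<le> s \<longrightarrow> s \<le> t \<longrightarrow> t \<le> of_int N \<longrightarrow>
    c * (t - s) \<le> interp p t - interp p s \<and> interp p t - interp p s \<le> C * (t - s)"
proof -
  let ?I = "{- N..<N}"
  have fin: "finite ?I" "?I \<noteq> {}" using N by auto
  define c where "c = Min ((\<lambda>z. p (z + 1) - p z) ` ?I)"
  define C where "C = Max ((\<lambda>z. p (z + 1) - p z) ` ?I)"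
  have c: "c \<le> p (z + 1) - p z" "p (z + 1) - p z \<le> C" if "- N \<le> z" "z < N" for z
    unfolding c_def C_def using fin that by (auto intro!: Min_le Max_ge)
  have c0: "0 < c" unfolding c_def using fin p by (subst Min_gr_iff) auto
  have C0: "0 < C" using c[of 0] N p[of 0] by linarith
  have lin1: "interp (\<lambda>z. p z - c * of_int z) t = interp p t - c * t" for t
    unfolding interp_def frac_def by (simp add: algebra_simps)
  have lin2: "interp (\<lambda>z. C * of_int z - p z) t = C * t - interp p t" for t
    unfolding interp_def frac_def by (simp add: algebra_simps)
  have "c * (t - s) \<le> interp p t - interp p s \<and> interp p t - interp p s \<le> C * (t - s)"
    if st: "- of_int N \<le> s" "s \<le> t" "t \<le> of_int N" for s t
  proof -
    have "interp (\<lambda>z. p z - c * of_int z) s \<le> interp (\<lambda>z. p z - c * of_int z) t"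
      by (rule interp_mono[of "- N" N]) (use c(1) st in \<open>auto simp: algebra_simps\<close>)
    moreover have "interp (\<lambda>z. C * of_int z - p z) s \<le> interp (\<lambda>z. C * of_int z - p z) t"
      by (rule interp_mono[of "- N" N]) (use c(2) st in \<open>auto simp: algebra_simps\<close>)
    ultimately show ?thesis unfolding lin1 lin2 by (simp add: algebra_simps)
  qed
  then show ?thesis using c0 C0 by blast
qed

locale increasing_knots =
  fixes p :: "int \<Rightarrow> real"
  assumes p_pos: "\<And>z. 0 < p z" and p_less: "\<And>z. p z < p (z + 1)"
    and p_zero: "(\<lambda>n. p (- int n)) \<longlonglongrightarrow> 0" and p_unbounded: "\<And>M. \<exists>z. M \<le> p z"
begin

text \<open>The knot \<open>p z\<close> is attained at exp z. As z tends to minus infinity these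
  points accumulate at 0, where the value 0 continues the path.\<close>

definition path :: "real \<Rightarrow> real" where
  "path r = (if r \<le> 0 then 0 else interp p (ln r))"

lemma path_between_knots:
  assumes "0 < r" shows "p \<lfloor>ln r\<rfloor> \<le> path r" "path r \<le> p (\<lfloor>ln r\<rfloor> + 1)"
  using assms interp_bounds[of p "ln r"] p_less[of "\<lfloor>ln r\<rfloor>"] by (auto simp: path_def)

lemma path_bilipschitz:
  assumes r: "0 < r1" "r1 \<le> r2"
  shows "\<exists>c>0. \<exists>C>0. \<forall>r s. r1 \<le> r \<longrightarrow> r \<le> s \<longrightarrow> s \<le> r2 \<longrightarrow>
    c * (s - r) \<le> path s - path r \<and> path s - path r \<le> C * (s - r)"
proof -
  define N where "N = max 1 (max \<lceil>\<bar>ln r1\<bar>\<rceil> \<lceil>\<bar>ln r2\<bar>\<rceil>)"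
  have N: "0 < N" "\<bar>ln r1\<bar> \<le> of_int N" "\<bar>ln r2\<bar> \<le> of_int N"
  proof -
    have "\<lceil>\<bar>ln r1\<bar>\<rceil> \<le> N" "\<lceil>\<bar>ln r2\<bar>\<rceil> \<le> N" "1 \<le> N" by (auto simp: N_def)
    then show "0 < N" "\<bar>ln r1\<bar> \<le> of_int N" "\<bar>ln r2\<bar> \<le> of_int N" by (auto simp: ceiling_le_iff)
  qed
  obtain c C where c: "0 < c" "0 < C" and cC: "\<And>s t. - of_int N \<le> s \<Longrightarrow> s \<le> t \<Longrightarrow> t \<le> of_int N \<Longrightarrow>
      c * (t - s) \<le> interp p t - interp p s \<and> interp p t - interp p s \<le> C * (t - s)"
    using interp_bilipschitz[of p N] p_less N(1) by blast
  \<comment> \<open>On [r1, r2] the slope of ln lies between 1/r2 and 1/r1, which turns the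
    interpolation constants c and C into c / r2 and C / r1.\<close>
  have "c / r2 * (s - r) \<le> path s - path r \<and> path s - path r \<le> C / r1 * (s - r)"
    if rs: "r1 \<le> r" "r \<le> s" "s \<le> r2" for r s
  proof -
    have pos: "0 < r" "0 < s" using r rs by linarith+
    have l: "ln r1 \<le> ln r" "ln r \<le> ln s" "ln s \<le> ln r2" using r rs pos by auto
    then have b: "c * (ln s - ln r) \<le> path s - path r \<and> path s - path r \<le> C * (ln s - ln r)"
      using cC[of "ln r" "ln s"] N pos by (simp add: path_def)
    have "ln s - ln r \<le> (s - r) / r" using ln_diff_le[OF pos(2,1)] .
    also have "\<dots> \<le> (s - r) / r1" using rs r by (intro divide_left_mono) auto
    finally have u: "ln s - ln r \<le> (s - r) / r1" .
    have "(s - r) / r2 \<le> (s - r) / s" using rs r pos by (intro divide_left_mono) auto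
    also have "\<dots> \<le> ln s - ln r"
    proof -
      have "ln r - ln s \<le> (r - s) / s" by (rule ln_diff_le[OF pos])
      also have "(r - s) / s = - ((s - r) / s)" by (simp add: diff_divide_distrib)
      finally show ?thesis by linarith
    qed
    finally have d: "(s - r) / r2 \<le> ln s - ln r" .
    have "c * ((s - r) / r2) \<le> c * (ln s - ln r)" by (rule mult_left_mono[OF d less_imp_le[OF c(1)]])
    moreover have "C * (ln s - ln r) \<le> C * ((s - r) / r1)" by (rule mult_left_mono[OF u less_imp_le[OF c(2)]])
    ultimately show ?thesis using b by simp
  qed
  then show ?thesis using c r by (intro exI[of _ "c / r2"] conjI exI[of _ "C / r1"]) auto
qed

lemma path_less: assumes "0 \<le> r" "r < s" shows "path r < path s"
proof (cases "r = 0")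
  case True
  have "p \<lfloor>ln s\<rfloor> \<le> path s" by (rule path_between_knots) (use assms in simp)
  then show ?thesis using True p_pos[of "\<lfloor>ln s\<rfloor>"] by (simp add: path_def)
next
  case False
  then obtain c where "0 < c" "c * (s - r) \<le> path s - path r"
    using path_bilipschitz[of r s] assms by auto
  moreover have "0 < c * (s - r)" using \<open>0 < c\<close> assms by simp
  ultimately show ?thesis by linarith
qed

lemma path_continuous: "continuous_on {0..} path"
  unfolding continuous_on_eq_continuous_within
proof
  fix r :: real assume "r \<in> {0..}"
  then consider "r = 0" | "0 < r" by fastforce
  then show "continuous (at r within {0..}) path"
  proof cases
    case 1
    have "(path \<longlongrightarrow> 0) (at 0 within {0..})"
    proof (rule tendstoI)
      fix e :: real assume "0 < e"
      have "\<forall>\<^sub>F n in sequentially. p (- int n) < e" by (rule order_tendstoD(2)[OF p_zero \<open>0 < e\<close>])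
      then obtain n where n: "p (- int n) < e" unfolding eventually_sequentially by blast
      show "\<forall>\<^sub>F x in at 0 within {0..}. dist (path x) 0 < e"
        unfolding eventually_at
      proof (intro exI[of _ "exp (- real n)"] conjI ballI impI)
        fix x :: real assume "x \<in> {0..}" and xn: "x \<noteq> 0 \<and> dist x 0 < exp (- real n)"
        then have x: "0 < x" "x < exp (- real n)" by (auto simp: dist_real_def)
        have "path x < path (exp (- real n))" by (rule path_less) (use x in auto)
        also have "path (exp (- real n)) = p (- int n)" using interp_of_int[of p "- int n"] by (simp add: path_def)
        finally have "path x < e" using n by simp
        moreover have "0 < path x" using path_less[of 0 x] x by (simp add: path_def)
        ultimately show "dist (path x) 0 < e" by (simp add: dist_real_def)
      qed simp
    qed
    then show ?thesis using 1 by (simp add: continuous_within path_def)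
  next
    case 2
    then obtain C where C: "0 < C" "\<And>x y. r / 2 \<le> x \<Longrightarrow> x \<le> y \<Longrightarrow> y \<le> 2 * r \<Longrightarrow> path y - path x \<le> C * (y - x)"
      using path_bilipschitz[of "r / 2" "2 * r"] by auto
    have le: "path x \<le> path y" if "r / 2 \<le> x" "x \<le> y" for x y
      using path_less[of x y] that 2 by (cases "x = y") auto
    have "C-lipschitz_on {r / 2..2 * r} path"
    proof (rule lipschitz_onI)
      fix x y assume xy: "x \<in> {r / 2..2 * r}" "y \<in> {r / 2..2 * r}"
      show "dist (path x) (path y) \<le> C * dist x y"
      proof (cases "x \<le> y")
        case True
        then show ?thesis using C(2)[of x y] le[of x y] xy by (simp add: dist_real_def)
      next
        case False
        then show ?thesis using C(2)[of y x] le[of y x] xy by (simp add: dist_real_def)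
      qed
    qed (use C in simp)
    then have "continuous_on {r / 2..2 * r} path" by (rule lipschitz_on_continuous_on)
    then have "continuous_on {r / 2<..<2 * r} path" by (rule continuous_on_subset) auto
    then have "isCont path r" using 2 by (simp add: continuous_on_eq_continuous_at)
    then show ?thesis using continuous_at_imp_continuous_at_within by blast
  qed
qed

lemma class_K_inf_path: "class_K_inf path"
proof -
  have "class_K path" by (rule class_KI[OF path_continuous path_less]) (auto simp: path_def)
  moreover have "\<exists>r\<ge>0. M \<le> path r" for M
  proof -
    obtain z where "M \<le> p z" using p_unbounded by blast
    then have "M \<le> path (exp (of_int z))" by (simp add: path_def)
    then show ?thesis by (intro exI[of _ "exp (of_int z)"]) simp
  qed
  ultimately show ?thesis by (simp add: class_K_inf_iff)
qed

lemma inv_path_bilipschitz: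
  assumes lh: "0 < l" "l \<le> h"
  shows "\<exists>c>0. \<exists>C>0. \<forall>y z. l \<le> y \<longrightarrow> y \<le> z \<longrightarrow> z \<le> h \<longrightarrow>
    c * (z - y) \<le> inv_K path z - inv_K path y \<and> inv_K path z - inv_K path y \<le> C * (z - y)"
proof -
  have iK: "class_K (inv_K path)" using class_K_inf_inv_K[OF class_K_inf_path] class_K_infD by blast
  have r: "0 < inv_K path l" "inv_K path l \<le> inv_K path h"
    using class_K_pos[OF iK lh(1)] class_K_mono[OF iK _ lh(2)] lh by auto
  obtain c C where c: "0 < c" "0 < C" and cC: "\<And>r s. inv_K path l \<le> r \<Longrightarrow> r \<le> s \<Longrightarrow> s \<le> inv_K path h \<Longrightarrow>
      c * (s - r) \<le> path s - path r \<and> path s - path r \<le> C * (s - r)"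
    using path_bilipschitz[OF r] by blast
  have "1 / C * (z - y) \<le> inv_K path z - inv_K path y \<and> inv_K path z - inv_K path y \<le> 1 / c * (z - y)"
    if yz: "l \<le> y" "y \<le> z" "z \<le> h" for y z
  proof -
    have y0: "0 \<le> y" "0 \<le> z" "0 \<le> l" using lh yz by linarith+
    have "c * (inv_K path z - inv_K path y) \<le> path (inv_K path z) - path (inv_K path y) \<and>
        path (inv_K path z) - path (inv_K path y) \<le> C * (inv_K path z - inv_K path y)"
      by (rule cC) (use class_K_mono[OF iK] y0 yz in auto)
    then have "c * (inv_K path z - inv_K path y) \<le> z - y \<and> z - y \<le> C * (inv_K path z - inv_K path y)"
      using inv_K_props(2)[OF class_K_inf_path] y0 by simp
    then show ?thesis using c by (simp add: field_simps)
  qed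
  then show ?thesis using c by (intro exI[of _ "1 / C"] conjI exI[of _ "1 / c"]) auto
qed

lemma inv_path_loc_lipschitz: "loc_lipschitz_on {0<..} (inv_K path)"
  unfolding loc_lipschitz_on_def
proof
  fix y :: real assume "y \<in> {0<..}"
  then have y: "0 < y" by simp
  obtain c C where c: "0 < c" "0 < C" and cC: "\<And>u v. y / 2 \<le> u \<Longrightarrow> u \<le> v \<Longrightarrow> v \<le> 2 * y \<Longrightarrow>
      c * (v - u) \<le> inv_K path v - inv_K path u \<and> inv_K path v - inv_K path u \<le> C * (v - u)"
    using inv_path_bilipschitz[of "y / 2" "2 * y"] y by auto
  have ab: "\<bar>inv_K path v - inv_K path u\<bar> \<le> C * (v - u)" if "y / 2 \<le> u" "u \<le> v" "v \<le> 2 * y" for u v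
  proof -
    have "0 \<le> c * (v - u)" using c that by simp
    then show ?thesis using cC[OF that] by linarith
  qed
  have "C-lipschitz_on {y / 2..2 * y} (inv_K path)"
  proof (rule lipschitz_onI)
    fix u v assume "u \<in> {y / 2..2 * y}" "v \<in> {y / 2..2 * y}"
    then show "dist (inv_K path u) (inv_K path v) \<le> C * dist u v"
      using ab[of u v] ab[of v u] by (cases "u \<le> v") (auto simp: dist_real_def abs_minus_commute)
  qed (use c in simp)
  then have "C-lipschitz_on (cball y (y / 2) \<inter> {0<..}) (inv_K path)"
  proof (rule lipschitz_on_subset)
    show "cball y (y / 2) \<inter> {0<..} \<subseteq> {y / 2..2 * y}"
    proof
      fix x assume "x \<in> cball y (y / 2) \<inter> {0<..}"
      then have "\<bar>y - x\<bar> \<le> y / 2" by (simp add: dist_real_def)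
      then have "y / 2 \<le> x" "x \<le> 2 * y" using y by linarith+
      then show "x \<in> {y / 2..2 * y}" by simp
    qed
  qed
  then show "\<exists>e>0. \<exists>L. L-lipschitz_on (cball y e \<inter> {0<..}) (inv_K path)"
    using y by (intro exI[of _ "y / 2"]) auto
qed

lemma inv_path_deriv_bounds:
  assumes K: "compact K" "K \<subseteq> {0<..}"
  shows "\<exists>c>0. \<exists>C. \<forall>r\<in>K. \<forall>d. (inv_K path has_real_derivative d) (at r) \<longrightarrow> c \<le> d \<and> d \<le> C"
proof (cases "K = {}")
  case False
  obtain l h where l: "l \<in> K" "\<forall>r\<in>K. l \<le> r" and h: "\<forall>r\<in>K. r \<le> h"
    using compact_attains_inf[OF K(1) False] compact_attains_sup[OF K(1) False] by blast
  \<comment> \<open>The additional 1 leaves room for right difference quotients at the largest point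
    of K.\<close>
  have lh: "0 < l" "l \<le> h + 1" using l h K(2) by force+
  obtain c C where c: "0 < c" and cC: "\<And>y z. l \<le> y \<Longrightarrow> y \<le> z \<Longrightarrow> z \<le> h + 1 \<Longrightarrow>
      c * (z - y) \<le> inv_K path z - inv_K path y \<and> inv_K path z - inv_K path y \<le> C * (z - y)"
    using inv_path_bilipschitz[OF lh] by blast
  have "c \<le> d \<and> d \<le> C" if r: "r \<in> K" and d: "(inv_K path has_real_derivative d) (at r)" for r d
  proof -
    have "((\<lambda>k. (inv_K path (r + k) - inv_K path r) / k) \<longlongrightarrow> d) (at 0)" using d by (simp add: DERIV_def)
    then have lim: "((\<lambda>k. (inv_K path (r + k) - inv_K path r) / k) \<longlongrightarrow> d) (at_right 0)"
      by (rule tendsto_within_subset) simp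
    have ev: "\<forall>\<^sub>F k in at_right 0. 0 < k \<and> k < (1 :: real)"
      unfolding eventually_at_right_field by (intro exI[of _ 1]) auto
    have b: "c \<le> (inv_K path (r + k) - inv_K path r) / k \<and> (inv_K path (r + k) - inv_K path r) / k \<le> C"
      if "0 < k \<and> k < 1" for k
    proof -
      have "l \<le> r" "r \<le> h" using l h r by auto
      then show ?thesis using cC[of r "r + k"] that by (simp add: pos_le_divide_eq pos_divide_le_eq)
    qed
    have "c \<le> d" by (rule tendsto_lowerbound[OF lim]) (use ev b in \<open>auto elim: eventually_mono\<close>)
    moreover have "d \<le> C" by (rule tendsto_upperbound[OF lim]) (use ev b in \<open>auto elim: eventually_mono\<close>)
    ultimately show ?thesis by blast
  qed
  then show ?thesis using c by blast
qed (auto intro: exI[of _ 1])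

end

theorem (in irreducible_operator) Omega_path_exists: "\<exists>\<sigma>. Omega_path T \<sigma>"
proof -
  obtain p :: "int \<Rightarrow> real ^ 'n" where p: "\<And>z i. 0 < p z $ i" "\<And>z i. p z $ i < p (z + 1) $ i"
    "\<And>z i. T (p (z + 1)) $ i < p z $ i" "\<And>i. (\<lambda>n. p (- int n) $ i) \<longlonglongrightarrow> 0" "\<And>i M. \<exists>z. M \<le> p z $ i"
    using strict_decay_sequence by blast
  have knots: "increasing_knots (\<lambda>z. p z $ i)" for i
    by unfold_locales (rule p)+
  define \<sigma> where "\<sigma> i = increasing_knots.path (\<lambda>z. p z $ i)" for i
  note facts = increasing_knots.class_K_inf_path[OF knots, folded \<sigma>_def]
    increasing_knots.inv_path_loc_lipschitz[OF knots, folded \<sigma>_def]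
    increasing_knots.inv_path_deriv_bounds[OF knots, folded \<sigma>_def]
    increasing_knots.path_between_knots[OF knots, folded \<sigma>_def]
  have "\<exists>c C. 0 < c \<and> c < C \<and> (\<forall>i. \<forall>r\<in>K. \<forall>d. (inv_K (\<sigma> i) has_real_derivative d) (at r) \<longrightarrow> c \<le> d \<and> d \<le> C)"
    if K: "compact K" "K \<subseteq> {0<..}" for K
  proof -
    define P where "P i c C \<longleftrightarrow> 0 < c \<and> (\<forall>r\<in>K. \<forall>d. (inv_K (\<sigma> i) has_real_derivative d) (at r) \<longrightarrow> c \<le> d \<and> d \<le> C)" for i c C
    have "\<forall>i. \<exists>c. \<exists>C. P i c C" using facts(3)[OF K] unfolding P_def by blast
    then obtain c C where P: "\<And>i. P i (c i) (C i)" unfolding choice_iff by blast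
    define c0 where "c0 = Min (range c)"
    \<comment> \<open>The alternative \<open>c0 + 1\<close> secures the strict inequality between
      the two bounds.\<close>
    define C0 where "C0 = max (c0 + 1) (Max (range C))"
    have "c0 \<in> range c" unfolding c0_def by (rule Min_in) simp_all
    then have "0 < c0" using P by (auto simp: P_def)
    moreover have "c0 < C0" by (simp add: C0_def less_max_iff_disj)
    moreover have "c0 \<le> d \<and> d \<le> C0" if "r \<in> K" "(inv_K (\<sigma> i) has_real_derivative d) (at r)" for i r d
    proof -
      have "c0 \<le> c i" unfolding c0_def by (rule Min_le) simp_all
      moreover have "C i \<le> Max (range C)" by (rule Max_ge) simp_all
      then have "C i \<le> C0" unfolding C0_def by (rule max.coboundedI2)
      ultimately show ?thesis using P[of i] that unfolding P_def by (meson order_trans)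
    qed
    ultimately show ?thesis by blast
  qed
  moreover have "vless (T (\<chi> i. \<sigma> i r)) (\<chi> i. \<sigma> i r)" if r: "0 < r" for r
  proof -
    \<comment> \<open>All components have their knots at the same parameters exp z. So the path at r
      lies between p ?z and p (?z + 1), and monotonicity gives T (path r) \<le> T (p (?z + 1)) < p
      ?z \<le> path r.\<close>
    let ?z = "\<lfloor>ln r\<rfloor>"
    have lo: "p ?z $ i \<le> \<sigma> i r" and up: "\<sigma> i r \<le> p (?z + 1) $ i" for i using facts(4,5)[OF r] by auto
    have "0 \<le> (\<chi> i. \<sigma> i r)" using lo p(1) by (simp add: vec_nonneg_iff) (meson less_imp_le order_trans)
    moreover have "(\<chi> i. \<sigma> i r) \<le> p (?z + 1)" using up by (simp add: less_eq_vec_def)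
    ultimately have "T (\<chi> i. \<sigma> i r) \<le> T (p (?z + 1))" by (rule T_mono)
    then have "T (\<chi> i. \<sigma> i r) $ i < \<sigma> i r" for i
      using p(3)[of ?z i] lo[of i] unfolding less_eq_vec_def by (meson le_less_trans less_le_trans)
    then show ?thesis by (simp add: vless_def)
  qed
  ultimately have "Omega_path T \<sigma>" unfolding Omega_path_def using facts(1,2) by blast
  then show ?thesis by blast
qed

section \<open>Omega-paths of gain operators\<close>

context gain_network
begin

text \<open>\<open>MAF\<close> does not force the value 0 at the origin. A positive component of the
  gain operator at 0 would make the point with just this component violate the small gain
  condition.\<close>

lemma gain_op_zero:
  assumes \<alpha>: "class_K_inf \<alpha>"
    and sg: "\<And>s. 0 \<le> s \<Longrightarrow> s \<noteq> 0 \<Longrightarrow> \<not> s \<le> (diag_op \<alpha> \<circ> gain_op \<mu> \<gamma> \<gamma>u) s"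
  shows "gain_op \<mu> \<gamma> \<gamma>u 0 = 0"
proof (rule ccontr)
  let ?G = "gain_op \<mu> \<gamma> \<gamma>u"
  assume "?G 0 \<noteq> 0"
  then obtain i where "?G 0 $ i \<noteq> 0" by (auto simp: vec_eq_iff)
  then have pos: "0 < ?G 0 $ i" using gain_op_nonneg[of 0] by (simp add: vec_nonneg_iff less_le)
  define s where "s = axis i (?G 0 $ i)"
  have s: "0 \<le> s" "s \<noteq> 0" using pos by (auto simp: s_def vec_nonneg_iff axis_def vec_eq_iff)
  have G: "0 \<le> ?G s $ j" "?G 0 $ j \<le> ?G s $ j" for j
    using gain_op_nonneg[OF s(1)] gain_op_mono[OF order_refl s(1)] by (auto simp: less_eq_vec_def)
  have "s $ j \<le> ?G s $ j + \<alpha> (?G s $ j)" for j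
    using G[of j] class_K_nonneg[OF class_K_infD[OF \<alpha>] G(1)[of j]] by (auto simp: s_def axis_def)
  then have "s \<le> (diag_op \<alpha> \<circ> ?G) s" by (simp add: less_eq_vec_def diag_op_def)
  then show False using sg[OF s] by blast
qed

lemma MAF_proper:
  assumes "MAF m" shows "\<exists>R. \<forall>x\<ge>0. R \<le> norm x \<longrightarrow> M \<le> m x"
proof -
  have "filterlim m at_top (inf at_infinity (principal {s. 0 \<le> s}))" using assms by (simp add: MAF_def)
  then have "\<forall>\<^sub>F x in inf at_infinity (principal {s. 0 \<le> s}). M \<le> m x" by (simp add: filterlim_at_top)
  then show ?thesis unfolding eventually_inf_principal eventually_at_infinity by blast
qed

theorem Omega_path_exists:
  assumes \<alpha>: "class_K_inf \<alpha>"
    and sg: "\<And>s. 0 \<le> s \<Longrightarrow> s \<noteq> 0 \<Longrightarrow> \<not> s \<le> (diag_op \<alpha> \<circ> gain_op \<mu> \<gamma> \<gamma>u) s"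
    and irr: "irreducible_matrix (adjacency_matrix \<gamma>)"
  shows "\<exists>\<sigma>. Omega_path (diag_op \<alpha> \<circ> gain_op \<mu> \<gamma> \<gamma>u) \<sigma>"
proof -
  let ?G = "gain_op \<mu> \<gamma> \<gamma>u"
  let ?T = "diag_op \<alpha> \<circ> ?G"
  define E where "E i j \<longleftrightarrow> \<not> zero_fun (\<gamma> i j)" for i j
  have K\<alpha>: "class_K \<alpha>" using \<alpha> class_K_infD by blast
  have E_irr: "\<exists>i\<in>I. \<exists>j\<in>- I. E i j" if "I \<noteq> {}" "I \<noteq> UNIV" for I
    using irr that unfolding irreducible_matrix_def adjacency_matrix_def E_def by auto
  have T_nth: "?T s $ i = ?G s $ i + \<alpha> (?G s $ i)" for s i by (simp add: diag_op_def)
  have G_nn: "0 \<le> ?G s $ i" if "0 \<le> s" for s i using gain_op_nonneg[OF that] by (simp add: vec_nonneg_iff)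
  have T_ge: "?G s $ i \<le> ?T s $ i" if "0 \<le> s" for s i
    unfolding T_nth using class_K_nonneg[OF K\<alpha> G_nn[OF that]] by simp
  have T0: "?T 0 = 0" using gain_op_zero[OF \<alpha> sg] class_K_0[OF K\<alpha>] by (simp add: vec_eq_iff diag_op_def)
  \<comment> \<open>Irreducibility provides an edge in every column except for a single subsystem,
    whose zero matrix of size one counts as irreducible.\<close>
  show ?thesis
  proof (cases "\<forall>j. \<exists>i. E i j")
    case True
    interpret irreducible_operator ?T E
    proof
      show "?T s \<le> ?T t" if "0 \<le> s" "s \<le> t" for s t
      proof -
        have le: "?G s $ i \<le> ?G t $ i" for i using gain_op_mono[OF that] by (simp add: less_eq_vec_def)
        have "?T s $ i \<le> ?T t $ i" for i
          unfolding T_nth by (rule add_mono[OF le class_K_mono[OF K\<alpha> G_nn[OF that(1)] le]])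
        then show ?thesis by (simp add: less_eq_vec_def)
      qed
      have Gc: "continuous_on {s. 0 \<le> s} (\<lambda>s. ?G s $ i)" for i
        unfolding gain_op_nth
        by (rule continuous_on_gain_arg) (auto intro!: continuous_on_component continuous_on_id simp: vec_nonneg_iff)
      have "continuous_on {s. 0 \<le> s} (\<lambda>s. \<alpha> (?G s $ i))" for i
        by (rule continuous_on_compose2[OF class_K_continuous_on[OF K\<alpha> order_refl] Gc]) (use G_nn in auto)
      then show "continuous_on {s. 0 \<le> s} ?T"
        unfolding o_def diag_op_def using Gc by (intro continuous_on_vec_lambda continuous_on_add)
      show "?T 0 = 0" by (rule T0)
      show "\<not> s \<le> ?T s" if "0 \<le> s" "s \<noteq> 0" for s by (rule sg[OF that])
      show "0 < ?T s $ i" if "E i j" "0 \<le> s" "0 < s $ j" for i j s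
      proof -
        have "class_K (\<gamma> i j)" using gains[of i j] that(1) class_K_infD unfolding E_def by blast
        then have "0 < \<gamma> i j (s $ j)" using class_K_pos that(3) by blast
        then have "extend (\<chi> j. \<gamma> i j (s $ j)) 0 $ Some j \<noteq> 0" by simp
        then have "extend (\<chi> j. \<gamma> i j (s $ j)) 0 \<noteq> 0" by (metis zero_index)
        from MAF_pos[OF \<mu>_MAF gain_arg_nonneg[OF that(2) order_refl] this] have "0 < ?G s $ i"
          by (simp add: gain_op_nth)
        then show ?thesis using T_ge[OF that(2), of i] by linarith
      qed
      show "\<exists>C. \<forall>s\<ge>0. C \<le> s $ j \<longrightarrow> M \<le> ?T s $ i" if e: "E i j" for i j M
      proof -
        obtain R where R: "\<And>x. 0 \<le> x \<Longrightarrow> R \<le> norm x \<Longrightarrow> M \<le> \<mu> i x" using MAF_proper[OF \<mu>_MAF] by blast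
        have K: "class_K_inf (\<gamma> i j)" using gains[of i j] e unfolding E_def by blast
        then obtain C where C: "0 \<le> C" "R \<le> \<gamma> i j C" using class_K_inf_iff by blast
        have "M \<le> ?T s $ i" if s: "0 \<le> s" "C \<le> s $ j" for s
        proof -
          let ?x = "extend (\<chi> j. \<gamma> i j (s $ j)) 0"
          have "R \<le> \<gamma> i j (s $ j)" using class_K_mono[OF class_K_infD[OF K] C(1) s(2)] C(2) by linarith
          also have "\<dots> = ?x $ Some j" by simp
          also have "\<dots> \<le> norm ?x" using component_le_norm_cart[of ?x "Some j"] by linarith
          finally have "M \<le> ?G s $ i"
            unfolding gain_op_nth by (intro R gain_arg_nonneg s(1)) auto
          then show ?thesis using T_ge[OF s(1), of i] by linarith
        qed
        then show ?thesis by blast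
      qed
      show "\<exists>i\<in>I. \<exists>j\<in>- I. E i j" if "I \<noteq> {}" "I \<noteq> UNIV" for I by (rule E_irr[OF that])
      show "\<exists>i. E i j" for j using True by blast
    qed
    show ?thesis by (rule Omega_path_exists)
  next
    case False
    then obtain j where j: "\<And>i. \<not> E i j" by blast
    \<comment> \<open>Irreducibility applied to the complement of j would give an edge in column j,
      so that complement is empty.\<close>
    have "- {j} = {}"
      using E_irr[of "- {j}"] j by auto
    then have single: "i = j" for i by auto
    then have noE: "\<not> E i k" for i k using j by metis
    have T_zero: "?T s = 0" if "0 \<le> s" for s
    proof -
      have "\<gamma> i k (s $ k) = 0" for i k using noE[of i k] that by (simp add: E_def zero_fun_def vec_nonneg_iff)
      then have "?G s = ?G 0" by (simp add: vec_eq_iff gain_op_nth gain_0)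
      then show ?thesis using T0 by simp
    qed
    \<comment> \<open>As the operator vanishes, every positive path decays under it. The regularity
      properties are borrowed from an Omega-path of s -> s/2, whose graph has all edges.\<close>
    interpret half: irreducible_operator "\<lambda>s :: real ^ 'n. (1 / 2) *\<^sub>R s" "\<lambda>_ _. True"
    proof
      show "\<not> s \<le> (1 / 2) *\<^sub>R s" if "0 \<le> s" "s \<noteq> 0" for s :: "real ^ 'n"
      proof
        assume "s \<le> (1 / 2) *\<^sub>R s"
        then have "s $ i \<le> 0" for i by (simp add: less_eq_vec_def)
        then have "s \<le> 0" by (simp add: less_eq_vec_def)
        then show False using that by (metis order_antisym)
      qed
      show "0 < ((1 / 2) *\<^sub>R s) $ i" if "0 < s $ k" for i k :: 'n and s :: "real ^ 'n"
        using that single[of i] single[of k] by simp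
      show "\<exists>C. \<forall>s\<ge>0. C \<le> s $ k \<longrightarrow> M \<le> ((1 / 2) *\<^sub>R s) $ i" for i k :: 'n and M :: real
        using single[of i] single[of k] by (intro exI[of _ "2 * M"]) simp
    qed (auto simp: less_eq_vec_def intro!: continuous_intros)
    obtain \<sigma> where \<sigma>: "Omega_path (\<lambda>s :: real ^ 'n. (1 / 2) *\<^sub>R s) \<sigma>" using half.Omega_path_exists by blast
    note parts = \<sigma>[unfolded Omega_path_def]
    have below: "vless (?T (\<chi> i. \<sigma> i r)) (\<chi> i. \<sigma> i r)" if r: "0 < r" for r
    proof -
      have pos: "0 < \<sigma> i r" for i
        by (rule class_K_pos[OF class_K_infD[OF parts[THEN conjunct1, rule_format]] r])
      then have "0 \<le> (\<chi> i. \<sigma> i r)" by (simp add: vec_nonneg_iff less_imp_le)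
      from T_zero[OF this] show ?thesis using pos by (simp add: vless_def)
    qed
    have "Omega_path ?T \<sigma>"
      unfolding Omega_path_def
      by (intro conjI parts[THEN conjunct1] parts[THEN conjunct2, THEN conjunct1]
          parts[THEN conjunct2, THEN conjunct2, THEN conjunct1]) (use below in blast)
    then show ?thesis by blast
  qed
qed

end

theorem corollary5p6:
  fixes blk :: "'m::finite \<Rightarrow> 'n::finite"
    and f :: "real ^ 'm \<Rightarrow> real ^ 'p::finite \<Rightarrow> real ^ 'm"
    and V :: "'n \<Rightarrow> real ^ 'm \<Rightarrow> real"
    and \<mu> :: "'n \<Rightarrow> real ^ ('n option) \<Rightarrow> real"
    and \<gamma> :: "'n \<Rightarrow> 'n \<Rightarrow> real \<Rightarrow> real"
    and \<gamma>u :: "'n \<Rightarrow> real \<Rightarrow> real"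
    and \<alpha> :: "real \<Rightarrow> real"
  assumes blocks_nonempty: "surj blk"
    and f_continuous: "continuous_on UNIV (\<lambda>(x, u). f x u)"
    and well_posed: "\<And>i. subsystem_well_posed blk f i"
    and \<mu>_MAF: "\<And>i. MAF (\<mu> i)"
    and gains: "\<And>i j. class_K_inf (\<gamma> i j) \<or> zero_fun (\<gamma> i j)"
    and gains_diag: "\<And>i. zero_fun (\<gamma> i i)"
    and gains_input: "\<And>i. class_K (\<gamma>u i) \<or> zero_fun (\<gamma>u i)"
    and compat: "\<And>i. compatible (\<mu> i) (\<gamma> i)"
    and candidates: "\<And>i. lyapunov_candidate (block_space blk i) (V i)"
    and lyapunov: "\<And>i. subsystem_ISS_lyapunov blk f V \<mu> \<gamma> \<gamma>u i"
    and additive: "\<And>(x :: real ^ 'm) (u :: real ^ 'p).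
      gain_op_ext \<mu> \<gamma> \<gamma>u (\<chi> i. V i (block blk i x)) (norm u) =
      gain_op \<mu> \<gamma> \<gamma>u (\<chi> i. V i (block blk i x)) + (\<chi> i. \<gamma>u i (norm u))"
    and irreducible: "irreducible_matrix (adjacency_matrix \<gamma>)"
    and \<alpha>_K_inf: "class_K_inf \<alpha>"
    and small_gain: "\<And>s :: real ^ 'n. 0 \<le> s \<Longrightarrow> s \<noteq> 0 \<Longrightarrow>
      \<not> s \<le> (diag_op \<alpha> \<circ> gain_op \<mu> \<gamma> \<gamma>u) s"
  shows "ISS f \<and>
    (\<exists>\<sigma>. Omega_path (diag_op \<alpha> \<circ> gain_op \<mu> \<gamma> \<gamma>u) \<sigma>) \<and>
    (\<forall>\<sigma>. Omega_path (diag_op \<alpha> \<circ> gain_op \<mu> \<gamma> \<gamma>u) \<sigma> \<longrightarrow>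
      ISS_lyapunov f (\<lambda>x. MAX i. inv_K (\<sigma> i) (V i (block blk i x))))"
proof -
  interpret network: iss_network \<mu> \<gamma> \<gamma>u blk f V
    by unfold_locales (fact \<mu>_MAF gains gains_input blocks_nonempty f_continuous candidates lyapunov additive)+
  have lyap: "ISS_lyapunov f (\<lambda>x. MAX i. inv_K (\<sigma> i) (V i (block blk i x)))"
    if "Omega_path (diag_op \<alpha> \<circ> gain_op \<mu> \<gamma> \<gamma>u) \<sigma>" for \<sigma>
  proof -
    interpret omega_network \<mu> \<gamma> \<gamma>u blk f V \<alpha> \<sigma> by unfold_locales (fact \<alpha>_K_inf that)+
    show ?thesis by (rule Vmax_ISS_lyapunov)
  qed
  \<comment> \<open>ISS does not refer to a path, so one has to be exhibited.\<close>
  obtain \<sigma> where \<sigma>: "Omega_path (diag_op \<alpha> \<circ> gain_op \<mu> \<gamma> \<gamma>u) \<sigma>"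
    using network.Omega_path_exists[OF \<alpha>_K_inf small_gain irreducible] by blast
  have "ISS f" by (rule ISS_lyapunov_imp_ISS[OF f_continuous lyap[OF \<sigma>]])
  then show ?thesis using \<sigma> lyap by blast
qed

end
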